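(* There is a universal constant $C>0$ such that for every $d\ge 1$ and every rational map $f:\hat{\mathbb{C}}\to\hat{\mathbb{C}}$ of degree $d$, the derivative of its barycentric extension $\mathscr{E}f:\mathbb{H}^3\to\mathbb{H}^3$ satisfies $$\sup_{x\in\mathbb{H}^3}\|D\mathscr{E}f(x)\|\le C\deg(f),$$ where the operator norm of the derivative is computed with respect to the hyperbolic metric on source and target.
   Context: Identify $\hat{\mathbb{C}}$ with the unit sphere $S^2\subset\mathbb{R}^3$ by stereographic projection, and $\mathbb{H}^3$ with the open unit ball of $\mathbb{R}^3$ with its hyperbolic metric (curvature $-1$); $\mathbf 0$ is the center, and isometries of $\mathbb{H}^3$ extend to $S^2=\partial\mathbb{H}^3$. Let $\mu_{S^2}$ be the normalized (probability) spherical area measure. A probability measure $\mu$ on $S^2$ is balanced if $\int_{S^2}\zeta\,d\mu(\zeta)=\vec 0\in\mathbb{R}^3$, and balanced at $y\in\mathbb{H}^3$ if $M_*\mu$ is balanced for one (equivalently any) isometry $M$ of $\mathbb{H}^3$ with $M(y)=\mathbf 0$. An atomless probability measure on $S^2$ is balanced at a unique point of $\mathbb{H}^3$, its barycenter. For a non-constant rational map $f$, the barycentric extension $\mathscr{E}f:\mathbb{H}^3\to\mathbb{H}^3$ sends $x$ to the barycenter of $(f\circ M)_*\mu_{S^2}$, where $M$ is any isometry of $\mathbb{H}^3$ with $M(\mathbf 0)=x$. It is a real analytic map. *)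

theory Defs
  imports "HOL-Probability.Probability" "HOL-Computational_Algebra.Polynomial"
begin

text \<open>\<^term>\<open>None\<close> is the point at infinity.\<close>

type_synonym riemann_sphere = "complex option"

text \<open>The unit sphere is projected from its north pole, which corresponds to infinity.\<close>

definition stereo :: "real^3 \<Rightarrow> riemann_sphere" where
  "stereo \<zeta> = (if \<zeta> $ 3 = 1 then None
     else Some (Complex (\<zeta> $ 1 / (1 - \<zeta> $ 3)) (\<zeta> $ 2 / (1 - \<zeta> $ 3))))"

definition stereo_inv :: "riemann_sphere \<Rightarrow> real^3" where
  "stereo_inv w = (case w of
      None \<Rightarrow> vector [0, 0, 1]
    | Some z \<Rightarrow> (1 / ((norm z)\<^sup>2 + 1)) *\<^sub>R vector [2 * Re z, 2 * Im z, (norm z)\<^sup>2 - 1])"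

text \<open>
  For coprime \<open>p\<close> and \<open>q\<close>, the map \<open>p / q\<close> on the whole sphere. With
  \<open>n = max (degree p) (degree q)\<close>, the coefficients of index \<open>n\<close> are the values of the
  homogenisations of \<open>p\<close> and \<open>q\<close> at infinity, and they do not both vanish.
\<close>

definition rational_fun :: "complex poly \<Rightarrow> complex poly \<Rightarrow> riemann_sphere \<Rightarrow> riemann_sphere" where
  "rational_fun p q w = (case w of
      None \<Rightarrow> (let n = max (degree p) (degree q) in
                if coeff q n = 0 then None else Some (coeff p n / coeff q n))
    | Some z \<Rightarrow> (if poly q z = 0 then None else Some (poly p z / poly q z)))"

definition rational_map_of_degree :: "nat \<Rightarrow> (riemann_sphere \<Rightarrow> riemann_sphere) \<Rightarrow> bool" where
  "rational_map_of_degree d f \<longleftrightarrow>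
     (\<exists>p q. coprime p q \<and> max (degree p) (degree q) = d \<and> f = rational_fun p q)"

definition on_sphere :: "(riemann_sphere \<Rightarrow> riemann_sphere) \<Rightarrow> real^3 \<Rightarrow> real^3" where
  "on_sphere f = stereo_inv \<circ> f \<circ> stereo"

text \<open>
  The length of a tangent vector \<open>v\<close> at \<open>x\<close> for the metric \<open>2 |dx| / (1 - |x|\<^sup>2)\<close>, which has
  curvature \<open>-1\<close>, and the distance it induces.
\<close>

definition hyp_norm :: "real^3 \<Rightarrow> real^3 \<Rightarrow> real" where
  "hyp_norm x v = 2 * norm v / (1 - (norm x)\<^sup>2)"

definition hyp_dist :: "real^3 \<Rightarrow> real^3 \<Rightarrow> real" where
  "hyp_dist x y = arcosh (1 + 2 * (norm (x - y))\<^sup>2 / ((1 - (norm x)\<^sup>2) * (1 - (norm y)\<^sup>2)))"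

text \<open>
  An isometry is taken together with its continuous extension to the closed ball, which
  it determines uniquely. Values outside the closed ball are irrelevant.
\<close>

definition hyp_isometry :: "(real^3 \<Rightarrow> real^3) \<Rightarrow> bool" where
  "hyp_isometry M \<longleftrightarrow>
     bij_betw M (ball 0 1) (ball 0 1) \<and>
     (\<forall>x\<in>ball 0 1. \<forall>y\<in>ball 0 1. hyp_dist (M x) (M y) = hyp_dist x y) \<and>
     continuous_on (cball 0 1) M"

text \<open>The operator norm of \<open>T\<close> from the tangent space at \<open>x\<close> to the one at \<open>y\<close>.\<close>

definition hyp_onorm :: "real^3 \<Rightarrow> real^3 \<Rightarrow> (real^3 \<Rightarrow> real^3) \<Rightarrow> real" where
  "hyp_onorm x y T = (SUP v. hyp_norm y (T v) / hyp_norm x v)"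

abbreviation borel_S2 :: "(real^3) measure" where
  "borel_S2 \<equiv> restrict_space borel (sphere 0 1)"

text \<open>
  Surface area in the chart \<open>\<sigma> (x + i y) = stereo_inv (Some (x + i y))\<close>, which misses
  only one point of the sphere: \<open>|\<partial>\<^sub>x \<sigma> \<times> \<partial>\<^sub>y \<sigma>| = 4 / (1 + |z|\<^sup>2)\<^sup>2\<close>.
  The total area is \<open>4 \<pi>\<close>.
\<close>

definition area_S2 :: "(real^3) measure" where
  "area_S2 = distr (density lborel (\<lambda>z::complex. ennreal (4 / (1 + (norm z)\<^sup>2)\<^sup>2)))
               borel_S2 (\<lambda>z. stereo_inv (Some z))"

definition mu_S2 :: "(real^3) measure" where
  "mu_S2 = scale_measure (ennreal (1 / (4 * pi))) area_S2"

definition balanced :: "(real^3) measure \<Rightarrow> bool" where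
  "balanced \<mu> \<longleftrightarrow> prob_space \<mu> \<and> sets \<mu> = sets borel_S2 \<and> (\<integral>\<zeta>. \<zeta> \<partial>\<mu>) = 0"

definition balanced_at :: "(real^3) measure \<Rightarrow> real^3 \<Rightarrow> bool" where
  "balanced_at \<mu> y \<longleftrightarrow>
     y \<in> ball 0 1 \<and> (\<exists>M. hyp_isometry M \<and> M y = 0 \<and> balanced (distr \<mu> borel_S2 M))"

definition barycenter :: "(real^3) measure \<Rightarrow> real^3" where
  "barycenter \<mu> = (THE y. balanced_at \<mu> y)"

definition barycentric_extension :: "(riemann_sphere \<Rightarrow> riemann_sphere) \<Rightarrow> real^3 \<Rightarrow> real^3" where
  "barycentric_extension f x =
     barycenter (distr mu_S2 borel_S2 (on_sphere f \<circ> (SOME M. hyp_isometry M \<and> M 0 = x)))"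

end

theory Submission imports Defs
begin

text \<open>
  Isometries of source and target reduce the estimate to the derivative at \<open>0\<close> of an extension
  that fixes \<open>0\<close>, for \<open>\<phi>\<close> a rational map followed and preceded by isometries. Expanding the
  equation that says that \<open>y\<close> is the barycenter of the image of the measure with density
  \<open>poisson x\<close> gives \<open>(I - A) y = 2 B x + O(|x|\<^sup>2)\<close>, where \<open>A\<close> is the
  second moment of \<open>\<phi>\<close> and \<open>B x\<close> the integral of \<open>(\<omega> \<bullet> x) \<phi>(\<omega>)\<close>. So the derivative
  has norm at most \<open>2 / \<epsilon>\<close> as soon as \<open>1 - (v \<bullet> \<phi>)\<^sup>2\<close> has integral at least \<open>\<epsilon>\<close> for
  every unit vector \<open>v\<close>, and the point is that \<open>\<epsilon> \<ge> c / d\<close>.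

  For \<open>g = v \<bullet> \<phi>\<close>, conformality gives \<open>|\<nabla>g| \<le> \<rho> sqrt (1 - g\<^sup>2)\<close>, where \<open>\<rho>\<close> is the conformal
  factor. The integral of \<open>\<rho>\<^sup>2 = \<Delta> log (|p|\<^sup>2 + |q|\<^sup>2)\<close> over a square is at most the flux of
  \<open>\<nabla> log (|p|\<^sup>2 + |q|\<^sup>2)\<close> out of a huge square, which is \<open>O(d)\<close>. Since \<open>g\<close> has mean \<open>0\<close>, the
  \<open>L\<^sup>1\<close> Poincare inequality bounds the integral of \<open>|\<nabla>g|\<close> from below unless \<open>\<epsilon>\<close> is itself bounded
  below, and Cauchy-Schwarz then yields \<open>\<epsilon> \<ge> c / d\<close>.
\<close>

text \<open>No implicit function theorem is applied, and no regularity of the barycenter in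
  \<open>x\<close> is known beforehand. Pairing the balance equation with \<open>y\<close> itself
  gives an inequality valid for every \<open>y\<close> in the ball, not only for small ones; it
  forces \<open>norm y\<close> to be O(|x|), and only then may the expansion be used. The same
  inequality yields uniqueness of the barycenter, while existence is Brouwer's fixed point theorem.

  The Poincare inequality compares \<open>g\<close> with its value at one point \<open>w\<close>
  rather than with a mean over the square: since \<open>g\<close> has spherical mean zero, the mean
  of \<open>(g - g w)^2\<close> is at least 1 - \<epsilon> for any constant \<open>g w\<close>. That
  square is fixed once, before the map is given, so the constant is universal. The huge square
  depends on the map, but the flux does not: its perimeter cancels the O(d / side) size of the
  gradient.

  Translations act on homogeneous coordinates by invertible 2 by 2 matrices. Composing a rational
  map with them on both sides therefore gives again two polynomials of degree at most
  \<open>d\<close> without common zero, and moving base points to 0 costs nothing.\<close>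

section \<open>Isometries of the ball\<close>

text \<open>The hyperbolic translation of the ball that takes \<open>y\<close> to \<open>0\<close>.\<close>

definition mobius :: "'a::real_inner \<Rightarrow> 'a \<Rightarrow> 'a" where
  "mobius y x = ((1 - (norm y)\<^sup>2) *\<^sub>R x - (1 - 2 * (x \<bullet> y) + (norm x)\<^sup>2) *\<^sub>R y) /\<^sub>R
     (1 - 2 * (x \<bullet> y) + (norm x)\<^sup>2 * (norm y)\<^sup>2)"

lemma mobius_denom_pos:
  fixes x y :: "'a::real_inner"
  assumes "norm x \<le> 1" "norm y < 1"
  shows "1 - 2 * (x \<bullet> y) + (norm x)\<^sup>2 * (norm y)\<^sup>2 > 0"
proof -
  have "norm x * norm y < 1"
    using assms by (metis mult_left_le_one_le norm_ge_zero order_le_less_trans)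
  then have "0 < (1 - norm x * norm y)\<^sup>2" by simp
  also have "\<dots> \<le> 1 - 2 * (x \<bullet> y) + (norm x)\<^sup>2 * (norm y)\<^sup>2"
    using norm_cauchy_schwarz[of x y] by (simp add: power2_eq_square algebra_simps)
  finally show ?thesis .
qed

lemma mobius_zero_right [simp]: "mobius y 0 = - y"
  by (simp add: mobius_def)

lemma mobius_zero_left [simp]: "mobius 0 x = x"
  by (simp add: mobius_def)

lemma mobius_self [simp]: "mobius y y = 0"
  by (simp add: mobius_def power2_norm_eq_inner)

text \<open>This and \<open>norm_mobius_diff\<close> show that the quotient inside
  \<open>hyp_dist\<close> is invariant: the denominators cancel. Naming the inner products turns the
  vector identity into a polynomial one in real variables.\<close>

lemma one_minus_norm_mobius:
  fixes x y :: "'a::real_inner"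
  assumes "norm x \<le> 1" "norm y < 1"
  shows "1 - (norm (mobius y x))\<^sup>2 =
    (1 - (norm x)\<^sup>2) * (1 - (norm y)\<^sup>2) / (1 - 2 * (x \<bullet> y) + (norm x)\<^sup>2 * (norm y)\<^sup>2)"
proof -
  define X where "X = x \<bullet> x"
  define Y where "Y = y \<bullet> y"
  define c where "c = x \<bullet> y"
  define D where "D = 1 - 2 * c + X * Y"
  have D: "D > 0"
    using mobius_denom_pos[OF assms] by (simp add: D_def X_def Y_def c_def power2_norm_eq_inner)
  have cc: "y \<bullet> x = c" by (simp add: c_def inner_commute)
  have "(norm (mobius y x))\<^sup>2 = ((1 - Y)\<^sup>2 * X - 2 * (1 - Y) * (1 - 2 * c + X) * c + (1 - 2 * c + X)\<^sup>2 * Y) / D\<^sup>2"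
    unfolding mobius_def power2_norm_eq_inner
    by (simp add: inner_diff_left inner_diff_right cc flip: X_def Y_def c_def D_def)
       (use D in \<open>simp add: divide_simps, simp add: power2_eq_square algebra_simps\<close>)
  also have "1 - \<dots> = (1 - X) * (1 - Y) / D"
  proof -
    have "D\<^sup>2 - ((1 - Y)\<^sup>2 * X - 2 * (1 - Y) * (1 - 2 * c + X) * c + (1 - 2 * c + X)\<^sup>2 * Y) = (1 - X) * (1 - Y) * D"
      unfolding D_def by algebra
    moreover have "1 - a / D\<^sup>2 = (D\<^sup>2 - a) / D\<^sup>2" for a using D by (simp add: diff_divide_distrib)
    ultimately show ?thesis using D by (simp add: power2_eq_square)
  qed
  finally show ?thesis by (simp add: X_def Y_def c_def D_def power2_norm_eq_inner)
qed

lemma norm_mobius_diff: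
  fixes x y :: "'a::real_inner"
  assumes "norm x \<le> 1" "norm x' \<le> 1" "norm y < 1"
  shows "(norm (mobius y x - mobius y x'))\<^sup>2 = (1 - (norm y)\<^sup>2)\<^sup>2 * (norm (x - x'))\<^sup>2 /
    ((1 - 2 * (x \<bullet> y) + (norm x)\<^sup>2 * (norm y)\<^sup>2) * (1 - 2 * (x' \<bullet> y) + (norm x')\<^sup>2 * (norm y)\<^sup>2))"
proof -
  define X where "X = x \<bullet> x"
  define X' where "X' = x' \<bullet> x'"
  define Y where "Y = y \<bullet> y"
  define c where "c = x \<bullet> y"
  define c' where "c' = x' \<bullet> y"
  define e where "e = x \<bullet> x'"
  define D where "D = 1 - 2 * c + X * Y"
  define D' where "D' = 1 - 2 * c' + X' * Y"
  have D: "D > 0" "D' > 0"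
    using mobius_denom_pos[OF assms(1,3)] mobius_denom_pos[OF assms(2,3)]
    by (simp_all add: D_def D'_def X_def X'_def Y_def c_def c'_def power2_norm_eq_inner)
  have cc: "y \<bullet> x = c" "y \<bullet> x' = c'" "x' \<bullet> x = e" by (simp_all add: c_def c'_def e_def inner_commute)
  have m: "(norm (mobius y x))\<^sup>2 = 1 - (1 - X) * (1 - Y) / D"
          "(norm (mobius y x'))\<^sup>2 = 1 - (1 - X') * (1 - Y) / D'"
    using one_minus_norm_mobius[OF assms(1,3)] one_minus_norm_mobius[OF assms(2,3)]
    by (simp_all add: D_def D'_def X_def X'_def Y_def c_def c'_def power2_norm_eq_inner)
  have i: "mobius y x \<bullet> mobius y x' = ((1 - Y)\<^sup>2 * e - (1 - Y) * (1 - 2 * c' + X') * c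
      - (1 - Y) * (1 - 2 * c + X) * c' + (1 - 2 * c + X) * (1 - 2 * c' + X') * Y) / (D * D')"
    unfolding mobius_def power2_norm_eq_inner
    by (simp add: inner_diff_left inner_diff_right cc flip: X_def X'_def Y_def c_def c'_def e_def D_def D'_def)
       (use D in \<open>simp add: field_simps power2_eq_square\<close>)
  have "(norm (mobius y x - mobius y x'))\<^sup>2 =
    (norm (mobius y x))\<^sup>2 + (norm (mobius y x'))\<^sup>2 - 2 * (mobius y x \<bullet> mobius y x')"
    by (simp add: power2_norm_eq_inner inner_diff_left inner_diff_right inner_commute)
  also have "\<dots> = (2 * D * D' - (1 - X) * (1 - Y) * D' - (1 - X') * (1 - Y) * D - 2 * ((1 - Y)\<^sup>2 * e - (1 - Y) * (1 - 2 * c' + X') * c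
      - (1 - Y) * (1 - 2 * c + X) * c' + (1 - 2 * c + X) * (1 - 2 * c' + X') * Y)) / (D * D')"
    unfolding m i using D by (simp add: divide_simps) (simp add: algebra_simps)
  also have "2 * D * D' - (1 - X) * (1 - Y) * D' - (1 - X') * (1 - Y) * D - 2 * ((1 - Y)\<^sup>2 * e - (1 - Y) * (1 - 2 * c' + X') * c
      - (1 - Y) * (1 - 2 * c + X) * c' + (1 - 2 * c + X) * (1 - 2 * c' + X') * Y) = (1 - Y)\<^sup>2 * (X + X' - 2 * e)"
    unfolding D_def D'_def by algebra
  also have "X + X' - 2 * e = (norm (x - x'))\<^sup>2"
    by (simp add: power2_norm_eq_inner inner_diff_left inner_diff_right cc X_def X'_def e_def)
  finally show ?thesis by (simp add: X_def X'_def Y_def c_def c'_def D_def D'_def power2_norm_eq_inner)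
qed

lemma norm_mobius_less_1: "norm x < 1 \<Longrightarrow> norm y < 1 \<Longrightarrow> norm (mobius y x) < 1"
proof -
  assume a: "norm x < 1" "norm y < 1"
  then have "1 - (norm (mobius y x))\<^sup>2 > 0"
    using mobius_denom_pos[of x y] by (subst one_minus_norm_mobius) (auto intro!: divide_pos_pos mult_pos_pos simp: power_less_one_iff abs_square_less_1)
  then show ?thesis using abs_square_less_1[of "norm (mobius y x)"] by simp
qed

lemma norm_mobius_eq_1: "norm x = 1 \<Longrightarrow> norm y < 1 \<Longrightarrow> norm (mobius y x) = 1"
  using one_minus_norm_mobius[of x y] by simp (metis abs_norm_cancel power2_eq_1_iff abs_1 abs_minus_cancel)

lemma mobius_inverse:
  fixes x y :: "'a::real_inner"
  assumes "norm x \<le> 1" "norm y < 1"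
  shows "mobius (- y) (mobius y x) = x"
proof -
  define X where "X = x \<bullet> x"
  define Y where "Y = y \<bullet> y"
  define c where "c = x \<bullet> y"
  define D where "D = 1 - 2 * c + X * Y"
  define m where "m = mobius y x"
  have D: "D > 0"
    using mobius_denom_pos[OF assms] by (simp add: D_def X_def Y_def c_def power2_norm_eq_inner)
  have Y: "1 - Y > 0"
    using assms(2) by (simp add: Y_def power2_norm_eq_inner[symmetric] abs_square_less_1)
  have M: "(norm m)\<^sup>2 = 1 - (1 - X) * (1 - Y) / D"
    using one_minus_norm_mobius[OF assms]
    by (simp add: D_def X_def Y_def c_def m_def power2_norm_eq_inner)
  have my: "m \<bullet> y = ((1 - Y) * c - (1 - 2 * c + X) * Y) / D"
    unfolding m_def mobius_def power2_norm_eq_inner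
    by (simp add: inner_diff_left divide_inverse mult.commute flip: X_def Y_def c_def) (simp add: D_def mult.commute)
  \<comment> \<open>\<open>e1\<close> and \<open>e2\<close> are the denominator and the coefficient
    of \<open>y\<close> for the second translation; with them the multiples of \<open>y\<close>
    cancel.\<close>
  have e1: "1 + 2 * (m \<bullet> y) + (norm m)\<^sup>2 * Y = (1 - Y)\<^sup>2 / D"
  proof -
    have "D + 2 * ((1 - Y) * c - (1 - 2 * c + X) * Y) + (D - (1 - X) * (1 - Y)) * Y = (1 - Y)\<^sup>2"
      unfolding D_def by algebra
    then show ?thesis unfolding M my using D by (simp add: divide_simps)
  qed
  have e2: "1 + 2 * (m \<bullet> y) + (norm m)\<^sup>2 = (1 - Y) * (1 - 2 * c + X) / D"
  proof -
    have "D + 2 * ((1 - Y) * c - (1 - 2 * c + X) * Y) + (D - (1 - X) * (1 - Y)) = (1 - Y) * (1 - 2 * c + X)"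
      unfolding D_def by algebra
    then show ?thesis unfolding M my using D by (simp add: divide_simps)
  qed
  have m': "m = ((1 - Y) *\<^sub>R x - (1 - 2 * c + X) *\<^sub>R y) /\<^sub>R D"
    by (simp add: m_def mobius_def X_def Y_def c_def D_def power2_norm_eq_inner)
  have "mobius (- y) m = ((1 - Y) *\<^sub>R m + (1 + 2 * (m \<bullet> y) + (norm m)\<^sup>2) *\<^sub>R y) /\<^sub>R
          (1 + 2 * (m \<bullet> y) + (norm m)\<^sup>2 * Y)"
    by (simp add: mobius_def Y_def power2_norm_eq_inner)
  also have "\<dots> = (((1 - Y) * (1 - Y) / D) *\<^sub>R x) /\<^sub>R ((1 - Y)\<^sup>2 / D)"
    unfolding e1 e2 by (subst m') (use D in \<open>simp add: algebra_simps divide_inverse flip: scaleR_left_distrib\<close>)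
  also have "\<dots> = x" using D Y by (simp add: power2_eq_square)
  finally show ?thesis by (simp add: m_def)
qed

lemma orthogonal_transformation_mobius:
  assumes "orthogonal_transformation g"
  shows "mobius (g y) (g x) = g (mobius y x)"
proof -
  have l: "linear g" and i: "\<And>v w. g v \<bullet> g w = v \<bullet> w"
    using assms by (auto simp: orthogonal_transformation_def)
  show ?thesis
    by (simp add: mobius_def i orthogonal_transformation_norm[OF assms] linear_scale[OF l] linear_diff[OF l])
qed

lemma continuous_on_mobius:
  assumes "norm y < 1" shows "continuous_on (cball 0 1) (mobius y)"
  unfolding mobius_def
  by (intro continuous_intros) (use mobius_denom_pos[of _ y] assms in \<open>force simp: less_le\<close>)

lemma hyp_dist_mobius:
  assumes "x \<in> ball 0 1" "x' \<in> ball 0 1" "norm y < 1"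
  shows "hyp_dist (mobius y x) (mobius y x') = hyp_dist x x'"
proof -
  have n: "norm x \<le> 1" "norm x' \<le> 1" and n': "norm x < 1" "norm x' < 1" using assms by auto
  define D where "D = 1 - 2 * (x \<bullet> y) + (norm x)\<^sup>2 * (norm y)\<^sup>2"
  define D' where "D' = 1 - 2 * (x' \<bullet> y) + (norm x')\<^sup>2 * (norm y)\<^sup>2"
  have D: "D > 0" "D' > 0" unfolding D_def D'_def
    using mobius_denom_pos[OF n(1) assms(3)] mobius_denom_pos[OF n(2) assms(3)] by simp_all
  have Y: "1 - (norm y)\<^sup>2 > 0" using assms(3) by (simp add: abs_square_less_1)
  show ?thesis
    unfolding hyp_dist_def one_minus_norm_mobius[OF n(1) assms(3)] one_minus_norm_mobius[OF n(2) assms(3)]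
      norm_mobius_diff[OF n assms(3)] D_def[symmetric] D'_def[symmetric]
    using D Y by (simp add: power2_eq_square)
qed

lemma hyp_isometry_mobius:
  assumes "norm y < 1" shows "hyp_isometry (mobius y)"
proof -
  have "bij_betw (mobius y) (ball 0 1) (ball 0 1)"
  proof (rule bij_betw_byWitness[where f' = "mobius (- y)"])
    show "\<forall>x\<in>ball 0 1. mobius (- y) (mobius y x) = x"
      using assms by (auto simp: mobius_inverse)
    show "\<forall>x\<in>ball 0 1. mobius y (mobius (- y) x) = x"
      using assms mobius_inverse[of _ "- y"] by auto
  qed (use assms in \<open>auto intro!: norm_mobius_less_1\<close>)
  then show ?thesis
    unfolding hyp_isometry_def using assms by (auto simp: hyp_dist_mobius continuous_on_mobius)
qed

section \<open>On the sphere, isometries are translations up to an orthogonal map\<close>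

lemma hyp_isometry_cball:
  assumes "hyp_isometry M" "norm x \<le> 1" shows "norm (M x) \<le> 1"
proof -
  have "M ` closure (ball 0 1) \<subseteq> cball 0 1"
    using assms(1) by (intro image_closure_subset) (auto simp: hyp_isometry_def bij_betw_def)
  then show ?thesis using assms(2) by (auto simp: image_subset_iff)
qed

lemma hyp_isometry_comp:
  assumes "hyp_isometry M" "hyp_isometry N" shows "hyp_isometry (M \<circ> N)"
proof -
  have "continuous_on (cball 0 1) (M \<circ> N)"
    using assms hyp_isometry_cball[OF assms(2)]
    by (intro continuous_on_compose) (auto simp: hyp_isometry_def intro: continuous_on_subset)
  moreover have "bij_betw (M \<circ> N) (ball 0 1) (ball 0 1)"
    using assms by (auto simp: hyp_isometry_def intro: bij_betw_trans)
  moreover have "N x \<in> ball 0 1" if "x \<in> ball 0 1" for x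
    using assms(2) that by (auto simp: hyp_isometry_def bij_betw_def)
  ultimately show ?thesis
    using assms by (simp add: hyp_isometry_def)
qed

text \<open>Distances to 0 show that norms are preserved; then equal hyperbolic distances mean equal
  Euclidean ones. Continuity carries this radially to the sphere, where an isometry extends to an
  orthogonal map. The conclusion concerns only the sphere because measures live there.\<close>

lemma hyp_isometry_fixing_0:
  assumes M: "hyp_isometry M" and M0: "M 0 = 0"
  obtains g where "orthogonal_transformation g" "\<And>x. norm x = 1 \<Longrightarrow> M x = g x"
proof -
  have cont: "continuous_on (cball 0 1) M" using M by (simp add: hyp_isometry_def)
  have *: "2 * (norm (M x - M y))\<^sup>2 / ((1 - (norm (M x))\<^sup>2) * (1 - (norm (M y))\<^sup>2))
     = 2 * (norm (x - y))\<^sup>2 / ((1 - (norm x)\<^sup>2) * (1 - (norm y)\<^sup>2))" if "norm x < 1" "norm y < 1" for x y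
  proof -
    have "norm (M x) < 1" "norm (M y) < 1"
      using M that by (auto simp: hyp_isometry_def bij_betw_def)
    then have "2 * (norm (M x - M y))\<^sup>2 / ((1 - (norm (M x))\<^sup>2) * (1 - (norm (M y))\<^sup>2)) \<ge> 0"
       "2 * (norm (x - y))\<^sup>2 / ((1 - (norm x)\<^sup>2) * (1 - (norm y)\<^sup>2)) \<ge> 0"
      using that by (auto intro!: divide_nonneg_nonneg mult_nonneg_nonneg simp: power_le_one)
    moreover have "hyp_dist (M x) (M y) = hyp_dist x y"
      using M that by (auto simp: hyp_isometry_def)
    \<comment> \<open>Both arguments of \<open>arcosh\<close> are at least 1, where
      \<open>cosh\<close> undoes it.\<close>
    ultimately show ?thesis
      unfolding hyp_dist_def by (metis add_left_cancel cosh_arcosh_real le_add_same_cancel1)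
  qed
  have nrm: "norm (M x) = norm x" if "norm x < 1" for x
  proof -
    have l: "norm (M x) < 1" using M that by (auto simp: hyp_isometry_def bij_betw_def)
    have "(norm (M x))\<^sup>2 / (1 - (norm (M x))\<^sup>2) = (norm x)\<^sup>2 / (1 - (norm x)\<^sup>2)"
      using *[of x 0] that by (simp add: M0)
    moreover have "1 - (norm (M x))\<^sup>2 > 0" "1 - (norm x)\<^sup>2 > 0"
      using l that by (auto simp: abs_square_less_1)
    ultimately have "(norm (M x))\<^sup>2 = (norm x)\<^sup>2" by (simp add: field_simps)
    then show ?thesis by simp
  qed
  have dst: "norm (M x - M y) = norm (x - y)" if "norm x < 1" "norm y < 1" for x y
  proof -
    have "1 - (norm y)\<^sup>2 > 0" "1 - (norm x)\<^sup>2 > 0"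
      using that by (auto simp: abs_square_less_1)
    then have "(norm (M x - M y))\<^sup>2 = (norm (x - y))\<^sup>2"
      using *[OF that] that by (simp add: nrm)
    then show ?thesis by simp
  qed
  \<comment> \<open>Radial factors strictly between 0 and 1: the double \<open>Suc\<close> makes
    \<open>t 0\<close> equal to 1/2 and not 0.\<close>
  define t where "t n = 1 - 1 / real (Suc (Suc n))" for n
  have t: "t \<longlonglongrightarrow> 1" unfolding t_def by real_asymp
  have t1: "0 < t n" "t n < 1" for n by (auto simp: t_def field_simps)
  have lim: "(\<lambda>n. M (t n *\<^sub>R x)) \<longlonglongrightarrow> M x" if "norm x = 1" for x
  proof (rule continuous_on_tendsto_compose[OF cont])
    show "(\<lambda>n. t n *\<^sub>R x) \<longlonglongrightarrow> x" using tendsto_scaleR[OF t tendsto_const[of x]] by simp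
    show "\<forall>\<^sub>F n in sequentially. t n *\<^sub>R x \<in> cball 0 1"
      using t1 that by (auto simp: less_imp_le abs_of_pos)
  qed (use that in auto)
  have tl: "norm (t n *\<^sub>R x) < 1" if "norm x = 1" for x :: "real^3" and n
    using t1 that by (simp add: abs_of_pos)
  have n1: "norm (M x) = 1" if "norm x = 1" for x
  proof -
    have "(\<lambda>n. norm (M (t n *\<^sub>R x))) \<longlonglongrightarrow> norm (M x)" by (intro tendsto_norm lim that)
    moreover have "(\<lambda>n. norm (M (t n *\<^sub>R x))) = t" using t1 tl[OF that] that by (auto simp: nrm abs_of_pos)
    ultimately show ?thesis using t LIMSEQ_unique by metis
  qed
  have d1: "dist (M x) (M y) = dist x y" if "norm x = 1" "norm y = 1" for x y
  proof -
    have "(\<lambda>n. norm (M (t n *\<^sub>R x) - M (t n *\<^sub>R y))) \<longlonglongrightarrow> norm (M x - M y)"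
      by (intro tendsto_intros lim that)
    moreover have "norm (M (t n *\<^sub>R x) - M (t n *\<^sub>R y)) = t n * norm (x - y)" for n
      using t1[of n] tl that by (simp add: dst abs_of_pos flip: scaleR_right_diff_distrib)
    moreover have "(\<lambda>n. t n * norm (x - y)) \<longlonglongrightarrow> 1 * norm (x - y)" by (intro tendsto_intros t)
    ultimately show ?thesis using LIMSEQ_unique by (fastforce simp: dist_norm)
  qed
  obtain g where "orthogonal_transformation g" "\<forall>x. norm x = 1 \<longrightarrow> g x = M x"
    using isometry_sphere_extend[of M, OF n1 d1] by blast
  then show thesis using that by metis
qed

text \<open>Being balanced is unaffected by orthogonal maps, so this lets \<open>mobius y\<close>
  stand for the arbitrary isometry in \<open>balanced_at\<close>.\<close>

lemma hyp_isometry_to_0: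
  assumes M: "hyp_isometry M" and "M y = 0" "norm y < 1"
  obtains g where "orthogonal_transformation g" "\<And>x. norm x = 1 \<Longrightarrow> M x = g (mobius y x)"
proof -
  have "hyp_isometry (M \<circ> mobius (- y))" "(M \<circ> mobius (- y)) 0 = 0"
    using assms by (auto intro!: hyp_isometry_comp hyp_isometry_mobius)
  then obtain g where g: "orthogonal_transformation g" "\<And>x. norm x = 1 \<Longrightarrow> M (mobius (- y) x) = g x"
    using hyp_isometry_fixing_0[of "M \<circ> mobius (- y)"] unfolding comp_def by blast
  have "M x = g (mobius y x)" if "norm x = 1" for x
    using g(2)[of "mobius y x"] that assms(3) by (simp add: norm_mobius_eq_1 mobius_inverse)
  then show thesis using g(1) that by blast
qed

text \<open>The counterpart for the isometry chosen by \<open>SOME\<close> in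
  \<open>barycentric_extension\<close>: the orthogonal factor acts first, and the spherical measure
  absorbs it.\<close>

lemma hyp_isometry_from_0:
  assumes M: "hyp_isometry M" and "M 0 = x" "norm x < 1"
  obtains g where "orthogonal_transformation g" "\<And>z. norm z = 1 \<Longrightarrow> M z = mobius (- x) (g z)"
proof -
  have "hyp_isometry (mobius x \<circ> M)" "(mobius x \<circ> M) 0 = 0"
    using assms by (auto intro!: hyp_isometry_comp hyp_isometry_mobius)
  then obtain g where g: "orthogonal_transformation g" "\<And>z. norm z = 1 \<Longrightarrow> mobius x (M z) = g z"
    using hyp_isometry_fixing_0[of "mobius x \<circ> M"] unfolding comp_def by blast
  have "M z = mobius (- x) (g z)" if "norm z = 1" for z
    using mobius_inverse[of "M z" x] g(2)[OF that] that assms hyp_isometry_cball[OF M, of z] by simp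
  then show thesis using g(1) that by blast
qed

text \<open>The composition sends \<open>mobius (- y0) y'\<close> to 0, hence is the translation of
  that point up to an orthogonal map. It is used to change the base point in the target;
  \<open>mobius_comp_from_0\<close> does so in the source.\<close>

lemma mobius_comp_to_0:
  fixes y0 y' :: "real^3"
  assumes "norm y0 < 1" "norm y' < 1"
  obtains g where "orthogonal_transformation g"
    "\<And>z. norm z = 1 \<Longrightarrow> mobius y' (mobius y0 z) = g (mobius (mobius (- y0) y') z)"
proof -
  have "hyp_isometry (mobius y' \<circ> mobius y0)"
    using assms by (auto intro!: hyp_isometry_comp hyp_isometry_mobius)
  moreover have "(mobius y' \<circ> mobius y0) (mobius (- y0) y') = 0"
    using assms mobius_inverse[of y' "- y0"] by simp
  moreover have "norm (mobius (- y0) y') < 1" using assms by (intro norm_mobius_less_1) auto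
  ultimately show thesis
    using that hyp_isometry_to_0[of "mobius y' \<circ> mobius y0" "mobius (- y0) y'"] unfolding comp_def by blast
qed

lemma mobius_comp_from_0:
  fixes x0 x' :: "real^3"
  assumes "norm x0 < 1" "norm x' < 1"
  obtains g where "orthogonal_transformation g"
    "\<And>z. norm z = 1 \<Longrightarrow> mobius (- x0) (mobius (- x') z) = mobius (- mobius (- x0) x') (g z)"
proof -
  have "hyp_isometry (mobius (- x0) \<circ> mobius (- x'))"
    using assms by (auto intro!: hyp_isometry_comp hyp_isometry_mobius)
  moreover have "(mobius (- x0) \<circ> mobius (- x')) 0 = mobius (- x0) x'" by simp
  moreover have "norm (mobius (- x0) x') < 1" using assms by (intro norm_mobius_less_1) auto
  ultimately show thesis
    using that hyp_isometry_from_0[of "mobius (- x0) \<circ> mobius (- x')" "mobius (- x0) x'"] unfolding comp_def by blast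
qed

section \<open>The spherical measure\<close>

lemma norm_vec_3: "(norm (x::real^3))\<^sup>2 = (x$1)\<^sup>2 + (x$2)\<^sup>2 + (x$3)\<^sup>2"
  unfolding power2_norm_eq_inner inner_vec_def sum_3 by (simp add: power2_eq_square)

lemma continuous_on_vector_3 [continuous_intros]:
  fixes f g h :: "'a::topological_space \<Rightarrow> real"
  assumes "continuous_on S f" "continuous_on S g" "continuous_on S h"
  shows "continuous_on S (\<lambda>x. vector [f x, g x, h x] :: real^3)"
proof -
  have "vector [a, b, c] = a *\<^sub>R axis 1 1 + b *\<^sub>R axis 2 1 + c *\<^sub>R (axis 3 1 :: real^3)" for a b c :: real
    by (simp add: vec_eq_iff forall_3 axis_def)
  then show ?thesis by (simp only:) (intro continuous_intros assms)
qed

lemma stereo_inv_component: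
  "stereo_inv (Some z) $ 1 = 2 * Re z / ((norm z)\<^sup>2 + 1)"
  "stereo_inv (Some z) $ 2 = 2 * Im z / ((norm z)\<^sup>2 + 1)"
  "stereo_inv (Some z) $ 3 = ((norm z)\<^sup>2 - 1) / ((norm z)\<^sup>2 + 1)"
  by (simp_all add: stereo_inv_def)

lemma norm_sq_plus_1_pos: "(norm z)\<^sup>2 + 1 > (0::real)"
  by (simp add: add_nonneg_pos)

lemma norm_stereo_inv_Some: "norm (stereo_inv (Some z)) = 1"
proof -
  define n where "n = (norm z)\<^sup>2 + 1"
  have n: "n > 0" "(Re z)\<^sup>2 + (Im z)\<^sup>2 = n - 1" using norm_sq_plus_1_pos[of z] by (simp_all add: n_def cmod_power2)
  have "(norm (stereo_inv (Some z)))\<^sup>2 = (4 * ((Re z)\<^sup>2 + (Im z)\<^sup>2) + (n - 2)\<^sup>2) / n\<^sup>2"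
    unfolding norm_vec_3 stereo_inv_component using n(1)
    by (simp add: n_def power_divide power_mult_distrib add_divide_distrib)
  also have "\<dots> = 1" using n by (simp add: power2_eq_square field_simps)
  finally show ?thesis by (metis norm_ge_zero one_power2 power2_eq_imp_eq zero_le_one)
qed

lemma stereo_inv_Some_neq_north: "stereo_inv (Some z) $ 3 < 1"
  using norm_sq_plus_1_pos[of z] by (simp add: stereo_inv_component divide_less_eq)

lemma stereo_stereo_inv: "stereo (stereo_inv (Some z)) = Some z"
proof -
  have "1 - stereo_inv (Some z) $ 3 = 2 / ((norm z)\<^sup>2 + 1)"
    using norm_sq_plus_1_pos[of z] by (simp add: stereo_inv_component field_simps)
  then show ?thesis
    using stereo_inv_Some_neq_north[of z] norm_sq_plus_1_pos[of z]
    by (simp add: stereo_def) (simp add: stereo_inv_component complex_eq_iff)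
qed

lemma stereo_inv_Some_inject [simp]: "stereo_inv (Some z) = stereo_inv (Some w) \<longleftrightarrow> z = w"
  by (metis option.inject stereo_stereo_inv)

lemma sphere_component_3:
  assumes "norm \<zeta> = 1" shows "\<zeta> $ 3 \<le> 1" "\<zeta> $ 3 = 1 \<longleftrightarrow> \<zeta> = (vector [0,0,1] :: real^3)"
proof -
  have e: "(\<zeta>$1)\<^sup>2 + (\<zeta>$2)\<^sup>2 + (\<zeta>$3)\<^sup>2 = 1" using norm_vec_3[of \<zeta>] assms by simp
  show "\<zeta> $ 3 \<le> 1" using component_le_norm_cart[of \<zeta> 3] assms by simp
  show "\<zeta> $ 3 = 1 \<longleftrightarrow> \<zeta> = vector [0,0,1]"
  proof
    assume "\<zeta> $ 3 = 1"
    then have "(\<zeta>$1)\<^sup>2 + (\<zeta>$2)\<^sup>2 = 0" using e by simp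
    then show "\<zeta> = vector [0,0,1]" using \<open>\<zeta> $ 3 = 1\<close>
      by (simp add: vec_eq_iff forall_3)
  qed simp
qed

lemma stereo_inv_stereo:
  assumes "norm \<zeta> = 1" shows "stereo_inv (stereo \<zeta>) = \<zeta>"
proof (cases "\<zeta> $ 3 = 1")
  case True
  then show ?thesis using sphere_component_3(2)[OF assms] by (simp add: stereo_def stereo_inv_def)
next
  case False
  define t where "t = 1 - \<zeta> $ 3"
  have t: "t > 0" using False sphere_component_3(1)[OF assms] by (simp add: t_def)
  define z where "z = Complex (\<zeta> $ 1 / t) (\<zeta> $ 2 / t)"
  have "(\<zeta>$1)\<^sup>2 + (\<zeta>$2)\<^sup>2 + (\<zeta>$3)\<^sup>2 = 1" using norm_vec_3[of \<zeta>] assms by simp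
  then have e: "(\<zeta>$1)\<^sup>2 + (\<zeta>$2)\<^sup>2 = t * (2 - t)" by (simp add: t_def algebra_simps power2_eq_square)
  have "(norm z)\<^sup>2 = ((\<zeta>$1)\<^sup>2 + (\<zeta>$2)\<^sup>2) / t\<^sup>2"
    by (simp add: z_def cmod_power2 power_divide add_divide_distrib)
  also have "\<dots> = (2 - t) / t" unfolding e using t by (simp add: power2_eq_square)
  finally have nz: "(norm z)\<^sup>2 = (2 - t) / t" .
  have nz1: "(norm z)\<^sup>2 + 1 = 2 / t" and nz2: "(norm z)\<^sup>2 - 1 = 2 * (1 - t) / t"
    unfolding nz using t by (simp_all add: field_simps)
  have "stereo_inv (Some z) = \<zeta>"
    unfolding vec_eq_iff forall_3 stereo_inv_component nz1 nz2 using t by (simp add: z_def t_def)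
  then show ?thesis using False by (simp add: stereo_def z_def t_def)
qed

lemma continuous_on_stereo_inv_Some: "continuous_on S (\<lambda>z. stereo_inv (Some z))"
proof -
  have "(norm z)\<^sup>2 + 1 \<noteq> 0" for z :: complex using norm_sq_plus_1_pos[of z] by simp
  then show ?thesis unfolding stereo_inv_def option.case by (intro continuous_intros) auto
qed

lemma measurable_stereo_inv_Some [measurable]: "(\<lambda>z. stereo_inv (Some z)) \<in> borel \<rightarrow>\<^sub>M borel_S2"
  by (intro measurable_restrict_space2 borel_measurable_continuous_onI continuous_on_stereo_inv_Some)
     (auto simp: norm_stereo_inv_Some)

lemma space_borel_S2 [simp]: "space borel_S2 = sphere 0 1"
  by (simp add: space_restrict_space)

lemma space_mu_S2 [simp]: "space mu_S2 = sphere 0 1"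
  by (simp add: mu_S2_def area_S2_def space_scale_measure)

lemma space_area_S2 [simp]: "space area_S2 = sphere 0 1"
  by (simp add: area_S2_def)

lemma sets_area_S2 [simp, measurable_cong]: "sets area_S2 = sets borel_S2"
  by (simp add: area_S2_def)

lemma sets_mu_S2 [simp, measurable_cong]: "sets mu_S2 = sets borel_S2"
  by (simp add: mu_S2_def)

lemma emeasure_area_S2:
  assumes [measurable]: "B \<in> sets borel_S2"
  shows "emeasure area_S2 B =
    (\<integral>\<^sup>+z. ennreal (4 / (1 + (norm z)\<^sup>2)\<^sup>2) * indicator B (stereo_inv (Some z)) \<partial>lborel)"
proof -
  have "(\<lambda>z. stereo_inv (Some z)) -` B \<inter> space borel \<in> sets (borel :: complex measure)"
    by (rule measurable_sets[OF measurable_stereo_inv_Some assms])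
  then show ?thesis
  unfolding area_S2_def by (subst emeasure_distr) (auto simp: emeasure_density indicator_def intro!: nn_integral_cong)
qed

section \<open>Area as three times the volume of a cone, and its rotation invariance\<close>

lemma prod_Basis_3: "(\<Prod>b\<in>Basis. f b) = f (axis 1 1) * f (axis 2 1) * f (axis (3::3) (1::real))"
proof -
  have B: "(Basis :: (real^3) set) = {axis 1 1, axis 2 1, axis 3 1}"
    by (auto simp: Basis_vec_def UNIV_3)
  show ?thesis unfolding B by (simp add: axis_eq_axis mult.assoc)
qed

text \<open>Prepares Fubini in cone coordinates: the plane of the chart times the radius.\<close>

lemma lborel_vec_3: "lborel = distr (lborel \<Otimes>\<^sub>M lborel) borel (\<lambda>(z, r). vector [Re z, Im z, r] :: real^3)"
proof (rule lborel_eqI)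
  have c: "continuous_on UNIV (\<lambda>(z, r). vector [Re z, Im z, r] :: real^3)"
    unfolding case_prod_beta by (intro continuous_intros)
  have m: "(\<lambda>(z, r). vector [Re z, Im z, r] :: real^3) \<in> lborel \<Otimes>\<^sub>M lborel \<rightarrow>\<^sub>M borel"
    unfolding lborel_prod using borel_measurable_continuous_onI[OF c] by simp
  fix l u :: "real^3" assume "\<And>b. b \<in> Basis \<Longrightarrow> l \<bullet> b \<le> u \<bullet> b"
  moreover have "axis i 1 \<in> (Basis :: (real^3) set)" for i by (auto simp: Basis_vec_def)
  ultimately have le: "l $ i \<le> u $ i" for i unfolding cart_eq_inner_axis by blast
  have eq: "(\<lambda>(z, r). vector [Re z, Im z, r] :: real^3) -` box l u =
      box (Complex (l$1) (l$2)) (Complex (u$1) (u$2)) \<times> box (l$3) (u$3)"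
    by (auto simp: mem_box_cart forall_3 mem_box Basis_complex_def)
  have "emeasure (distr (lborel \<Otimes>\<^sub>M lborel) borel (\<lambda>(z, r). vector [Re z, Im z, r] :: real^3)) (box l u) =
      emeasure (lborel \<Otimes>\<^sub>M lborel) (box (Complex (l$1) (l$2)) (Complex (u$1) (u$2)) \<times> box (l$3) (u$3))"
    by (subst emeasure_distr[OF m]) (simp_all add: eq space_pair_measure)
  also have "\<dots> = emeasure lborel (box (Complex (l$1) (l$2)) (Complex (u$1) (u$2))) * emeasure lborel (box (l$3) (u$3))"
    by (intro lborel.emeasure_pair_measure_Times) auto
  also have "\<dots> = (\<Prod>b\<in>Basis. (u - l) \<bullet> b)"
    using le by (simp add: emeasure_lborel_box_eq prod_Basis_3 Basis_complex_def ennreal_mult' flip: cart_eq_inner_axis)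
  finally show "emeasure (distr (lborel \<Otimes>\<^sub>M lborel) borel (\<lambda>(z, r). vector [Re z, Im z, r] :: real^3)) (box l u) = ennreal (\<Prod>b\<in>Basis. (u - l) \<bullet> b)"
    .
qed simp

definition open_cone :: "(real^3) set \<Rightarrow> (real^3) set" where
  "open_cone B = {y. y \<noteq> 0 \<and> norm y < 1 \<and> y /\<^sub>R norm y \<in> B}"

text \<open>
  Polar coordinates over the chart of the sphere. They express area by the volume of cones,
  which makes its invariance under all orthogonal maps that of Lebesgue measure.
\<close>

definition cone_chart :: "real^3 \<Rightarrow> real^3" where
  "cone_chart v = v$3 *\<^sub>R stereo_inv (Some (Complex (v$1) (v$2)))"

text \<open>Here \<open>n\<close> is |z|^2 + 1 and \<open>m\<close> its differential; the entries
  are the quotient rule, the last one applied to \<open>v$3 - 2 * v$3 / n\<close>.\<close>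

definition cone_chart_deriv :: "real^3 \<Rightarrow> real^3 \<Rightarrow> real^3" where
  "cone_chart_deriv v h = (let n = (v$1)\<^sup>2 + (v$2)\<^sup>2 + 1; m = 2 * v$1 * h$1 + 2 * v$2 * h$2 in
     vector [2 * h$1 * v$3 / n + 2 * v$1 * h$3 / n - 2 * v$1 * v$3 * m / n\<^sup>2,
             2 * h$2 * v$3 / n + 2 * v$2 * h$3 / n - 2 * v$2 * v$3 * m / n\<^sup>2,
             (n - 2) * h$3 / n + 2 * v$3 * m / n\<^sup>2])"

lemma has_derivative_cone_chart: "(cone_chart has_derivative cone_chart_deriv v) (at v within S)"
proof -
  have n0: "(v$1)\<^sup>2 + (v$2)\<^sup>2 + 1 \<noteq> 0" for v :: "real^3"
    by (metis add_nonneg_pos less_irrefl sum_power2_ge_zero zero_less_one)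
  have c: "cone_chart v $ 1 = 2 * v$1 * v$3 / ((v$1)\<^sup>2 + (v$2)\<^sup>2 + 1)"
     "cone_chart v $ 2 = 2 * v$2 * v$3 / ((v$1)\<^sup>2 + (v$2)\<^sup>2 + 1)"
     "cone_chart v $ 3 = v$3 - 2 * v$3 / ((v$1)\<^sup>2 + (v$2)\<^sup>2 + 1)" for v
    using n0[of v] by (simp_all add: cone_chart_def stereo_inv_component cmod_power2 field_simps)
  have v: "((\<lambda>v. v $ i) has_derivative (\<lambda>h. h $ i)) (at v within S)" for i :: 3 and v :: "real^3"
    using bounded_linear.has_derivative[OF bounded_linear_vec_nth has_derivative_ident] .
  define n where "n = (v$1)\<^sup>2 + (v$2)\<^sup>2 + 1"
  have n: "n \<noteq> 0" using n0 by (simp add: n_def)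
  have "((\<lambda>x. cone_chart x $ i) has_derivative (\<lambda>h. cone_chart_deriv v h $ i)) (at v within S)" for i
  proof -
    have "((\<lambda>x. 2 * x$1 * x$3 / ((x$1)\<^sup>2 + (x$2)\<^sup>2 + 1)) has_derivative (\<lambda>h. cone_chart_deriv v h $ 1)) (at v within S)"
      by (rule derivative_eq_intros v n0 refl)+
         (use n in \<open>simp add: cone_chart_deriv_def Let_def fun_eq_iff flip: n_def; simp add: field_simps power2_eq_square\<close>)
    moreover have "((\<lambda>x. 2 * x$2 * x$3 / ((x$1)\<^sup>2 + (x$2)\<^sup>2 + 1)) has_derivative (\<lambda>h. cone_chart_deriv v h $ 2)) (at v within S)"
      by (rule derivative_eq_intros v n0 refl)+
         (use n in \<open>simp add: cone_chart_deriv_def Let_def fun_eq_iff flip: n_def; simp add: field_simps power2_eq_square\<close>)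
    moreover have "((\<lambda>x. x$3 - 2 * x$3 / ((x$1)\<^sup>2 + (x$2)\<^sup>2 + 1)) has_derivative (\<lambda>h. cone_chart_deriv v h $ 3)) (at v within S)"
      by (rule derivative_eq_intros v n0 refl)+
         (use n in \<open>simp add: cone_chart_deriv_def Let_def fun_eq_iff flip: n_def; simp add: field_simps power2_eq_square\<close>)
    ultimately have "\<forall>i. ((\<lambda>x. cone_chart x $ i) has_derivative (\<lambda>h. cone_chart_deriv v h $ i)) (at v within S)"
      unfolding forall_3 c by blast
    then show ?thesis by blast
  qed
  then show ?thesis
    by (subst has_derivative_componentwise_within) (auto simp: Basis_vec_def inner_axis)
qed

text \<open>The Jacobian is the squared radius times the area density of the chart. The first two
  columns share the factor \<open>k\<close>, the third the factor \<open>1 / n\<close>, and the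
  remaining determinant is \<open>- (n ^ 3)\<close>.\<close>

lemma det_cone_chart_deriv:
  "\<bar>det (matrix (cone_chart_deriv v))\<bar> = 4 * (v$3)\<^sup>2 / ((v$1)\<^sup>2 + (v$2)\<^sup>2 + 1)\<^sup>2"
proof -
  define a b where "a = v$1" and "b = v$2"
  define n where "n = a\<^sup>2 + b\<^sup>2 + 1"
  have n: "n > 0" unfolding n_def by (simp add: add_nonneg_pos)
  define k where "k = 2 * v$3 / n\<^sup>2"
  let ?A = "matrix (cone_chart_deriv v)"
  have cd: "cone_chart_deriv v h = (let m = 2 * a * h$1 + 2 * b * h$2 in
     vector [2 * h$1 * v$3 / n + 2 * a * h$3 / n - 2 * a * v$3 * m / n\<^sup>2,
             2 * h$2 * v$3 / n + 2 * b * h$3 / n - 2 * b * v$3 * m / n\<^sup>2,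
             (n - 2) * h$3 / n + 2 * v$3 * m / n\<^sup>2])" for h
    by (simp add: cone_chart_deriv_def Let_def a_def b_def n_def)
  have A: "?A$1$1 = k * (n - 2 * a\<^sup>2)" "?A$2$1 = k * (- 2 * a * b)" "?A$3$1 = k * (2 * a)"
    "?A$1$2 = k * (- 2 * a * b)" "?A$2$2 = k * (n - 2 * b\<^sup>2)" "?A$3$2 = k * (2 * b)"
    "?A$1$3 = 1 / n * (2 * a)" "?A$2$3 = 1 / n * (2 * b)" "?A$3$3 = 1 / n * (n - 2)"
    unfolding matrix_def using n by (simp_all add: cd axis_def k_def) (simp_all add: field_simps power2_eq_square)
  have p: "(n - 2 * a\<^sup>2) * (n - 2 * b\<^sup>2) * (n - 2) + (- 2 * a * b) * (2 * b) * (2 * a) + (- 2 * a * b) * (2 * b) * (2 * a)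
     - (n - 2 * a\<^sup>2) * (2 * b) * (2 * b) - (- 2 * a * b) * (- 2 * a * b) * (n - 2) - (n - 2 * b\<^sup>2) * (2 * a) * (2 * a) = - (n ^ 3)"
    unfolding n_def by algebra
  have "det ?A = k * k * (1 / n) * (- (n ^ 3))"
    unfolding det_3 A p[symmetric] by algebra
  also have "\<dots> = - (4 * (v$3)\<^sup>2 / n\<^sup>2)"
    using n by (simp add: k_def field_simps power2_eq_square power3_eq_cube)
  finally show ?thesis using n by (simp add: n_def a_def b_def)
qed

text \<open>The north pole is removed because the chart misses it.\<close>

lemma cone_chart_image:
  assumes "B \<subseteq> sphere 0 1"
  shows "cone_chart ` {v. 0 < v$3 \<and> v$3 < 1 \<and> stereo_inv (Some (Complex (v$1) (v$2))) \<in> B} =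
    open_cone (B - {vector [0,0,1]})" (is "_ ` ?S = _")
proof (intro equalityI subsetI)
  fix y assume "y \<in> cone_chart ` ?S"
  then obtain v where v: "0 < v$3" "v$3 < 1" "stereo_inv (Some (Complex (v$1) (v$2))) \<in> B" "y = cone_chart v"
    by auto
  have "norm y = v$3" using v by (simp add: cone_chart_def norm_stereo_inv_Some)
  moreover have "stereo_inv (Some (Complex (v$1) (v$2))) \<noteq> vector [0,0,1]"
    using stereo_inv_Some_neq_north[of "Complex (v$1) (v$2)"] by (metis less_irrefl vector_3(3))
  ultimately show "y \<in> open_cone (B - {vector [0,0,1]})" using v by (auto simp: open_cone_def cone_chart_def)
next
  fix y assume y: "y \<in> open_cone (B - {vector [0,0,1]})"
  define \<zeta> where "\<zeta> = y /\<^sub>R norm y"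
  have 1: "norm \<zeta> = 1" "\<zeta> \<in> B" "\<zeta> \<noteq> vector [0,0,1]" using y assms by (auto simp: open_cone_def \<zeta>_def)
  then have "\<zeta> $ 3 \<noteq> 1" using sphere_component_3(2) by blast
  then obtain z where z: "stereo \<zeta> = Some z" by (auto simp: stereo_def)
  then have zz: "stereo_inv (Some z) = \<zeta>" using stereo_inv_stereo[OF 1(1)] by simp
  have "cone_chart (vector [Re z, Im z, norm y]) = y"
    using y by (simp add: cone_chart_def zz) (simp add: \<zeta>_def open_cone_def)
  moreover have "vector [Re z, Im z, norm y] \<in> ?S"
    using y 1 zz by (auto simp: open_cone_def)
  ultimately show "y \<in> cone_chart ` ?S" by (intro image_eqI[OF sym])
qed

lemma inj_on_cone_chart: "inj_on cone_chart {v. 0 < v$3}"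
proof (rule inj_onI)
  fix v w assume a: "v \<in> {v. 0 < v$3}" "w \<in> {v. 0 < v$3}" "cone_chart v = cone_chart w"
  have "norm (cone_chart v) = norm (cone_chart w)" using a by simp
  then have 3: "v$3 = w$3" using a by (simp add: cone_chart_def norm_stereo_inv_Some)
  then have "stereo_inv (Some (Complex (v$1) (v$2))) = stereo_inv (Some (Complex (w$1) (w$2)))"
    using a by (auto simp: cone_chart_def)
  then have "Complex (v$1) (v$2) = Complex (w$1) (w$2)" unfolding stereo_inv_Some_inject .
  then show "v = w" using 3 by (simp add: vec_eq_iff forall_3)
qed

lemma sets_borel_S2_D: "B \<in> sets borel_S2 \<Longrightarrow> B \<in> sets borel \<and> B \<subseteq> sphere 0 1"
  by (auto simp: sets_restrict_space_iff)

lemma borel_cone: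
  assumes "B \<in> sets borel_S2" shows "open_cone B \<in> sets borel"
proof -
  have [measurable]: "B \<in> sets borel" using sets_borel_S2_D[OF assms] by blast
  have "open_cone B = {y \<in> space borel. y \<noteq> 0 \<and> norm y < 1 \<and> y /\<^sub>R norm y \<in> B}" by (simp add: open_cone_def)
  also have "\<dots> \<in> sets borel" by measurable
  finally show ?thesis .
qed

lemma bounded_open_cone: "bounded (open_cone B)"
  by (rule bounded_subset[OF bounded_ball[of 0 1]]) (auto simp: open_cone_def)

text \<open>The radial integral, and so the origin of the factor 3 between area and volume of the
  cone.\<close>

lemma nn_integral_square_unit: "(\<integral>\<^sup>+r. ennreal (r\<^sup>2 * indicator {0<..<1} r) \<partial>lborel) = ennreal (1 / 3)"
proof -
  have "((\<lambda>r::real. r\<^sup>2) has_integral (1^3 / 3 - 0^3 / 3)) {0..1}"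
    by (rule fundamental_theorem_of_calculus)
       (auto intro!: derivative_eq_intros simp flip: has_real_derivative_iff_has_vector_derivative)
  then have "((\<lambda>r::real. r\<^sup>2) has_integral (1 / 3)) {0<..<1}"
    by (simp add: has_integral_Icc_iff_Ioo)
  from nn_integral_has_integral_lebesgue[OF _ this] show ?thesis by (simp add: mult.commute ennreal_mult' ennreal_indicator)
qed

text \<open>Change of variables by \<open>cone_chart\<close> and Fubini: the Jacobian splits into
  the area density in \<open>z\<close> and \<open>r^2\<close>.\<close>

lemma emeasure_area_S2_cone:
  assumes B: "B \<in> sets borel_S2"
  shows "emeasure area_S2 B = 3 * emeasure lborel (open_cone B)"
proof -
  define \<sigma> :: "complex \<Rightarrow> real^3" where "\<sigma> = (\<lambda>z. stereo_inv (Some z))"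
  have [measurable]: "\<sigma> \<in> borel \<rightarrow>\<^sub>M borel_S2" by (simp add: \<sigma>_def)
  have Bb[measurable]: "B \<in> sets borel" and Bs: "B \<subseteq> sphere 0 1" using sets_borel_S2_D[OF B] by auto
  have [measurable]: "\<sigma> \<in> borel \<rightarrow>\<^sub>M borel"
    unfolding \<sigma>_def by (intro borel_measurable_continuous_onI continuous_on_stereo_inv_Some)
  let ?S = "{v::real^3. 0 < v$3 \<and> v$3 < 1 \<and> \<sigma> (Complex (v$1) (v$2)) \<in> B}"
  have cC: "continuous_on UNIV (\<lambda>v::real^3. Complex (v$1) (v$2))"
    unfolding Complex_eq by (intro continuous_intros)
  have [measurable]: "(\<lambda>v::real^3. Complex (v$1) (v$2)) \<in> borel \<rightarrow>\<^sub>M borel"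
    by (intro borel_measurable_continuous_onI cC)
  have S[measurable]: "?S \<in> sets borel"
  proof -
    have "?S = {v\<in>space borel. 0 < v$3 \<and> v$3 < 1 \<and> \<sigma> (Complex (v$1) (v$2)) \<in> B}" by simp
    also have "\<dots> \<in> sets borel" by measurable
    finally show ?thesis .
  qed
  let ?B' = "B - {vector [0,0,1]}"
  have B': "?B' \<in> sets borel_S2" using B by (auto simp: sets_restrict_space_iff)
  have im: "cone_chart ` ?S = open_cone ?B'" using cone_chart_image[OF Bs] by (simp add: \<sigma>_def)

  have lm: "open_cone ?B' \<in> lmeasurable"
    using borel_cone[OF B'] by (intro bounded_set_imp_lmeasurable) (auto simp: bounded_open_cone)
  define f :: "real^3 \<Rightarrow> real" where "f = (\<lambda>v. 4 * (v$3)\<^sup>2 / ((v$1)\<^sup>2 + (v$2)\<^sup>2 + 1)\<^sup>2)"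
  have "((\<lambda>v. \<bar>det (matrix (cone_chart_deriv v))\<bar>) has_integral measure lebesgue (open_cone ?B')) ?S"
  proof (subst has_measure_differentiable_image[symmetric])
    show "?S \<in> sets lebesgue" using S by simp
    show "inj_on cone_chart ?S" by (rule inj_on_subset[OF inj_on_cone_chart]) auto
    show "cone_chart ` ?S \<in> lmeasurable \<and> measure lebesgue (cone_chart ` ?S) = measure lebesgue (open_cone ?B')"
      unfolding im using lm by simp
  qed (rule has_derivative_cone_chart)
  then have hi: "(f has_integral measure lebesgue (open_cone ?B')) ?S" unfolding det_cone_chart_deriv f_def .
  have "emeasure lborel (open_cone ?B') = ennreal (measure lebesgue (open_cone ?B'))"
  proof -
    have "emeasure lborel (open_cone ?B') = emeasure lebesgue (open_cone ?B')"
      using borel_cone[OF B'] by (subst emeasure_completion) auto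
    then show ?thesis using emeasure_eq_measure2[OF lm] by simp
  qed
  also have "\<dots> = (\<integral>\<^sup>+v. ennreal (indicator ?S v * f v) \<partial>lborel)"
    by (rule nn_integral_has_integral_lebesgue[OF _ hi, symmetric]) (simp add: f_def)
  also have "\<dots> = (\<integral>\<^sup>+v. ennreal (indicator ?S v * f v)
      \<partial>distr (lborel \<Otimes>\<^sub>M lborel) borel (\<lambda>(z, r). vector [Re z, Im z, r]))"
    by (simp flip: lborel_vec_3)
  also have "\<dots> = (\<integral>\<^sup>+(z, r). ennreal (indicator ?S (vector [Re z, Im z, r]) * f (vector [Re z, Im z, r]))
       \<partial>(lborel \<Otimes>\<^sub>M lborel))"
  proof -
    have "continuous_on UNIV (\<lambda>(z, r). vector [Re z, Im z, r] :: real^3)"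
      unfolding case_prod_beta by (intro continuous_intros)
    then have m: "(\<lambda>(z, r). vector [Re z, Im z, r] :: real^3) \<in> lborel \<Otimes>\<^sub>M lborel \<rightarrow>\<^sub>M borel"
      unfolding lborel_prod by (simp add: borel_measurable_continuous_onI)
    have [measurable]: "f \<in> borel_measurable borel" unfolding f_def by measurable
    show ?thesis by (subst nn_integral_distr[OF m]) (auto intro!: nn_integral_cong simp: case_prod_beta)
  qed
  also have "\<dots> = (\<integral>\<^sup>+(z, r). (ennreal (4 / (1 + (norm z)\<^sup>2)\<^sup>2) * indicator B (\<sigma> z)) * ennreal (r\<^sup>2 * indicator {0<..<1} r)
       \<partial>(lborel \<Otimes>\<^sub>M lborel))"
  proof (intro nn_integral_cong, clarify)
    fix z :: complex and r :: real
    have "indicator ?S (vector [Re z, Im z, r]) * f (vector [Re z, Im z, r])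
        = (4 / (1 + (norm z)\<^sup>2)\<^sup>2) * (r\<^sup>2 * indicator {0<..<1} r) * (indicator B (\<sigma> z) :: real)"
      by (simp add: f_def cmod_power2 indicator_def add.commute)
    then show "ennreal (indicator ?S (vector [Re z, Im z, r]) * f (vector [Re z, Im z, r]))
        = (ennreal (4 / (1 + (norm z)\<^sup>2)\<^sup>2) * indicator B (\<sigma> z)) * ennreal (r\<^sup>2 * indicator {0<..<1} r)"
      by (auto simp: indicator_def simp flip: ennreal_mult')
  qed
  also have "\<dots> = (\<integral>\<^sup>+z. (\<integral>\<^sup>+r. (ennreal (4 / (1 + (norm z)\<^sup>2)\<^sup>2) * indicator B (\<sigma> z)) * ennreal (r\<^sup>2 * indicator {0<..<1} r) \<partial>lborel) \<partial>lborel)"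
    by (subst lborel.nn_integral_fst[symmetric]) auto
  also have "\<dots> = (\<integral>\<^sup>+z. (ennreal (4 / (1 + (norm z)\<^sup>2)\<^sup>2) * indicator B (\<sigma> z)) * ennreal (1 / 3) \<partial>lborel)"
    by (subst nn_integral_cmult) (auto simp: nn_integral_square_unit)
  also have "\<dots> = emeasure area_S2 B * ennreal (1 / 3)"
    by (subst nn_integral_multc) (auto simp: emeasure_area_S2[OF B], simp add: \<sigma>_def)
  finally have "3 * emeasure lborel (open_cone ?B') = ennreal 3 * (emeasure area_S2 B * ennreal (1 / 3))"
    by simp
  also have "\<dots> = emeasure area_S2 B * ennreal (3 * (1 / 3))"
    by (subst ennreal_mult) (auto simp: mult_ac)
  finally have *: "emeasure area_S2 B = 3 * emeasure lborel (open_cone ?B')" by simp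
  \<comment> \<open>The cone over the north pole is a segment inside the hyperplane where the first
    coordinate vanishes, hence null.\<close>
  have "emeasure lborel (open_cone B) = emeasure lborel (open_cone ?B')"
  proof (rule emeasure_eq_AE)
    have "negligible {x::real^3. axis 1 1 \<bullet> x = 0}"
      by (rule negligible_hyperplane) (simp add: axis_eq_0_iff)
    then have "{x::real^3. axis 1 1 \<bullet> x = 0} \<in> null_sets lborel"
      by (simp add: negligible_iff_null_sets null_sets_completion_iff)
    from AE_not_in[OF this] show "AE x in lborel. x \<in> open_cone B \<longleftrightarrow> x \<in> open_cone ?B'"
      by eventually_elim (auto simp: open_cone_def inner_axis' vec_eq_iff[of _ "vector _"] forall_3)
  qed (use B B' borel_cone in auto)
  then show ?thesis using * by simp
qed

lemma emeasure_lborel_orthogonal_image: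
  fixes g :: "real^3 \<Rightarrow> real^3"
  assumes g: "orthogonal_transformation g" and A: "A \<in> sets borel" "bounded A" and gA: "g ` A \<in> sets borel"
  shows "emeasure lborel (g ` A) = emeasure lborel A"
proof -
  have lm: "A \<in> lmeasurable" using A by (intro bounded_set_imp_lmeasurable) auto
  have "emeasure lebesgue (g ` A) = emeasure lebesgue A"
    using lm measure_orthogonal_image[OF g lm] measurable_orthogonal_image[OF g lm]
    by (simp add: emeasure_eq_measure2)
  then show ?thesis using A gA by (simp add: emeasure_completion)
qed

lemma measurable_orthogonal_S2 [intro]:
  assumes "orthogonal_transformation g" shows "g \<in> borel_S2 \<rightarrow>\<^sub>M borel_S2"
proof -
  have "g \<in> borel \<rightarrow>\<^sub>M borel"
    using assms by (intro borel_measurable_continuous_onI linear_continuous_on)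
      (auto simp: linear_conv_bounded_linear orthogonal_transformation_def)
  then show ?thesis
    by (intro measurable_restrict_space2 measurable_restrict_space1)
       (auto simp: space_restrict_space orthogonal_transformation_norm[OF assms])
qed

text \<open>The cone over the preimage of \<open>B\<close> is carried onto the cone over
  \<open>B\<close>, and orthogonal maps preserve volume.\<close>

lemma emeasure_area_S2_orthogonal:
  assumes g: "orthogonal_transformation g" and B: "B \<in> sets borel_S2"
  shows "emeasure area_S2 (g -` B \<inter> sphere 0 1) = emeasure area_S2 B"
proof -
  let ?A = "g -` B \<inter> sphere 0 1"
  have A: "?A \<in> sets borel_S2"
    using measurable_sets[OF measurable_orthogonal_S2[OF g] B] by simp
  have bij: "surj g" using orthogonal_transformation_surj[OF g] .
  have n: "norm (g y) = norm y" for y by (rule orthogonal_transformation_norm[OF g])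
  have l: "linear g" by (rule orthogonal_transformation_linear[OF g])
  have z: "g y = 0 \<longleftrightarrow> y = 0" for y by (metis n norm_eq_zero)
  have "y \<in> open_cone ?A \<longleftrightarrow> g y \<in> open_cone B" for y
    using sets_borel_S2_D[OF B] by (auto simp: open_cone_def n z linear_scale[OF l])
  then have "g ` open_cone ?A = open_cone B" using bij by (auto simp: set_eq_iff image_iff surj_def) metis
  then have "emeasure lborel (open_cone B) = emeasure lborel (open_cone ?A)"
    using emeasure_lborel_orthogonal_image[OF g borel_cone[OF A] bounded_open_cone] borel_cone[OF B] by simp
  then show ?thesis by (simp add: emeasure_area_S2_cone[OF A] emeasure_area_S2_cone[OF B])
qed

lemma distr_mu_S2_orthogonal:
  assumes g: "orthogonal_transformation g"
  shows "distr mu_S2 borel_S2 g = mu_S2"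
proof (rule measure_eqI)
  fix B assume "B \<in> sets (distr mu_S2 borel_S2 g)"
  then have B: "B \<in> sets borel_S2" by simp
  have "g \<in> mu_S2 \<rightarrow>\<^sub>M borel_S2" using measurable_orthogonal_S2[OF g] by (simp cong: measurable_cong_sets)
  then show "emeasure (distr mu_S2 borel_S2 g) B = emeasure mu_S2 B"
    using B by (subst emeasure_distr) (auto simp: mu_S2_def emeasure_area_S2_orthogonal[OF g B] space_scale_measure)
qed simp

lemma emeasure_area_S2_sphere: "emeasure area_S2 (sphere 0 1) = ennreal (4 * pi)"
proof -
  have S: "sphere 0 1 \<in> sets borel_S2" by (simp add: sets_restrict_space_iff)
  have "open_cone (sphere 0 1) = ball 0 1 - {0}" by (auto simp: open_cone_def)
  then have "emeasure lborel (open_cone (sphere 0 1)) = emeasure lborel (ball (0::real^3) 1)"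
    by (simp add: emeasure_Diff_null_set finite_imp_null_set_lborel)
  also have "\<dots> = ennreal (4 / 3 * pi)" by (simp add: emeasure_ball unit_ball_vol_3)
  finally have "emeasure area_S2 (sphere 0 1) = ennreal 3 * ennreal (4 / 3 * pi)" by (simp add: emeasure_area_S2_cone[OF S])
  also have "\<dots> = ennreal (4 * pi)" by (subst ennreal_mult[symmetric]) auto
  finally show ?thesis .
qed

lemma prob_space_mu_S2: "prob_space mu_S2"
proof
  have "emeasure mu_S2 (space mu_S2) = ennreal (1 / (4 * pi)) * ennreal (4 * pi)"
    by (simp add: mu_S2_def emeasure_area_S2_sphere space_scale_measure)
  also have "\<dots> = 1" by (subst ennreal_mult[symmetric]) auto
  finally show "emeasure mu_S2 (space mu_S2) = 1" .
qed

lemma integral_mu_S2_orthogonal: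
  fixes h :: "real^3 \<Rightarrow> 'b::{banach, second_countable_topology}"
  assumes g: "orthogonal_transformation g" and h: "h \<in> borel_measurable borel_S2"
  shows "(\<integral>\<omega>. h (g \<omega>) \<partial>mu_S2) = (\<integral>\<omega>. h \<omega> \<partial>mu_S2)"
proof -
  have "g \<in> mu_S2 \<rightarrow>\<^sub>M borel_S2" using measurable_orthogonal_S2[OF g] by (simp cong: measurable_cong_sets)
  from integral_distr[OF this h] show ?thesis by (simp add: distr_mu_S2_orthogonal[OF g])
qed

section \<open>Integration in the chart and change of variables under translations\<close>

definition chart_density :: "complex \<Rightarrow> real" where
  "chart_density z = 1 / (pi * (1 + (norm z)\<^sup>2)\<^sup>2)"

lemma mu_S2_chart: "mu_S2 = distr (density lborel (\<lambda>z. ennreal (chart_density z))) borel_S2 (\<lambda>z. stereo_inv (Some z))"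
proof (rule measure_eqI)
  fix B assume "B \<in> sets mu_S2"
  then have B: "B \<in> sets borel_S2" by simp
  have [measurable]: "(\<lambda>z. stereo_inv (Some z)) \<in> borel_measurable borel"
    by (intro borel_measurable_continuous_onI continuous_on_stereo_inv_Some)
  have [measurable]: "B \<in> sets borel" using sets_borel_S2_D[OF B] by blast
  have [measurable]: "chart_density \<in> borel_measurable borel" unfolding chart_density_def by measurable
  have "(\<lambda>z. stereo_inv (Some z)) -` B \<inter> space borel \<in> sets (borel :: complex measure)"
    by (rule measurable_sets[OF measurable_stereo_inv_Some B])
  then have "emeasure (distr (density lborel (\<lambda>z. ennreal (chart_density z))) borel_S2 (\<lambda>z. stereo_inv (Some z))) B
     = (\<integral>\<^sup>+z. ennreal (chart_density z) * indicator B (stereo_inv (Some z)) \<partial>lborel)"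
    using B by (subst emeasure_distr) (auto simp: emeasure_density indicator_def intro!: nn_integral_cong)
  also have "\<dots> = (\<integral>\<^sup>+z. ennreal (1 / (4 * pi)) * (ennreal (4 / (1 + (norm z)\<^sup>2)\<^sup>2) * indicator B (stereo_inv (Some z))) \<partial>lborel)"
    by (intro nn_integral_cong) (simp add: chart_density_def indicator_def flip: ennreal_mult')
  also have "\<dots> = emeasure mu_S2 B"
    by (subst nn_integral_cmult) (simp_all add: mu_S2_def emeasure_area_S2[OF B])
  finally show "emeasure mu_S2 B = emeasure (distr (density lborel (\<lambda>z. ennreal (chart_density z))) borel_S2 (\<lambda>z. stereo_inv (Some z))) B" ..
qed simp

lemma chart_density_pos: "chart_density z > 0"
  using norm_sq_plus_1_pos[of z]
  by (auto simp: chart_density_def add.commute intro!: divide_pos_pos mult_pos_pos)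

lemma borel_measurable_chart_density [measurable]: "chart_density \<in> borel_measurable borel"
  unfolding chart_density_def by measurable

lemma integral_mu_S2_chart:
  fixes h :: "real^3 \<Rightarrow> 'b::{banach, second_countable_topology}"
  assumes h[measurable]: "h \<in> borel_measurable borel_S2"
  shows "(\<integral>\<omega>. h \<omega> \<partial>mu_S2) = (\<integral>z. chart_density z *\<^sub>R h (stereo_inv (Some z)) \<partial>lborel)"
    "integrable mu_S2 h \<longleftrightarrow> integrable lborel (\<lambda>z. chart_density z *\<^sub>R h (stereo_inv (Some z)))"
  unfolding mu_S2_chart
  using less_imp_le[OF chart_density_pos]
  by (simp_all add: integral_distr integrable_distr_eq integral_density integrable_density)

lemma mu_S2_singleton: "emeasure mu_S2 {\<zeta>} = 0"
proof (cases "norm \<zeta> = 1")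
  case False
  then show ?thesis by (intro emeasure_notin_sets) (auto simp: sets_restrict_space_iff)
next
  case True
  then have B: "{\<zeta>} \<in> sets borel_S2" by (simp add: sets_restrict_space_iff)
  have "(\<integral>\<^sup>+z. ennreal (4 / (1 + (norm z)\<^sup>2)\<^sup>2) * indicator {\<zeta>} (stereo_inv (Some z)) \<partial>lborel) = (\<integral>\<^sup>+z. 0 \<partial>(lborel :: complex measure))"
  proof (rule nn_integral_cong_AE)
    show "AE z in lborel. ennreal (4 / (1 + (norm z)\<^sup>2)\<^sup>2) * indicator {\<zeta>} (stereo_inv (Some z)) = 0"
    proof (cases "\<exists>z. stereo_inv (Some z) = \<zeta>")
      case True
      then obtain w where "stereo_inv (Some w) = \<zeta>" by blast
      moreover have "AE z in lborel. z \<noteq> w" by (rule AE_lborel_singleton)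
      ultimately show ?thesis by (auto simp: indicator_def elim!: eventually_mono)
    next
      case False
      then show ?thesis by (auto simp: indicator_def)
    qed
  qed
  then show ?thesis by (simp add: mu_S2_def emeasure_area_S2[OF B])
qed

lemma mu_S2_finite: "finite A \<Longrightarrow> A \<subseteq> sphere 0 1 \<Longrightarrow> A \<in> null_sets mu_S2"
proof -
  assume A: "finite A" "A \<subseteq> sphere 0 1"
  have "(\<Union>x\<in>A. {x}) \<in> null_sets mu_S2"
    using A by (intro null_sets_UN' countable_finite) (auto simp: mu_S2_singleton null_sets_def sets_restrict_space_iff)
  then show ?thesis by simp
qed

lemma measurable_mobius [measurable]:
  assumes "norm y < 1" shows "mobius y \<in> borel_S2 \<rightarrow>\<^sub>M borel_S2"
proof (rule measurable_restrict_space2)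
  show "mobius y \<in> borel_S2 \<rightarrow>\<^sub>M borel"
    by (intro borel_measurable_continuous_on_restrict continuous_on_subset[OF continuous_on_mobius[OF assms]]) auto
qed (auto simp: norm_mobius_eq_1[OF _ assms])

text \<open>The Poisson kernel of hyperbolic 3-space: for unit \<open>\<omega>\<close> the
  denominator is the squared distance from \<open>\<omega>\<close> to \<open>x\<close>, and the
  exponent 2 is the dimension of the sphere. It is the density of the image of \<open>mu_S2\<close>
  under \<open>mobius (- x)\<close>.\<close>

definition poisson :: "'a::real_inner \<Rightarrow> 'a \<Rightarrow> real" where
  "poisson x \<omega> = ((1 - (norm x)\<^sup>2) / (1 - 2 * (\<omega> \<bullet> x) + (norm x)\<^sup>2))\<^sup>2"

lemma borel_measurable_poisson [measurable]: "poisson (x :: real^3) \<in> borel_measurable borel_S2"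
proof -
  have "poisson x \<in> borel_measurable borel" unfolding poisson_def by measurable
  then show ?thesis by (rule measurable_restrict_space1)
qed

text \<open>A translation along the polar axis fixes both poles and is a dilation of the chart, with
  ratio \<open>(1 + s) / (1 - s)\<close>. The second claim says that the dilated density is the old
  one times \<open>poisson\<close>.\<close>

lemma mobius_dilation:
  assumes s: "0 \<le> s" "s < 1"
  shows "mobius (- (s *\<^sub>R axis 3 1)) (stereo_inv (Some z)) = stereo_inv (Some (((1 + s) / (1 - s)) *\<^sub>R z))" (is ?th1)
    and "chart_density (((1 - s) / (1 + s)) *\<^sub>R z) * ((1 - s) / (1 + s))\<^sup>2 =
      chart_density z * poisson (s *\<^sub>R axis 3 1) (stereo_inv (Some z))" (is ?th2)
proof -
  define N where "N = (norm z)\<^sup>2"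
  define n where "n = N + 1"
  have N: "N \<ge> 0" and n: "n > 0" by (simp_all add: N_def n_def add_nonneg_pos)
  define L where "L = (1 + s) / (1 - s)"
  have L: "L > 0" using s by (simp add: L_def)
  have i: "stereo_inv (Some z) \<bullet> axis 3 1 = (N - 1) / n"
    by (simp add: stereo_inv_component N_def n_def inner_axis)
  have m: "norm (s *\<^sub>R axis 3 1 :: real^3) = s" using s by simp
  have LL: "(1 - s)\<^sup>2 * L\<^sup>2 = (1 + s)\<^sup>2" "(1 + s)\<^sup>2 * (1 / L)\<^sup>2 = (1 - s)\<^sup>2"
    using s by (simp_all add: L_def power_divide)
  have LL1: "(1 - s)\<^sup>2 * (L\<^sup>2 * N + 1) = (1 + s)\<^sup>2 * N + (1 - s)\<^sup>2"
    unfolding LL(1)[symmetric] by algebra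
  have LL2: "(1 - s)\<^sup>2 * (L\<^sup>2 * N - 1) = (1 + s)\<^sup>2 * N - (1 - s)\<^sup>2"
    unfolding LL(1)[symmetric] by algebra
  have LL3: "(1 + s)\<^sup>2 * ((1 / L)\<^sup>2 * N + 1) = (1 - s)\<^sup>2 * N + (1 + s)\<^sup>2"
    unfolding LL(2)[symmetric] by algebra
  have e: "1 + 2 * (s * ((N - 1) / n)) + s\<^sup>2 = (1 - s)\<^sup>2 * (L\<^sup>2 * N + 1) / n"
    unfolding LL1 using n by (simp add: divide_simps) (simp add: n_def power2_eq_square algebra_simps)
  have p: "L\<^sup>2 * N + 1 > 0" using N by (simp add: add_nonneg_pos)
  have nL: "(norm (L *\<^sub>R z))\<^sup>2 = L\<^sup>2 * N" by (simp add: N_def power_mult_distrib)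
  have mb: "mobius (- (s *\<^sub>R axis 3 1)) (stereo_inv (Some z)) =
     ((1 - s\<^sup>2) *\<^sub>R stereo_inv (Some z) + ((2 + 2 * (s * ((N - 1) / n))) * s) *\<^sub>R axis 3 1) /\<^sub>R ((1 - s)\<^sup>2 * (L\<^sup>2 * N + 1) / n)"
    unfolding e[symmetric] mobius_def norm_minus_cancel inner_minus_right norm_stereo_inv_Some inner_scaleR_right i m by simp
  have "stereo_inv (Some z) $ 1 = 2 * Re z / n" "stereo_inv (Some z) $ 2 = 2 * Im z / n" "stereo_inv (Some z) $ 3 = (N - 1) / n"
    "stereo_inv (Some (L *\<^sub>R z)) $ 1 = 2 * L * Re z / (L\<^sup>2 * N + 1)"
    "stereo_inv (Some (L *\<^sub>R z)) $ 2 = 2 * L * Im z / (L\<^sup>2 * N + 1)"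
    "stereo_inv (Some (L *\<^sub>R z)) $ 3 = (L\<^sup>2 * N - 1) / (L\<^sup>2 * N + 1)"
    unfolding stereo_inv_component nL by (simp_all add: N_def n_def)
  note cs = this
  have a1: "(1 - s\<^sup>2) = (1 - s)\<^sup>2 * L" using s by (simp add: L_def power2_eq_square field_simps)
  have "(1 - s\<^sup>2) * ((N - 1) / n) + (2 + 2 * (s * ((N - 1) / n))) * s = (1 - s)\<^sup>2 * (L\<^sup>2 * N - 1) / n"
    unfolding LL2 using n by (simp add: divide_simps) (simp add: n_def power2_eq_square algebra_simps)
  then have "mobius (- (s *\<^sub>R axis 3 1)) (stereo_inv (Some z)) = stereo_inv (Some (L *\<^sub>R z))"
    unfolding vec_eq_iff forall_3 mb using s n p
    by (simp add: cs axis_def a1)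
  then show ?th1 by (simp add: L_def)
  have "1 - 2 * (stereo_inv (Some z) \<bullet> s *\<^sub>R axis 3 1) + s\<^sup>2 = (1 + s)\<^sup>2 * ((1/L)\<^sup>2 * N + 1) / n"
    unfolding inner_scaleR_right i
    unfolding LL3 using n by (simp add: divide_simps) (simp add: n_def power2_eq_square algebra_simps)
  then have P: "poisson (s *\<^sub>R axis 3 1) (stereo_inv (Some z)) = ((1 - s\<^sup>2) * n / ((1 + s)\<^sup>2 * ((1/L)\<^sup>2 * N + 1)))\<^sup>2"
    unfolding poisson_def m using n by simp
  have "(1 - s\<^sup>2) = (1 + s)\<^sup>2 * (1 / L)" using s by (simp add: L_def power2_eq_square field_simps)
  then have P': "poisson (s *\<^sub>R axis 3 1) (stereo_inv (Some z)) = (1 / L * n / ((1/L)\<^sup>2 * N + 1))\<^sup>2"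
    unfolding P using s by simp
  have "(norm ((1 / L) *\<^sub>R z))\<^sup>2 = (1 / L)\<^sup>2 * N" by (simp add: N_def power_mult_distrib power_divide)
  then have "chart_density ((1 / L) *\<^sub>R z) * (1 / L)\<^sup>2 = (1 / L)\<^sup>2 / (pi * (1 + (1 / L)\<^sup>2 * N)\<^sup>2)"
    unfolding chart_density_def by simp
  moreover have "chart_density z = 1 / (pi * n\<^sup>2)" by (simp add: chart_density_def n_def N_def add.commute)
  ultimately have "chart_density ((1 / L) *\<^sub>R z) * (1 / L)\<^sup>2 = chart_density z * poisson (s *\<^sub>R axis 3 1) (stereo_inv (Some z))"
    unfolding P' using n by (simp add: power_divide power_mult_distrib add.commute)
  then show ?th2 by (simp add: L_def)
qed

text \<open>Substitution \<open>z\<close> by \<open>L\<close> times \<open>z\<close> in the plane,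
  whose Jacobian is \<open>L^2\<close>.\<close>

lemma integral_mu_S2_dilation:
  fixes h :: "real^3 \<Rightarrow> 'b::{banach, second_countable_topology}"
  assumes s: "0 \<le> s" "s < 1" and h[measurable]: "h \<in> borel_measurable borel_S2"
  shows "(\<integral>\<omega>. h (mobius (- (s *\<^sub>R axis 3 1)) \<omega>) \<partial>mu_S2) = (\<integral>\<omega>. poisson (s *\<^sub>R axis 3 1) \<omega> *\<^sub>R h \<omega> \<partial>mu_S2)"
proof -
  define L where "L = (1 + s) / (1 - s)"
  have L: "L > 0" "1 / L = (1 - s) / (1 + s)" using s by (simp_all add: L_def)
  have [measurable]: "mobius (- (s *\<^sub>R axis 3 1)) \<in> borel_S2 \<rightarrow>\<^sub>M borel_S2"
    using s by (intro measurable_mobius) simp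
  have "(\<integral>\<omega>. poisson (s *\<^sub>R axis 3 1) \<omega> *\<^sub>R h \<omega> \<partial>mu_S2) =
     (\<integral>z. (chart_density ((1 / L) *\<^sub>R z) * (1 / L)\<^sup>2) *\<^sub>R h (stereo_inv (Some z)) \<partial>lborel)"
    using s by (subst integral_mu_S2_chart) (simp_all add: mobius_dilation(2)[OF s] L(2))
  also have "\<dots> = (\<integral>z. (chart_density ((1 / L) *\<^sub>R z) * (1 / L)\<^sup>2) *\<^sub>R h (stereo_inv (Some z))
      \<partial>density (distr lborel borel (\<lambda>z. 0 + L *\<^sub>R z)) (\<lambda>_. ennreal (\<bar>L\<bar> ^ DIM(complex))))"
    using L by (subst lborel_affine[of L 0]) simp_all
  also have "\<dots> = (\<integral>z. L\<^sup>2 *\<^sub>R ((chart_density z * (1 / L)\<^sup>2) *\<^sub>R h (stereo_inv (Some (L *\<^sub>R z)))) \<partial>lborel)"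
    using L(1) by (simp add: integral_density integral_distr)
  also have "\<dots> = (\<integral>z. chart_density z *\<^sub>R h (stereo_inv (Some (L *\<^sub>R z))) \<partial>lborel)"
    using L(1) by (simp add: power_divide)
  also have "\<dots> = (\<integral>\<omega>. h (mobius (- (s *\<^sub>R axis 3 1)) \<omega>) \<partial>mu_S2)"
    by (subst integral_mu_S2_chart) (simp_all add: mobius_dilation(1)[OF s] L_def)
  finally show ?thesis ..
qed

text \<open>A rotation moves \<open>x\<close> to the polar axis, where the translation is a
  dilation; measure, kernel and translations are all equivariant under it.\<close>

theorem integral_mu_S2_poisson:
  fixes h :: "real^3 \<Rightarrow> 'b::{banach, second_countable_topology}"
  assumes x: "norm x < 1" and h[measurable]: "h \<in> borel_measurable borel_S2"
  shows "(\<integral>\<omega>. h (mobius (- x) \<omega>) \<partial>mu_S2) = (\<integral>\<omega>. poisson x \<omega> *\<^sub>R h \<omega> \<partial>mu_S2)"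
proof -
  define s where "s = norm x"
  have s: "0 \<le> s" "s < 1" using x by (simp_all add: s_def)
  have "norm (s *\<^sub>R axis 3 1 :: real^3) = norm x" by (simp add: s_def)
  then obtain g where g: "orthogonal_transformation g" and gx: "g (s *\<^sub>R axis 3 1 :: real^3) = x"
    by (rule orthogonal_transformation_exists)
  let ?e = "s *\<^sub>R axis 3 1 :: real^3"
  have [measurable]: "mobius (- x) \<in> borel_S2 \<rightarrow>\<^sub>M borel_S2" "g \<in> borel_S2 \<rightarrow>\<^sub>M borel_S2"
    using x g by (auto intro!: measurable_mobius)
  have gm: "g (- ?e) = - x" using gx linear_neg[OF orthogonal_transformation_linear[OF g]] by metis
  have "poisson ?e \<omega> = poisson (g ?e) (g \<omega>)" for \<omega>
    using g unfolding poisson_def orthogonal_transformation_norm[OF g] by (simp add: orthogonal_transformation_def)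
  then have p: "poisson ?e \<omega> = poisson x (g \<omega>)" for \<omega> unfolding gx .
  have "(\<integral>\<omega>. h (mobius (- x) \<omega>) \<partial>mu_S2) = (\<integral>\<omega>. h (mobius (- x) (g \<omega>)) \<partial>mu_S2)"
    by (rule integral_mu_S2_orthogonal[OF g, symmetric]) measurable
  also have "\<dots> = (\<integral>\<omega>. h (g (mobius (- ?e) \<omega>)) \<partial>mu_S2)"
    by (simp only: orthogonal_transformation_mobius[OF g] flip: gm)
  also have "\<dots> = (\<integral>\<omega>. poisson ?e \<omega> *\<^sub>R h (g \<omega>) \<partial>mu_S2)"
    by (rule integral_mu_S2_dilation[OF s]) measurable
  also have "\<dots> = (\<integral>\<omega>. poisson x (g \<omega>) *\<^sub>R h (g \<omega>) \<partial>mu_S2)" by (simp only: p)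
  also have "\<dots> = (\<integral>\<omega>. poisson x \<omega> *\<^sub>R h \<omega> \<partial>mu_S2)"
    by (rule integral_mu_S2_orthogonal[OF g]) measurable
  finally show ?thesis .
qed

section \<open>Barycenters\<close>

lemma mobius_unit: "norm \<zeta> = 1 \<Longrightarrow> mobius y \<zeta> =
    ((1 - (norm y)\<^sup>2) *\<^sub>R \<zeta> - (2 - 2 * (\<zeta> \<bullet> y)) *\<^sub>R y) /\<^sub>R (1 - 2 * (\<zeta> \<bullet> y) + (norm y)\<^sup>2)"
  by (simp add: mobius_def)

lemma mobius_unit_denom_pos:
  "norm \<zeta> = 1 \<Longrightarrow> norm y < 1 \<Longrightarrow> 1 - 2 * (\<zeta> \<bullet> y) + (norm y)\<^sup>2 > 0"
  using mobius_denom_pos[of \<zeta> y] by simp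

lemma mobius_unit_denom:
  assumes "norm \<zeta> = 1"
  shows "1 - 2 * (\<zeta> \<bullet> y) + (norm y)\<^sup>2 \<le> (1 + norm y)\<^sup>2" "(1 - norm y)\<^sup>2 \<le> 1 - 2 * (\<zeta> \<bullet> y) + (norm y)\<^sup>2"
  using Cauchy_Schwarz_ineq2[of \<zeta> y] assms by (simp_all add: power2_eq_square algebra_simps abs_le_iff)

text \<open>Once a multiple of the denominator is split off the numerator, what remains is minus
  twice the Gram determinant of \<open>y\<close> and the unit vector \<open>\<zeta>\<close>.\<close>

lemma inner_mobius_self:
  assumes "norm \<zeta> = 1" "norm y < 1"
  shows "y \<bullet> mobius y \<zeta> = y \<bullet> \<zeta> - 2 * ((norm y)\<^sup>2 - (y \<bullet> \<zeta>)\<^sup>2) / (1 - 2 * (\<zeta> \<bullet> y) + (norm y)\<^sup>2)"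
proof -
  define D where "D = 1 - 2 * (y \<bullet> \<zeta>) + (norm y)\<^sup>2"
  have D: "D > 0" using mobius_denom_pos[of \<zeta> y] assms by (simp add: D_def inner_commute)
  have "y \<bullet> mobius y \<zeta> = ((1 - (norm y)\<^sup>2) * (y \<bullet> \<zeta>) - (2 - 2 * (y \<bullet> \<zeta>)) * (norm y)\<^sup>2) / D"
    by (simp add: mobius_unit[OF assms(1)] inner_diff_right power2_norm_eq_inner inner_commute D_def divide_inverse mult.commute)
  also have "(1 - (norm y)\<^sup>2) * (y \<bullet> \<zeta>) - (2 - 2 * (y \<bullet> \<zeta>)) * (norm y)\<^sup>2 = D * (y \<bullet> \<zeta>) - 2 * ((norm y)\<^sup>2 - (y \<bullet> \<zeta>)\<^sup>2)"
    unfolding D_def by algebra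
  finally show ?thesis using D by (simp add: diff_divide_distrib) (simp add: D_def inner_commute)
qed

lemma inner_sq_le: "norm \<zeta> = 1 \<Longrightarrow> (y \<bullet> \<zeta>)\<^sup>2 \<le> (norm y)\<^sup>2"
  using Cauchy_Schwarz_ineq[of y \<zeta>] by (simp add: power2_norm_eq_inner) (simp flip: power2_norm_eq_inner)

text \<open>The denominator is at most 4 on the whole ball. This bound carries both the uniqueness
  of the barycenter and the a priori estimate \<open>implicit_lipschitz\<close>; the subtracted term
  is half the quadratic form of I - A.\<close>

lemma inner_mobius_self_le:
  assumes "norm \<zeta> = 1" "norm y < 1"
  shows "y \<bullet> mobius y \<zeta> \<le> y \<bullet> \<zeta> - ((norm y)\<^sup>2 - (y \<bullet> \<zeta>)\<^sup>2) / 2"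
proof -
  define D where "D = 1 - 2 * (\<zeta> \<bullet> y) + (norm y)\<^sup>2"
  have "(1 + norm y)\<^sup>2 \<le> 2\<^sup>2" using assms by (intro power_mono) auto
  then have D: "0 < D" "D \<le> 4"
    using mobius_denom_pos[of \<zeta> y] assms mobius_unit_denom(1)[OF assms(1), of y] by (simp_all add: D_def)
  have "(norm y)\<^sup>2 - (y \<bullet> \<zeta>)\<^sup>2 \<ge> 0" using inner_sq_le[OF assms(1)] by simp
  then have "D * ((norm y)\<^sup>2 - (y \<bullet> \<zeta>)\<^sup>2) \<le> 4 * ((norm y)\<^sup>2 - (y \<bullet> \<zeta>)\<^sup>2)"
    using D by (intro mult_right_mono) auto
  then have "((norm y)\<^sup>2 - (y \<bullet> \<zeta>)\<^sup>2) / 2 \<le> 2 * ((norm y)\<^sup>2 - (y \<bullet> \<zeta>)\<^sup>2) / D"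
    using D by (simp add: field_simps)
  then show ?thesis unfolding inner_mobius_self[OF assms] D_def by simp
qed

lemma tendsto_mobius_left:
  assumes "(f \<longlongrightarrow> y) F" "norm \<zeta> = 1" "1 - 2 * (\<zeta> \<bullet> y) + (norm y)\<^sup>2 \<noteq> 0"
  shows "((\<lambda>n. mobius (f n) \<zeta>) \<longlongrightarrow> mobius y \<zeta>) F"
  unfolding mobius_unit[OF assms(2)] by (intro tendsto_intros assms)

text \<open>When \<open>y\<close> tends to a boundary point, the translations collapse every other
  boundary point to its antipode. The formula for \<open>mobius\<close> still makes sense there and
  gives this limit.\<close>

lemma mobius_boundary:
  assumes "norm \<zeta> = 1" "norm \<xi> = 1" "\<zeta> \<noteq> \<xi>"
  shows "1 - 2 * (\<zeta> \<bullet> \<xi>) + (norm \<xi>)\<^sup>2 \<noteq> 0" "mobius \<xi> \<zeta> = - \<xi>"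
proof -
  have "(norm (\<zeta> - \<xi>))\<^sup>2 = 2 - 2 * (\<zeta> \<bullet> \<xi>)"
    using assms dot_norm_neg[of \<zeta> \<xi>] by simp
  moreover have "(norm (\<zeta> - \<xi>))\<^sup>2 > 0" using assms by simp
  ultimately have *: "2 - 2 * (\<zeta> \<bullet> \<xi>) > 0" by simp
  then show "1 - 2 * (\<zeta> \<bullet> \<xi>) + (norm \<xi>)\<^sup>2 \<noteq> 0" using assms by simp
  have "mobius \<xi> \<zeta> = (- ((2 - 2 * (\<zeta> \<bullet> \<xi>)) *\<^sub>R \<xi>)) /\<^sub>R (2 - 2 * (\<zeta> \<bullet> \<xi>))"
    using assms by (simp add: mobius_unit)
  also have "\<dots> = - \<xi>" using * by simp
  finally show "mobius \<xi> \<zeta> = - \<xi>" .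
qed

section \<open>Existence and uniqueness of the barycenter\<close>

locale sphere_prob = prob_space \<nu> for \<nu> :: "(real^3) measure" +
  assumes sets_nu [simp, measurable_cong]: "sets \<nu> = sets borel_S2"
begin

lemma space_nu [simp]: "space \<nu> = sphere 0 1"
  using sets_eq_imp_space_eq[OF sets_nu] by simp

lemma integrable_bounded:
  fixes h :: "real^3 \<Rightarrow> 'b::{banach, second_countable_topology}"
  assumes "h \<in> borel_measurable borel_S2" "\<And>\<zeta>. norm \<zeta> = 1 \<Longrightarrow> norm (h \<zeta>) \<le> B"
  shows "integrable \<nu> h"
proof (rule integrable_const_bound[where B = B])
  show "AE x in \<nu>. norm (h x) \<le> B" using assms(2) by (intro AE_I2) simp
  show "h \<in> borel_measurable \<nu>" using assms(1) by (simp cong: measurable_cong_sets)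
qed

lemma integrable_mobius [simp]:
  assumes "norm y < 1" shows "integrable \<nu> (mobius y)"
proof (rule integrable_bounded)
  show "mobius y \<in> borel_measurable borel_S2"
    using measurable_mobius[OF assms] by (rule measurable_restrict_space2_iff[THEN iffD1, THEN conjunct1])
  show "norm (mobius y \<zeta>) \<le> 1" if "norm \<zeta> = 1" for \<zeta>
    using norm_mobius_eq_1[OF that assms] by simp
qed

lemma measurable_isometry:
  assumes "hyp_isometry M" "M y = 0" "norm y < 1"
  shows "M \<in> \<nu> \<rightarrow>\<^sub>M borel_S2"
proof -
  obtain g where g: "orthogonal_transformation g" "\<And>z. norm z = 1 \<Longrightarrow> M z = g (mobius y z)"
    using hyp_isometry_to_0[OF assms] by metis
  have "M \<in> borel_S2 \<rightarrow>\<^sub>M borel"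
    using assms(1) by (intro borel_measurable_continuous_on_restrict)
      (auto simp: hyp_isometry_def intro: continuous_on_subset)
  then have "M \<in> borel_S2 \<rightarrow>\<^sub>M borel_S2"
    by (intro measurable_restrict_space2)
      (auto simp: g(2) norm_mobius_eq_1 orthogonal_transformation_norm[OF g(1)] assms(3))
  then show ?thesis by (simp cong: measurable_cong_sets)
qed

text \<open>Any admissible isometry is \<open>mobius y\<close> followed by an orthogonal map, which
  commutes with the integral and preserves its vanishing.\<close>

lemma balanced_at_iff: "balanced_at \<nu> y \<longleftrightarrow> norm y < 1 \<and> (\<integral>\<zeta>. mobius y \<zeta> \<partial>\<nu>) = 0"
proof -
  have *: "balanced (distr \<nu> borel_S2 M) \<longleftrightarrow> (\<integral>\<zeta>. mobius y \<zeta> \<partial>\<nu>) = 0"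
    if M: "hyp_isometry M" "M y = 0" "norm y < 1" for M
  proof -
    obtain g where g: "orthogonal_transformation g" "\<And>z. norm z = 1 \<Longrightarrow> M z = g (mobius y z)"
      using hyp_isometry_to_0[OF M] by metis
    have Mm: "M \<in> \<nu> \<rightarrow>\<^sub>M borel_S2" by (rule measurable_isometry[OF M])
    have bl: "bounded_linear g" using g(1) by (simp add: orthogonal_transformation_linear linear_conv_bounded_linear[symmetric])
    have "(\<integral>\<zeta>. \<zeta> \<partial>distr \<nu> borel_S2 M) = (\<integral>\<zeta>. M \<zeta> \<partial>\<nu>)"
      by (rule integral_distr[OF Mm]) (simp add: measurable_restrict_space1)
    also have "\<dots> = (\<integral>\<zeta>. g (mobius y \<zeta>) \<partial>\<nu>)"
      by (intro Bochner_Integration.integral_cong) (auto simp: g(2))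
    also have "\<dots> = g (\<integral>\<zeta>. mobius y \<zeta> \<partial>\<nu>)"
      using integral_bounded_linear[OF bl integrable_mobius[OF M(3)]] .
    finally have "(\<integral>\<zeta>. \<zeta> \<partial>distr \<nu> borel_S2 M) = 0 \<longleftrightarrow> (\<integral>\<zeta>. mobius y \<zeta> \<partial>\<nu>) = 0"
      using orthogonal_transformation_norm[OF g(1)] by (metis norm_eq_zero)
    moreover have "prob_space (distr \<nu> borel_S2 M)" by (rule prob_space_distr[OF Mm])
    ultimately show ?thesis by (simp add: balanced_def)
  qed
  show ?thesis
  proof
    assume "balanced_at \<nu> y" then show "norm y < 1 \<and> (\<integral>\<zeta>. mobius y \<zeta> \<partial>\<nu>) = 0"
      unfolding balanced_at_def using * by auto
  next
    assume "norm y < 1 \<and> (\<integral>\<zeta>. mobius y \<zeta> \<partial>\<nu>) = 0"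
    then show "balanced_at \<nu> y"
      unfolding balanced_at_def using *[of "mobius y"] by (auto intro!: exI[of _ "mobius y"] hyp_isometry_mobius)
  qed
qed

end

locale atomless_sphere_prob = sphere_prob +
  assumes atomless: "emeasure \<nu> {\<zeta>} = 0"
begin

lemma AE_neq: "AE \<zeta> in \<nu>. \<zeta> \<noteq> \<xi>"
proof (cases "norm \<xi> = 1")
  case True
  then have "{\<xi>} \<in> null_sets \<nu>" using atomless by (auto simp: null_sets_def sets_restrict_space_iff)
  from AE_not_in[OF this] show ?thesis by simp
qed (intro AE_I2, auto)

text \<open>Equality in Cauchy-Schwarz holds only at the two points
  \<open>y /\<^sub>R norm y\<close> and its negative, which together have measure zero.\<close>

lemma nondegenerate:
  assumes "y \<noteq> 0" shows "(\<integral>\<zeta>. (norm y)\<^sup>2 - (y \<bullet> \<zeta>)\<^sup>2 \<partial>\<nu>) > 0"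
proof -
  let ?h = "\<lambda>\<zeta>::real^3. (norm y)\<^sup>2 - (y \<bullet> \<zeta>)\<^sup>2"
  have i: "integrable \<nu> ?h"
  proof (rule integrable_bounded)
    have "?h \<in> borel_measurable borel" by measurable
    then show "?h \<in> borel_measurable borel_S2" by (rule measurable_restrict_space1)
    show "norm (?h \<zeta>) \<le> (norm y)\<^sup>2" if "norm \<zeta> = 1" for \<zeta>
      using inner_sq_le[OF that, of y] by simp
  qed
  have nn: "AE \<zeta> in \<nu>. 0 \<le> ?h \<zeta>" using inner_sq_le by (intro AE_I2) simp
  have "(\<integral>\<zeta>. ?h \<zeta> \<partial>\<nu>) \<noteq> 0"
  proof
    assume "(\<integral>\<zeta>. ?h \<zeta> \<partial>\<nu>) = 0"
    then have "AE \<zeta> in \<nu>. ?h \<zeta> = 0" using integral_nonneg_eq_0_iff_AE[OF i nn] by simp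
    moreover have "AE \<zeta> in \<nu>. \<zeta> \<noteq> y /\<^sub>R norm y" "AE \<zeta> in \<nu>. \<zeta> \<noteq> - (y /\<^sub>R norm y)" by (rule AE_neq)+
    moreover have "AE \<zeta> in \<nu>. norm \<zeta> = 1" by (intro AE_I2) simp
    ultimately have "AE \<zeta> in \<nu>. False"
    proof eventually_elim
      case (elim \<zeta>)
      then have "sqrt ((y \<bullet> \<zeta>)\<^sup>2) = sqrt ((norm y)\<^sup>2)" by simp
      then have "\<bar>y \<bullet> \<zeta>\<bar> = norm y * norm \<zeta>" using elim by simp
      then have "norm y *\<^sub>R \<zeta> = norm \<zeta> *\<^sub>R y \<or> norm y *\<^sub>R \<zeta> = - norm \<zeta> *\<^sub>R y"
        unfolding norm_cauchy_schwarz_abs_eq .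
      then have "norm y *\<^sub>R \<zeta> = y \<or> norm y *\<^sub>R \<zeta> = - y" using elim by simp
      moreover have "\<zeta> = (norm y *\<^sub>R \<zeta>) /\<^sub>R norm y" using assms by simp
      ultimately have "\<zeta> = y /\<^sub>R norm y \<or> \<zeta> = - (y /\<^sub>R norm y)" by (metis scaleR_minus_right)
      then show False using elim by blast
    qed
    then show False using ae_filter_bot by (simp add: trivial_limit_def)
  qed
  moreover have "(\<integral>\<zeta>. ?h \<zeta> \<partial>\<nu>) \<ge> 0" by (rule integral_nonneg_AE[OF nn])
  ultimately show ?thesis by linarith
qed

text \<open>Integrating \<open>inner_mobius_self_le\<close> makes the pairing of \<open>y\<close>
  with its own balance integral strictly negative unless \<open>y\<close> is 0.\<close>

lemma integral_mobius_0_imp: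
  assumes "(\<integral>\<zeta>. \<zeta> \<partial>\<nu>) = 0" "(\<integral>\<zeta>. mobius y \<zeta> \<partial>\<nu>) = 0" "norm y < 1"
  shows "y = 0"
proof (rule ccontr)
  assume y: "y \<noteq> 0"
  have i1: "integrable \<nu> (\<lambda>\<zeta>. \<zeta>)" using integrable_mobius[of 0] by (simp cong: Bochner_Integration.integrable_cong)
  have i2: "integrable \<nu> (\<lambda>\<zeta>::real^3. (norm y)\<^sup>2 - (y \<bullet> \<zeta>)\<^sup>2)"
    using nondegenerate[OF y] not_integrable_integral_eq by force
  have "0 = (\<integral>\<zeta>. y \<bullet> mobius y \<zeta> \<partial>\<nu>)"
    using assms by (simp add: integral_inner_right)
  also have "\<dots> \<le> (\<integral>\<zeta>. y \<bullet> \<zeta> - ((norm y)\<^sup>2 - (y \<bullet> \<zeta>)\<^sup>2) / 2 \<partial>\<nu>)"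
    using i1 i2 assms(3) inner_mobius_self_le by (intro integral_mono) auto
  also have "\<dots> = (\<integral>\<zeta>. y \<bullet> \<zeta> \<partial>\<nu>) - (\<integral>\<zeta>. (norm y)\<^sup>2 - (y \<bullet> \<zeta>)\<^sup>2 \<partial>\<nu>) / 2"
    using i1 i2 by (subst Bochner_Integration.integral_diff) auto
  also have "\<dots> < 0" using nondegenerate[OF y] i1 assms(1) by (simp add: integral_inner_right)
  finally show False by simp
qed

text \<open>The field \<open>V\<close> points strictly inwards on some sphere of radius
  \<open>r\<close>, by compactness and \<open>mobius_boundary\<close>; Brouwer then yields a zero
  inside.\<close>

lemma ex_balanced: "\<exists>y. norm y < 1 \<and> (\<integral>\<zeta>. mobius y \<zeta> \<partial>\<nu>) = 0"
proof -
  define V where "V y = (\<integral>\<zeta>. mobius y \<zeta> \<partial>\<nu>)" for y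
  have lim: "(\<lambda>n. V (y n)) \<longlonglongrightarrow> (\<integral>\<zeta>. h \<zeta> \<partial>\<nu>)"
    if y: "\<And>n. norm (y n) < 1" and h: "AE \<zeta> in \<nu>. (\<lambda>n. mobius (y n) \<zeta>) \<longlonglongrightarrow> h \<zeta>" "h \<in> borel_measurable \<nu>"
    for y :: "nat \<Rightarrow> real^3" and h :: "real^3 \<Rightarrow> real^3"
    unfolding V_def
  proof (rule integral_dominated_convergence[where w = "\<lambda>_. 1"])
    show "AE \<zeta> in \<nu>. norm (mobius (y i) \<zeta>) \<le> 1" for i
      using norm_mobius_eq_1[OF _ y[of i]] by (intro AE_I2) simp
    show "mobius (y i) \<in> borel_measurable \<nu>" for i by (rule borel_measurable_integrable[OF integrable_mobius[OF y]])
  qed (use h in auto)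
  have "\<exists>r. 0 < r \<and> r < 1 \<and> (\<forall>y. norm y = r \<longrightarrow> y \<bullet> V y < 0)"
  proof (rule ccontr)
    assume neg: "\<not> ?thesis"
    \<comment> \<open>If no radius works, radii tending to 1 give points with
      \<open>y \<bullet> V y\<close> nonnegative. At a limit point \<xi> of the sphere
      \<open>V\<close> tends to the antipode, so the pairing tends to -1.\<close>
    define r where "r n = 1 - 1 / real (Suc (Suc n))" for n
    have r: "0 < r n" "r n < 1" for n by (auto simp: r_def field_simps)
    then have "\<forall>n. \<exists>y. norm y = r n \<and> y \<bullet> V y \<ge> 0" using neg by (meson not_le)
    then obtain y where y: "\<And>n. norm (y n) = r n" "\<And>n. y n \<bullet> V (y n) \<ge> 0" by metis
    have "\<forall>n. y n \<in> cball 0 1" using y r by (auto simp: less_imp_le)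
    then obtain \<xi> \<phi> where \<phi>: "strict_mono \<phi>" "(y \<circ> \<phi>) \<longlonglongrightarrow> \<xi>"
      using compact_cball[of 0 1] unfolding compact_def by blast
    have "r \<longlonglongrightarrow> 1" unfolding r_def by real_asymp
    then have "(\<lambda>n. norm ((y \<circ> \<phi>) n)) \<longlonglongrightarrow> 1"
      using LIMSEQ_subseq_LIMSEQ[OF _ \<phi>(1)] by (simp add: y comp_def)
    then have \<xi>: "norm \<xi> = 1" using tendsto_norm[OF \<phi>(2)] LIMSEQ_unique by blast
    have "(\<lambda>n. V ((y \<circ> \<phi>) n)) \<longlonglongrightarrow> (\<integral>\<zeta>. - \<xi> \<partial>\<nu>)"
    proof (rule lim)
      show "norm ((y \<circ> \<phi>) n) < 1" for n using y r by simp
      have "AE \<zeta> in \<nu>. norm \<zeta> = 1" by (intro AE_I2) simp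
      with AE_neq[of \<xi>] show "AE \<zeta> in \<nu>. (\<lambda>n. mobius ((y \<circ> \<phi>) n) \<zeta>) \<longlonglongrightarrow> - \<xi>"
      proof eventually_elim
        case (elim \<zeta>)
        then show ?case
          using tendsto_mobius_left[OF \<phi>(2) elim(2)] mobius_boundary[OF elim(2) \<xi> elim(1)] by simp
      qed
    qed simp
    then have "(\<lambda>n. V ((y \<circ> \<phi>) n)) \<longlonglongrightarrow> - \<xi>" using prob_space by simp
    then have "(\<lambda>n. (y \<circ> \<phi>) n \<bullet> V ((y \<circ> \<phi>) n)) \<longlonglongrightarrow> \<xi> \<bullet> (- \<xi>)" by (intro tendsto_intros \<phi>)
    then have "0 \<le> \<xi> \<bullet> (- \<xi>)" using y(2) by (intro LIMSEQ_le_const) auto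
    then show False using \<xi> by (simp add: norm_eq_1)
  qed
  then obtain r where r: "0 < r" "r < 1" "\<And>y. norm y = r \<Longrightarrow> y \<bullet> V y < 0" by blast
  have contV: "continuous_on (cball 0 r) V"
  proof (rule continuous_on_sequentiallyI)
    fix u :: "nat \<Rightarrow> real^3" and a assume u: "\<forall>n. u n \<in> cball 0 r" "a \<in> cball 0 r" "u \<longlonglongrightarrow> a"
    have a: "norm a < 1" using u r by auto
    have "(\<lambda>n. V (u n)) \<longlonglongrightarrow> (\<integral>\<zeta>. mobius a \<zeta> \<partial>\<nu>)"
    proof (rule lim)
      show "norm (u n) < 1" for n using u(1) r(2) by (metis mem_cball_0 order_le_less_trans)
      show "AE \<zeta> in \<nu>. (\<lambda>n. mobius (u n) \<zeta>) \<longlonglongrightarrow> mobius a \<zeta>"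
        using mobius_unit_denom_pos[OF _ a] by (intro AE_I2 tendsto_mobius_left u(3)) force+
      show "mobius a \<in> borel_measurable \<nu>" by (rule borel_measurable_integrable[OF integrable_mobius[OF a]])
    qed
    then show "(\<lambda>n. V (u n)) \<longlonglongrightarrow> V a" by (simp add: V_def)
  qed
  \<comment> \<open>Without a zero, \<open>V\<close> rescaled to length \<open>r\<close> maps the
    ball to its boundary. At a fixed point \<open>V\<close> points outwards, against the choice of
    \<open>r\<close>.\<close>
  have "\<exists>y\<in>cball 0 r. V y = 0"
  proof (rule ccontr)
    assume neg: "\<not> ?thesis"
    let ?f = "\<lambda>y. (r / norm (V y)) *\<^sub>R V y"
    have "continuous_on (cball 0 r) ?f" using neg by (intro continuous_intros contV) auto
    moreover have "?f \<in> cball 0 r \<rightarrow> cball 0 r" using neg r by auto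
    ultimately obtain y where y: "y \<in> cball 0 r" "?f y = y"
      using brouwer_ball[of r 0 ?f] r by auto
    have V: "V y \<noteq> 0" using neg y by blast
    have "norm (?f y) = r" using V r by simp
    then have "y \<bullet> V y < 0" using r y by simp
    moreover have "?f y \<bullet> V y = r * norm (V y)" using V by (simp add: power2_eq_square flip: power2_norm_eq_inner)
    ultimately show False using r y by (metis norm_ge_zero mult_nonneg_nonneg less_imp_le not_le)
  qed
  then show ?thesis using r unfolding V_def by (meson mem_cball_0 order_le_less_trans)
qed

lemma mobius_distr:
  assumes "norm y < 1"
  shows "atomless_sphere_prob (distr \<nu> borel_S2 (mobius y))"
proof -
  have m: "mobius y \<in> \<nu> \<rightarrow>\<^sub>M borel_S2" using measurable_mobius[OF assms] by (simp cong: measurable_cong_sets)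
  interpret p: prob_space "distr \<nu> borel_S2 (mobius y)" by (rule prob_space_distr[OF m])
  show ?thesis
  proof
    fix \<zeta> :: "real^3"
    show "emeasure (distr \<nu> borel_S2 (mobius y)) {\<zeta>} = 0"
    proof (cases "norm \<zeta> = 1")
      case True
      have "mobius y -` {\<zeta>} \<inter> sphere 0 1 \<subseteq> {mobius (- y) \<zeta>}"
        using mobius_inverse[OF _ assms] by auto
      then have "emeasure \<nu> (mobius y -` {\<zeta>} \<inter> sphere 0 1) \<le> emeasure \<nu> {mobius (- y) \<zeta>}"
        using True assms by (intro emeasure_mono) (auto simp: sets_restrict_space_iff norm_mobius_eq_1)
      then show ?thesis using True atomless by (subst emeasure_distr[OF m]) (auto simp: sets_restrict_space_iff)
    qed (intro emeasure_notin_sets, auto simp: sets_restrict_space_iff)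
  qed simp
qed

text \<open>Transporting by \<open>mobius y\<close> moves one barycenter to 0 and the other to
  \<open>w\<close>, which reduces the claim to \<open>integral_mobius_0_imp\<close>.\<close>

lemma balanced_unique:
  assumes y: "norm y < 1" "(\<integral>\<zeta>. mobius y \<zeta> \<partial>\<nu>) = 0" and z: "norm z < 1" "(\<integral>\<zeta>. mobius z \<zeta> \<partial>\<nu>) = 0"
  shows "z = y"
proof -
  let ?\<nu> = "distr \<nu> borel_S2 (mobius y)"
  interpret a: atomless_sphere_prob ?\<nu> by (rule mobius_distr[OF y(1)])
  have m: "mobius y \<in> \<nu> \<rightarrow>\<^sub>M borel_S2" using measurable_mobius[OF y(1)] by (simp cong: measurable_cong_sets)
  define w where "w = mobius y z"
  have w: "norm w < 1" unfolding w_def using y z by (intro norm_mobius_less_1)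
  have wz: "mobius (- y) w = z" unfolding w_def using y z by (intro mobius_inverse) auto
  obtain g where g: "orthogonal_transformation g" "\<And>\<zeta>. norm \<zeta> = 1 \<Longrightarrow> mobius w (mobius y \<zeta>) = g (mobius z \<zeta>)"
    using mobius_comp_to_0[OF y(1) w] unfolding wz by blast
  have bl: "bounded_linear g" using g(1) by (simp add: orthogonal_transformation_linear linear_conv_bounded_linear[symmetric])
  have mb: "(\<lambda>\<zeta>. \<zeta>) \<in> borel_measurable borel_S2" by (simp add: measurable_restrict_space1)
  have mw: "mobius w \<in> borel_measurable borel_S2" using a.integrable_mobius[OF w] by (auto cong: measurable_cong_sets)
  have "(\<integral>\<zeta>. \<zeta> \<partial>?\<nu>) = 0" using y(2) by (subst integral_distr[OF m mb]) simp
  moreover have "(\<integral>\<zeta>. mobius w \<zeta> \<partial>?\<nu>) = 0"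
  proof -
    have "(\<integral>\<zeta>. mobius w \<zeta> \<partial>?\<nu>) = (\<integral>\<zeta>. mobius w (mobius y \<zeta>) \<partial>\<nu>)" by (rule integral_distr[OF m mw])
    also have "\<dots> = (\<integral>\<zeta>. g (mobius z \<zeta>) \<partial>\<nu>)" by (intro Bochner_Integration.integral_cong) (auto simp: g(2))
    also have "\<dots> = g (\<integral>\<zeta>. mobius z \<zeta> \<partial>\<nu>)" by (rule integral_bounded_linear[OF bl integrable_mobius[OF z(1)]])
    also have "\<dots> = 0" using z(2) linear_0[OF orthogonal_transformation_linear[OF g(1)]] by simp
    finally show ?thesis .
  qed
  ultimately have "w = 0" using a.integral_mobius_0_imp w by blast
  then show ?thesis using wz by simp
qed

text \<open>Existence and uniqueness together make the description operator in
  \<open>barycenter\<close> denote the intended point.\<close>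

lemma barycenter_balanced: "norm (barycenter \<nu>) < 1" "(\<integral>\<zeta>. mobius (barycenter \<nu>) \<zeta> \<partial>\<nu>) = 0"
proof -
  have "\<exists>!y. balanced_at \<nu> y" unfolding balanced_at_iff using ex_balanced balanced_unique by metis
  from theI'[OF this] have "balanced_at \<nu> (barycenter \<nu>)" unfolding barycenter_def .
  then show "norm (barycenter \<nu>) < 1" "(\<integral>\<zeta>. mobius (barycenter \<nu>) \<zeta> \<partial>\<nu>) = 0"
    unfolding balanced_at_iff by auto
qed

end

section \<open>The barycenter equation near a balanced configuration\<close>

interpretation mu_S2: sphere_prob mu_S2
  by (intro sphere_prob.intro prob_space_mu_S2 sphere_prob_axioms.intro) simp

lemma mobius_unit_denom_ge:
  assumes "norm \<zeta> = 1" "norm y \<le> 1 / 2"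
  shows "1 - 2 * (\<zeta> \<bullet> y) + (norm y)\<^sup>2 \<ge> 1 / 4"
proof -
  have "(1 / 2)\<^sup>2 \<le> (1 - norm y)\<^sup>2" using assms by (intro power_mono) auto
  then show ?thesis using mobius_unit_denom(2)[OF assms(1), of y] by (simp add: power2_eq_square)
qed

text \<open>To first order the translation moves \<open>\<zeta>\<close> by minus twice the
  tangential part of \<open>y\<close>. The remainder is \<open>R /\<^sub>R D\<close> with
  \<open>norm R\<close> at most \<open>10 * Y\<close> and \<open>D\<close> at least 1/4, hence the
  40.\<close>

lemma mobius_expansion:
  assumes z: "norm \<zeta> = 1" and y: "norm y \<le> 1 / 2"
  shows "norm (mobius y \<zeta> - (\<zeta> - (2 *\<^sub>R y - (2 * (\<zeta> \<bullet> y)) *\<^sub>R \<zeta>))) \<le> 40 * (norm y)\<^sup>2"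
proof -
  define c where "c = \<zeta> \<bullet> y"
  define Y where "Y = (norm y)\<^sup>2"
  define D where "D = 1 - 2 * c + Y"
  have D: "D \<ge> 1 / 4" using mobius_unit_denom_ge[OF z y] by (simp add: D_def c_def Y_def)
  have c: "\<bar>c\<bar> \<le> norm y" using Cauchy_Schwarz_ineq2[of \<zeta> y] z by (simp add: c_def)
  have c2: "c\<^sup>2 \<le> Y" using c unfolding Y_def by (metis abs_le_square_iff abs_norm_cancel)
  have Y0: "Y \<ge> 0" by (simp add: Y_def)
  have cY: "\<bar>c * Y\<bar> \<le> 1 / 2 * Y" unfolding abs_mult using c y Y0 by (intro mult_mono) auto
  define R where "R = (4 * c\<^sup>2 - 2 * Y - 2 * (c * Y)) *\<^sub>R \<zeta> + (2 * Y - 2 * c) *\<^sub>R y"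
  have "mobius y \<zeta> - (\<zeta> - (2 *\<^sub>R y - (2 * (\<zeta> \<bullet> y)) *\<^sub>R \<zeta>)) = R /\<^sub>R D"
  proof -
    define E where "E = \<zeta> - (2 *\<^sub>R y - (2 * c) *\<^sub>R \<zeta>)"
    have DE: "D *\<^sub>R E = (D * (1 + 2 * c)) *\<^sub>R \<zeta> - (2 * D) *\<^sub>R y"
      by (simp add: E_def algebra_simps)
    have co: "(1 - Y) - D * (1 + 2 * c) = 4 * c\<^sup>2 - 2 * Y - 2 * (c * Y)" "2 * D - (2 - 2 * c) = 2 * Y - 2 * c"
      unfolding D_def by algebra+
    have "(1 - Y) *\<^sub>R \<zeta> - (2 - 2 * c) *\<^sub>R y - D *\<^sub>R E = R"
      unfolding R_def DE co[symmetric] scaleR_left_diff_distrib[of "1 - Y"] scaleR_left_diff_distrib[of "2 * D"] by simp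
    moreover have "D *\<^sub>R mobius y \<zeta> = (1 - Y) *\<^sub>R \<zeta> - (2 - 2 * c) *\<^sub>R y"
      using D by (simp add: mobius_unit[OF z] flip: D_def c_def Y_def)
    ultimately have "D *\<^sub>R (mobius y \<zeta> - E) = R" by (simp add: scaleR_right_diff_distrib)
    then have "mobius y \<zeta> - E = R /\<^sub>R D" using D by (simp flip: \<open>D *\<^sub>R (mobius y \<zeta> - E) = R\<close>)
    then show ?thesis by (simp add: E_def c_def)
  qed
  also have "norm (R /\<^sub>R D) = \<bar>inverse D\<bar> * norm R" by simp
  also have "\<bar>inverse D\<bar> = inverse D" using D by simp
  also have "inverse D * norm R = norm R / D" by (simp add: divide_inverse)
  also have "\<dots> \<le> (10 * Y) / (1 / 4)"
  proof (rule frac_le)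
    have "norm R \<le> \<bar>4 * c\<^sup>2 - 2 * Y - 2 * (c * Y)\<bar> + \<bar>2 * Y - 2 * c\<bar> * norm y"
      using norm_triangle_ineq[of "(4 * c\<^sup>2 - 2 * Y - 2 * (c * Y)) *\<^sub>R \<zeta>" "(2 * Y - 2 * c) *\<^sub>R y"] z
      by (simp add: R_def)
    also have "\<dots> \<le> 7 * Y + (2 * Y + 2 * norm y) * norm y"
    proof (intro add_mono mult_right_mono)
      show "\<bar>4 * c\<^sup>2 - 2 * Y - 2 * (c * Y)\<bar> \<le> 7 * Y"
        using c2 cY Y0 zero_le_power2[of c] by (intro abs_leI) linarith+
    qed (use c Y0 in auto)
    also have "\<dots> = 9 * Y + (2 * norm y) * Y" by (simp add: Y_def power2_eq_square algebra_simps)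
    also have "(2 * norm y) * Y \<le> 1 * Y" using y Y0 by (intro mult_right_mono) auto
    finally show "norm R \<le> 10 * Y" by simp
  qed (use D Y0 in auto)
  finally show ?thesis by (simp add: Y_def)
qed

text \<open>The kernel is \<open>q^2\<close> with \<open>q\<close> equal to \<open>1 + 2 * c\<close>
  up to \<open>28 * Y\<close>. The constants are 312 = 2 * 28 + 256 from squaring, 160 = 4 + 312 / 2
  and 81 = 1 + 160 / 2, using \<open>norm x \<le> 1 / 2\<close>.\<close>

lemma poisson_expansion:
  assumes w: "norm \<omega> = 1" and x: "norm x \<le> 1 / 2"
  shows "\<bar>poisson x \<omega> - (1 + 4 * (\<omega> \<bullet> x))\<bar> \<le> 312 * (norm x)\<^sup>2" (is ?th1)
    "\<bar>poisson x \<omega> - 1\<bar> \<le> 160 * norm x" (is ?th2) "\<bar>poisson x \<omega>\<bar> \<le> 81" (is ?th3)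
proof -
  define c where "c = \<omega> \<bullet> x"
  define Y where "Y = (norm x)\<^sup>2"
  define D where "D = 1 - 2 * c + Y"
  define q where "q = (1 - Y) / D"
  have D: "D \<ge> 1 / 4" using mobius_unit_denom_ge[OF w x] by (simp add: D_def c_def Y_def)
  have c: "\<bar>c\<bar> \<le> norm x" using Cauchy_Schwarz_ineq2[of \<omega> x] w by (simp add: c_def)
  have c2: "c\<^sup>2 \<le> Y" using c unfolding Y_def by (metis abs_le_square_iff abs_norm_cancel)
  have Y0: "Y \<ge> 0" by (simp add: Y_def)
  have cY: "\<bar>c * Y\<bar> \<le> 1 / 2 * Y" unfolding abs_mult using c x Y0 by (intro mult_mono) auto
  have Yx: "Y \<le> 1 / 2 * norm x" unfolding Y_def power2_eq_square using x by (intro mult_right_mono) auto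
  have "q - 1 - 2 * c = (4 * c\<^sup>2 - 2 * Y - 2 * (c * Y)) / D"
  proof -
    have "(1 - Y) - D * (1 + 2 * c) = 4 * c\<^sup>2 - 2 * Y - 2 * (c * Y)" unfolding D_def by algebra
    then show ?thesis unfolding q_def using D by (simp add: field_simps)
  qed
  then have "\<bar>q - 1 - 2 * c\<bar> = \<bar>4 * c\<^sup>2 - 2 * Y - 2 * (c * Y)\<bar> / D" using D by simp
  also have "\<dots> \<le> (7 * Y) / (1 / 4)"
  proof (rule frac_le)
    show "\<bar>4 * c\<^sup>2 - 2 * Y - 2 * (c * Y)\<bar> \<le> 7 * Y"
      using c2 cY Y0 zero_le_power2[of c] by (intro abs_leI) linarith+
  qed (use D Y0 in auto)
  finally have q1: "\<bar>q - 1 - 2 * c\<bar> \<le> 28 * Y" by simp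
  then have "\<bar>q - 1\<bar> \<le> 16 * norm x" using c Yx by linarith
  then have "(q - 1)\<^sup>2 \<le> (16 * norm x)\<^sup>2" by (metis abs_ge_zero power2_abs power_mono)
  then have q2: "(q - 1)\<^sup>2 \<le> 256 * Y" by (simp add: Y_def power_mult_distrib)
  have P: "poisson x \<omega> = q\<^sup>2" by (simp add: poisson_def q_def D_def c_def Y_def)
  have "\<bar>2 * u + t\<bar> \<le> 312 * Y" if "\<bar>u\<bar> \<le> 28 * Y" "0 \<le> t" "t \<le> 256 * Y" for u t
    using that by linarith
  from this[OF q1 _ q2] have "\<bar>2 * (q - 1 - 2 * c) + (q - 1)\<^sup>2\<bar> \<le> 312 * Y" by simp
  moreover have "q\<^sup>2 - (1 + 4 * c) = 2 * (q - 1 - 2 * c) + (q - 1)\<^sup>2" by algebra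
  ultimately have th1: "\<bar>poisson x \<omega> - (1 + 4 * c)\<bar> \<le> 312 * Y" unfolding P by simp
  then show ?th1 by (simp add: c_def Y_def)
  show ?th2 using th1 c Yx by linarith
  then show ?th3 using x by linarith
qed

text \<open>Product of the two expansions; the coefficients are 4 * 4 for the mixed term, 312 * 3
  and 81 * 40.\<close>

lemma poisson_mobius_expansion:
  fixes \<zeta> :: "'a::real_inner"
  assumes z: "norm \<zeta> = 1" and w: "norm \<omega> = 1" and y: "norm y \<le> 1 / 2" and x: "norm x \<le> 1 / 2"
  shows "norm (poisson x \<omega> *\<^sub>R mobius y \<zeta> - (\<zeta> + (4 * (\<omega> \<bullet> x)) *\<^sub>R \<zeta> - (2 *\<^sub>R y - (2 * (\<zeta> \<bullet> y)) *\<^sub>R \<zeta>)))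
    \<le> 16 * norm x * norm y + 936 * (norm x)\<^sup>2 + 3240 * (norm y)\<^sup>2"
proof -
  define c where "c = \<omega> \<bullet> x"
  define e where "e = 2 *\<^sub>R y - (2 * (\<zeta> \<bullet> y)) *\<^sub>R \<zeta>"
  define r1 where "r1 = mobius y \<zeta> - (\<zeta> - e)"
  define r2 where "r2 = poisson x \<omega> - (1 + 4 * c)"
  have c: "\<bar>c\<bar> \<le> norm x" using Cauchy_Schwarz_ineq2[of \<omega> x] w by (simp add: c_def)
  have "\<bar>\<zeta> \<bullet> y\<bar> \<le> norm y" using Cauchy_Schwarz_ineq2[of \<zeta> y] z by simp
  moreover have "norm e \<le> norm (2 *\<^sub>R y) + norm ((2 * (\<zeta> \<bullet> y)) *\<^sub>R \<zeta>)" unfolding e_def by (rule norm_triangle_ineq4)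
  ultimately have e: "norm e \<le> 4 * norm y" using z by (simp add: abs_mult)
  have r1: "norm r1 \<le> 40 * (norm y)\<^sup>2" using mobius_expansion[OF z y] by (simp add: r1_def e_def)
  have r2: "\<bar>r2\<bar> \<le> 312 * (norm x)\<^sup>2" using poisson_expansion(1)[OF w x] by (simp add: r2_def c_def)
  have P: "\<bar>poisson x \<omega>\<bar> \<le> 81" by (rule poisson_expansion(3)[OF w x])
  have "poisson x \<omega> *\<^sub>R mobius y \<zeta> - (\<zeta> + (4 * c) *\<^sub>R \<zeta> - e) = (- 4 * c) *\<^sub>R e + r2 *\<^sub>R (\<zeta> - e) + poisson x \<omega> *\<^sub>R r1"
    unfolding r1_def r2_def by (simp add: algebra_simps)
  also have "norm \<dots> \<le> \<bar>- 4 * c\<bar> * norm e + \<bar>r2\<bar> * norm (\<zeta> - e) + \<bar>poisson x \<omega>\<bar> * norm r1"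
    by (metis (no_types, lifting) add_mono norm_scaleR norm_triangle_ineq order_refl order_trans)
  also have "\<dots> \<le> (4 * norm x) * (4 * norm y) + (312 * (norm x)\<^sup>2) * 3 + 81 * (40 * (norm y)\<^sup>2)"
  proof (intro add_mono mult_mono)
    show "norm (\<zeta> - e) \<le> 3" using norm_triangle_ineq4[of \<zeta> e] e y z by linarith
    show "\<bar>- 4 * c\<bar> \<le> 4 * norm x" using c by simp
  qed (use e r1 r2 P in auto)
  finally show ?thesis by (simp add: c_def e_def)
qed

text \<open>The situation after moving base points: the barycenter is at 0, and the second part of
  \<open>eps\<close> says that the quadratic form of I - A is at least \<epsilon>.\<close>

locale balanced_sphere_map =
  fixes \<phi> :: "real^3 \<Rightarrow> real^3" and \<epsilon> :: real
  assumes phi [measurable]: "\<phi> \<in> borel_S2 \<rightarrow>\<^sub>M borel_S2"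
    and phi_0: "(\<integral>\<omega>. \<phi> \<omega> \<partial>mu_S2) = 0"
    and eps: "\<epsilon> > 0" "\<And>v. \<epsilon> * (norm v)\<^sup>2 \<le> (\<integral>\<omega>. (norm v)\<^sup>2 - (v \<bullet> \<phi> \<omega>)\<^sup>2 \<partial>mu_S2)"
begin

lemma norm_phi: "norm \<omega> = 1 \<Longrightarrow> norm (\<phi> \<omega>) = 1"
  using measurable_space[OF phi, of \<omega>] by simp

lemma phi_borel [measurable]: "\<phi> \<in> borel_measurable borel_S2"
  using phi by (rule measurable_restrict_space2_iff[THEN iffD1, THEN conjunct1])

lemma ident_borel [measurable]: "(\<lambda>\<omega>::real^3. \<omega>) \<in> borel_measurable borel_S2"
  by (simp add: measurable_restrict_space1)

lemma mobius_borel [measurable]: "norm y < 1 \<Longrightarrow> mobius y \<in> borel_measurable borel_S2"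
  using measurable_mobius by (rule measurable_restrict_space2_iff[THEN iffD1, THEN conjunct1])

text \<open>These are the maps \<open>I - A\<close> and \<open>B\<close> of the introduction.\<close>

definition mean_rejection :: "real^3 \<Rightarrow> real^3" where
  "mean_rejection v = (\<integral>\<omega>. v - (\<phi> \<omega> \<bullet> v) *\<^sub>R \<phi> \<omega> \<partial>mu_S2)"

definition first_variation :: "real^3 \<Rightarrow> real^3" where
  "first_variation v = (\<integral>\<omega>. (\<omega> \<bullet> v) *\<^sub>R \<phi> \<omega> \<partial>mu_S2)"

lemma inner_bound: "norm \<zeta> = 1 \<Longrightarrow> \<bar>\<zeta> \<bullet> v\<bar> \<le> norm v" for \<zeta> v :: "real^3"
  using Cauchy_Schwarz_ineq2[of \<zeta> v] by simp

lemma integrable_rejection: "integrable mu_S2 (\<lambda>\<omega>. v - (\<phi> \<omega> \<bullet> v) *\<^sub>R \<phi> \<omega>)"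
proof (rule mu_S2.integrable_bounded[where B = "2 * norm v"])
  fix \<zeta> :: "real^3" assume "norm \<zeta> = 1"
  then have "norm (\<phi> \<zeta>) = 1" by (rule norm_phi)
  then show "norm (v - (\<phi> \<zeta> \<bullet> v) *\<^sub>R \<phi> \<zeta>) \<le> 2 * norm v"
    using norm_triangle_ineq4[of v "(\<phi> \<zeta> \<bullet> v) *\<^sub>R \<phi> \<zeta>"] inner_bound[of "\<phi> \<zeta>" v] by simp
qed measurable

lemma integrable_first_variation: "integrable mu_S2 (\<lambda>\<omega>. (\<omega> \<bullet> v) *\<^sub>R \<phi> \<omega>)"
proof (rule mu_S2.integrable_bounded[where B = "norm v"])
  fix \<zeta> :: "real^3" assume "norm \<zeta> = 1"
  then show "norm ((\<zeta> \<bullet> v) *\<^sub>R \<phi> \<zeta>) \<le> norm v"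
    using norm_phi[of \<zeta>] inner_bound[of \<zeta> v] by simp
qed measurable

lemma integrable_phi: "integrable mu_S2 \<phi>"
  by (rule mu_S2.integrable_bounded[where B = 1]) (auto simp: norm_phi)

lemma integrable_quad: "integrable mu_S2 (\<lambda>\<omega>. (norm v)\<^sup>2 - (v \<bullet> \<phi> \<omega>)\<^sup>2)"
  by (rule mu_S2.integrable_bounded[where B = "(norm v)\<^sup>2"])
     (measurable, use inner_sq_le[OF norm_phi, of _ v] in auto)

lemma linear_mean_rejection: "linear mean_rejection"
proof
  show "mean_rejection (u + v) = mean_rejection u + mean_rejection v" for u v
    unfolding mean_rejection_def Bochner_Integration.integral_add[OF integrable_rejection integrable_rejection, symmetric]
    by (intro Bochner_Integration.integral_cong refl) (simp add: inner_add_right algebra_simps)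
  show "mean_rejection (c *\<^sub>R v) = c *\<^sub>R mean_rejection v" for c v
    unfolding mean_rejection_def integral_scaleR_right[symmetric]
    by (intro Bochner_Integration.integral_cong refl) (simp add: algebra_simps)
qed

lemma linear_first_variation: "linear first_variation"
proof
  show "first_variation (u + v) = first_variation u + first_variation v" for u v
    unfolding first_variation_def Bochner_Integration.integral_add[OF integrable_first_variation integrable_first_variation, symmetric]
    by (intro Bochner_Integration.integral_cong refl) (simp add: inner_add_right algebra_simps)
  show "first_variation (c *\<^sub>R v) = c *\<^sub>R first_variation v" for c v
    unfolding first_variation_def integral_scaleR_right[symmetric]
    by (intro Bochner_Integration.integral_cong refl) (simp add: algebra_simps)
qed

text \<open>A lower bound on the quadratic form bounds the operator from below, by Cauchy-Schwarz;
  this makes I - A invertible with inverse of norm at most 1 / \<epsilon>.\<close>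

lemma norm_mean_rejection_ge: "\<epsilon> * norm v \<le> norm (mean_rejection v)"
proof (cases "v = 0")
  case False
  have "v \<bullet> mean_rejection v = (\<integral>\<omega>. (norm v)\<^sup>2 - (v \<bullet> \<phi> \<omega>)\<^sup>2 \<partial>mu_S2)"
    unfolding mean_rejection_def integral_inner_right[OF integrable_rejection, symmetric]
    by (intro Bochner_Integration.integral_cong refl)
       (simp add: inner_diff_right inner_commute power2_eq_square[of "inner _ _"] flip: power2_norm_eq_inner)
  then have "\<epsilon> * (norm v)\<^sup>2 \<le> v \<bullet> mean_rejection v" using eps(2) by simp
  also have "\<dots> \<le> norm v * norm (mean_rejection v)" by (rule norm_cauchy_schwarz)
  finally show ?thesis using False by (simp add: power2_eq_square)
qed (simp add: linear_0[OF linear_mean_rejection])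

lemma norm_first_variation_le: "norm (first_variation v) \<le> norm v"
proof -
  have "norm (first_variation v) \<le> (\<integral>\<omega>. norm v \<partial>mu_S2)"
    unfolding first_variation_def
  proof (rule Bochner_Integration.integral_norm_bound_integral[OF integrable_first_variation])
    show "norm ((\<omega> \<bullet> v) *\<^sub>R \<phi> \<omega>) \<le> norm v" if "\<omega> \<in> space mu_S2" for \<omega>
      using norm_phi[of \<omega>] inner_bound[of \<omega> v] that by simp
  qed simp
  then show ?thesis using mu_S2.prob_space by simp
qed

lemma integrable_kernel:
  assumes "norm x \<le> 1 / 2" "norm y < 1"
  shows "integrable mu_S2 (\<lambda>\<omega>. poisson x \<omega> *\<^sub>R mobius y (\<phi> \<omega>))"
proof (rule mu_S2.integrable_bounded[where B = 81])
  fix \<omega> :: "real^3" assume w: "norm \<omega> = 1"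
  show "norm (poisson x \<omega> *\<^sub>R mobius y (\<phi> \<omega>)) \<le> 81"
    using poisson_expansion(3)[OF w assms(1)] norm_mobius_eq_1[OF norm_phi[OF w] assms(2)] by simp
next
  note [measurable] = measurable_mobius[OF assms(2)] mobius_borel[OF assms(2)]
  show "(\<lambda>\<omega>. poisson x \<omega> *\<^sub>R mobius y (\<phi> \<omega>)) \<in> borel_measurable borel_S2" by measurable
qed

text \<open>Pairing the equation with \<open>y\<close>: replacing the kernel by 1 costs at most
  \<open>160 * norm x * norm y\<close>, and what remains is at most
  \<open>- \<epsilon> * (norm y)^2 / 2\<close> since \<phi> has mean zero. No smallness of
  \<open>y\<close> enters, so this replaces a proof that the barycenter depends continuously on
  \<open>x\<close>.\<close>

lemma implicit_lipschitz:
  assumes x: "norm x \<le> 1 / 2" and y: "norm y < 1"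
    and 0: "(\<integral>\<omega>. poisson x \<omega> *\<^sub>R mobius y (\<phi> \<omega>) \<partial>mu_S2) = 0"
  shows "norm y \<le> 320 / \<epsilon> * norm x"
proof (cases "y = 0")
  case False
  have "0 = (\<integral>\<omega>. y \<bullet> (poisson x \<omega> *\<^sub>R mobius y (\<phi> \<omega>)) \<partial>mu_S2)"
    using 0 integrable_kernel[OF x y] by (simp only: integral_inner_right inner_zero_right)
  also have "\<dots> \<le> (\<integral>\<omega>. y \<bullet> \<phi> \<omega> - ((norm y)\<^sup>2 - (y \<bullet> \<phi> \<omega>)\<^sup>2) / 2 + 160 * norm x * norm y \<partial>mu_S2)"
  proof (rule integral_mono)
    show "integrable mu_S2 (\<lambda>\<omega>. y \<bullet> (poisson x \<omega> *\<^sub>R mobius y (\<phi> \<omega>)))"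
      by (intro integrable_inner_right integrable_kernel x y)
    show "integrable mu_S2 (\<lambda>\<omega>. y \<bullet> \<phi> \<omega> - ((norm y)\<^sup>2 - (y \<bullet> \<phi> \<omega>)\<^sup>2) / 2 + 160 * norm x * norm y)"
      using integrable_phi integrable_quad by auto
    fix \<omega> assume "\<omega> \<in> space mu_S2"
    then have w: "norm \<omega> = 1" by simp
    have "\<bar>y \<bullet> mobius y (\<phi> \<omega>)\<bar> \<le> norm y"
      using Cauchy_Schwarz_ineq2[of y "mobius y (\<phi> \<omega>)"] norm_mobius_eq_1[OF norm_phi[OF w] y] by simp
    then have "\<bar>(poisson x \<omega> - 1) * (y \<bullet> mobius y (\<phi> \<omega>))\<bar> \<le> (160 * norm x) * norm y"
      unfolding abs_mult using poisson_expansion(2)[OF w x] by (intro mult_mono) auto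
    moreover have "y \<bullet> mobius y (\<phi> \<omega>) \<le> y \<bullet> \<phi> \<omega> - ((norm y)\<^sup>2 - (y \<bullet> \<phi> \<omega>)\<^sup>2) / 2"
      by (rule inner_mobius_self_le[OF norm_phi[OF w] y])
    ultimately show "y \<bullet> (poisson x \<omega> *\<^sub>R mobius y (\<phi> \<omega>))
        \<le> y \<bullet> \<phi> \<omega> - ((norm y)\<^sup>2 - (y \<bullet> \<phi> \<omega>)\<^sup>2) / 2 + 160 * norm x * norm y"
      by (simp add: algebra_simps abs_le_iff)
  qed
  also have "\<dots> = y \<bullet> (\<integral>\<omega>. \<phi> \<omega> \<partial>mu_S2) - (\<integral>\<omega>. (norm y)\<^sup>2 - (y \<bullet> \<phi> \<omega>)\<^sup>2 \<partial>mu_S2) / 2 + 160 * norm x * norm y"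
    using integrable_phi integrable_quad[of y] mu_S2.prob_space
    by (subst Bochner_Integration.integral_add Bochner_Integration.integral_diff; simp)+
  also have "\<dots> \<le> - (\<epsilon> * (norm y)\<^sup>2) / 2 + 160 * norm x * norm y"
    using eps(2)[of y] by (simp add: phi_0)
  finally have "(\<epsilon> * norm y) * norm y \<le> (320 * norm x) * norm y" by (simp add: power2_eq_square)
  then show ?thesis using False eps(1) by (simp add: field_simps)
qed (use eps(1) in auto)

text \<open>Integrating \<open>poisson_mobius_expansion\<close> over the sphere leaves
  \<open>4 *\<^sub>R first_variation x - 2 *\<^sub>R mean_rejection y\<close> up to a quadratic
  error. The a priori bound on \<open>y\<close> makes that error O(|x|^2).\<close>

theorem implicit_derivative:
  assumes Y: "\<And>x. norm x < 1 \<Longrightarrow> norm (Y x) < 1"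
    and Y0: "\<And>x. norm x < 1 \<Longrightarrow> (\<integral>\<omega>. poisson x \<omega> *\<^sub>R mobius (Y x) (\<phi> \<omega>) \<partial>mu_S2) = 0"
  obtains L where "(Y has_derivative L) (at 0)" "\<And>v. norm (L v) \<le> 2 / \<epsilon> * norm v"
proof -
  have "inj mean_rejection"
    unfolding linear_injective_0[OF linear_mean_rejection]
    using norm_mean_rejection_ge eps(1) by (metis mult_le_0_iff norm_le_zero_iff norm_zero not_less)
  then obtain T where T: "linear T" "\<And>v. mean_rejection (T v) = v"
    using linear_injective_isomorphism[OF linear_mean_rejection] by blast
  \<comment> \<open>The solution of the linearised equation; the 2 is the quotient of the
    coefficients 4 and 2 in the expansion.\<close>
  define L where "L v = T (2 *\<^sub>R first_variation v)" for v
  have linL: "linear L"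
    unfolding L_def using linear_compose[OF linear_compose_scale_right[OF linear_first_variation] T(1)] by (simp add: comp_def)
  have LT: "mean_rejection (L v) = 2 *\<^sub>R first_variation v" for v by (simp add: L_def T)
  have L: "norm (L v) \<le> 2 / \<epsilon> * norm v" for v
    using norm_mean_rejection_ge[of "L v"] norm_first_variation_le[of v] eps(1) by (simp add: LT field_simps)
  have lip: "norm (Y x) \<le> 320 / \<epsilon> * norm x" if "norm x \<le> 1 / 2" for x
    using implicit_lipschitz[OF that Y Y0] that by simp
  define K where "K = 320 / \<epsilon>"
  have K: "K > 0" using eps(1) by (simp add: K_def)
  have "Y 0 = 0" using lip[of 0] by simp
  \<comment> \<open>Error coefficients of the expansion with \<open>norm y\<close> replaced by
    \<open>K * norm x\<close>, divided by the factor 2 of \<open>mean_rejection\<close> and by its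
    lower bound \<epsilon>.\<close>
  define C where "C = (16 * K + 936 + 3240 * K\<^sup>2) / (2 * \<epsilon>)"
  have est: "norm (Y x - L x) \<le> C * (norm x)\<^sup>2" if x: "norm x \<le> 1 / 2" "norm x \<le> 1 / (2 * K)" for x
  proof -
    define y where "y = Y x"
    have yK: "norm y \<le> K * norm x" using lip[OF x(1)] by (simp add: y_def K_def)
    \<comment> \<open>The second condition on \<open>x\<close> keeps \<open>norm y\<close> within
      1/2, the range of the expansion.\<close>
    have "K * norm x \<le> K * (1 / (2 * K))" using x(2) K by (intro mult_left_mono) auto
    then have y2: "norm y \<le> 1 / 2" using yK K by simp
    let ?R = "\<lambda>\<omega>. poisson x \<omega> *\<^sub>R mobius y (\<phi> \<omega>) - (\<phi> \<omega> + (4 * (\<omega> \<bullet> x)) *\<^sub>R \<phi> \<omega> - (2 *\<^sub>R y - (2 * (\<phi> \<omega> \<bullet> y)) *\<^sub>R \<phi> \<omega>))"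
    have i1: "integrable mu_S2 (\<lambda>\<omega>. poisson x \<omega> *\<^sub>R mobius y (\<phi> \<omega>))" using y2 by (intro integrable_kernel x) auto
    define F where "F \<omega> = (\<omega> \<bullet> x) *\<^sub>R \<phi> \<omega>" for \<omega>
    define G where "G \<omega> = y - (\<phi> \<omega> \<bullet> y) *\<^sub>R \<phi> \<omega>" for \<omega>
    have iF: "integrable mu_S2 F" "integrable mu_S2 G" using integrable_first_variation[of x] integrable_rejection[of y] by (simp_all add: F_def[abs_def] G_def[abs_def])
    have e: "(2 *\<^sub>R y - (2 * (\<phi> \<omega> \<bullet> y)) *\<^sub>R \<phi> \<omega>) = 2 *\<^sub>R G \<omega>"
       "(4 * (\<omega> \<bullet> x)) *\<^sub>R \<phi> \<omega> = 4 *\<^sub>R F \<omega>" for \<omega> by (simp_all add: F_def G_def algebra_simps)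
    have "(\<integral>\<omega>. poisson x \<omega> *\<^sub>R mobius y (\<phi> \<omega>) \<partial>mu_S2) = 0" unfolding y_def using x by (intro Y0) auto
    then have "(\<integral>\<omega>. ?R \<omega> \<partial>mu_S2) = 0 - (0 + 4 *\<^sub>R first_variation x - 2 *\<^sub>R mean_rejection y)"
      unfolding e using i1 integrable_phi iF
      by (simp add: phi_0 mean_rejection_def first_variation_def flip: F_def G_def)
    then have "norm (2 *\<^sub>R mean_rejection y - 4 *\<^sub>R first_variation x) = norm (\<integral>\<omega>. ?R \<omega> \<partial>mu_S2)" by simp
    also have "\<dots> \<le> (\<integral>\<omega>. 16 * norm x * norm y + 936 * (norm x)\<^sup>2 + 3240 * (norm y)\<^sup>2 \<partial>mu_S2)"
    proof (rule Bochner_Integration.integral_norm_bound_integral)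
      show "integrable mu_S2 ?R" unfolding e using i1 integrable_phi iF by simp
      show "norm (?R \<omega>) \<le> 16 * norm x * norm y + 936 * (norm x)\<^sup>2 + 3240 * (norm y)\<^sup>2" if "\<omega> \<in> space mu_S2" for \<omega>
        using that by (intro poisson_mobius_expansion norm_phi x y2) auto
    qed simp
    also have "\<dots> = 16 * norm x * norm y + 936 * (norm x)\<^sup>2 + 3240 * (norm y)\<^sup>2" using mu_S2.prob_space by simp
    also have "\<dots> \<le> 16 * norm x * (K * norm x) + 936 * (norm x)\<^sup>2 + 3240 * (K * norm x)\<^sup>2"
      using yK by (intro add_mono mult_left_mono power_mono) auto
    also have "\<dots> = (16 * K + 936 + 3240 * K\<^sup>2) * (norm x)\<^sup>2" by (simp add: power2_eq_square algebra_simps)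
    also have "\<dots> = (2 * \<epsilon>) * (C * (norm x)\<^sup>2)" using eps(1) by (simp add: C_def)
    finally have "norm (2 *\<^sub>R mean_rejection y - 4 *\<^sub>R first_variation x) \<le> (2 * \<epsilon>) * (C * (norm x)\<^sup>2)" .
    moreover have "2 *\<^sub>R mean_rejection y - 4 *\<^sub>R first_variation x = 2 *\<^sub>R mean_rejection (y - L x)"
      by (simp add: linear_diff[OF linear_mean_rejection] LT algebra_simps)
    ultimately have "norm (mean_rejection (y - L x)) \<le> \<epsilon> * (C * (norm x)\<^sup>2)" by simp
    then have "\<epsilon> * norm (y - L x) \<le> \<epsilon> * (C * (norm x)\<^sup>2)" using norm_mean_rejection_ge order_trans by blast
    then show ?thesis using eps(1) by (simp add: y_def)
  qed
  have "(Y has_derivative L) (at 0)"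
  proof (rule has_derivativeI_sandwich[where e = "min (1 / 2) (1 / (2 * K))" and H = "\<lambda>x. C * norm x"])
    show "0 < min (1 / 2) (1 / (2 * K))" using K by simp
    show "bounded_linear L" using linL by (simp add: linear_conv_bounded_linear)
    show "norm (Y x - Y 0 - L (x - 0)) / norm (x - 0) \<le> C * norm x"
      if "x \<noteq> 0" "dist x 0 < min (1 / 2) (1 / (2 * K))" for x
      using est[of x] that by (simp add: \<open>Y 0 = 0\<close> divide_le_eq power2_eq_square mult.assoc)
    show "((\<lambda>x. C * norm x) \<longlongrightarrow> 0) (at 0)"
      by (rule tendsto_eq_intros refl)+ simp
  qed
  then show thesis using L that by blast
qed

end

section \<open>Integrals over plane squares\<close>

lemma lborel_Complex: "lborel = distr (lborel :: (real \<times> real) measure) borel (\<lambda>(x, y). Complex x y)"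
proof (rule lborel_eqI)
  have "continuous_on UNIV (\<lambda>(x, y). Complex x y)"
    unfolding case_prod_beta Complex_eq by (intro continuous_intros)
  then have m: "(\<lambda>(x, y). Complex x y) \<in> (lborel :: (real \<times> real) measure) \<rightarrow>\<^sub>M borel"
    by (simp add: borel_measurable_continuous_onI)
  fix l u :: complex assume le: "\<And>b. b \<in> Basis \<Longrightarrow> l \<bullet> b \<le> u \<bullet> b"
  have eq: "(\<lambda>(x, y). Complex x y) -` box l u = box (Re l, Im l) (Re u, Im u)"
    by (auto simp: mem_box Basis_complex_def Basis_prod_def)
  have "Re l \<le> Re u" "Im l \<le> Im u" using le[of 1] le[of \<i>] by (simp_all add: Basis_complex_def)
  then show "emeasure (distr (lborel :: (real \<times> real) measure) borel (\<lambda>(x, y). Complex x y)) (box l u) = ennreal (\<Prod>b\<in>Basis. (u - l) \<bullet> b)"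
    by (subst emeasure_distr[OF m])
       (auto simp: eq emeasure_lborel_box_eq Basis_complex_def Basis_prod_def prod.union_disjoint prod.reindex inj_on_def)
qed simp

definition square :: "real \<Rightarrow> (real \<times> real) set" where
  "square L = cbox (- L, - L) (L, L)"

lemma mem_square: "(x, y) \<in> square L \<longleftrightarrow> \<bar>x\<bar> \<le> L \<and> \<bar>y\<bar> \<le> L"
  by (auto simp: square_def cbox_Pair_eq)

lemma square_integrable:
  fixes f :: "real \<Rightarrow> real \<Rightarrow> real"
  assumes "continuous_on UNIV (\<lambda>(x, y). f x y)"
  shows "(\<lambda>(x, y). f x y) integrable_on square L"
  unfolding square_def by (intro integrable_continuous continuous_on_subset[OF assms]) auto

lemma square_iterated:
  fixes f :: "real \<Rightarrow> real \<Rightarrow> real"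
  assumes "continuous_on UNIV (\<lambda>(x, y). f x y)"
  shows "integral (square L) (\<lambda>(x, y). f x y) = integral {- L..L} (\<lambda>x. integral {- L..L} (\<lambda>y. f x y))"
    "integral (square L) (\<lambda>(x, y). f x y) = integral {- L..L} (\<lambda>y. integral {- L..L} (\<lambda>x. f x y))"
proof -
  have c: "continuous_on (cbox (- L, - L) (L, L)) (\<lambda>(x, y). f x y)"
    by (intro continuous_on_subset[OF assms]) auto
  show 1: "integral (square L) (\<lambda>(x, y). f x y) = integral {- L..L} (\<lambda>x. integral {- L..L} (\<lambda>y. f x y))"
    using integral_prod_continuous[OF c] by (simp add: square_def)
  show "integral (square L) (\<lambda>(x, y). f x y) = integral {- L..L} (\<lambda>y. integral {- L..L} (\<lambda>x. f x y))"
    unfolding 1 using integral_swap_continuous[OF c] by simp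
qed

lemma continuous_section:
  fixes f :: "real \<Rightarrow> real \<Rightarrow> real"
  assumes "continuous_on UNIV (\<lambda>(x, y). f x y)"
  shows "continuous_on S (\<lambda>x. f x y)" "continuous_on S (f x)"
proof -
  have "continuous_on S (\<lambda>x. (\<lambda>(x, y). f x y) (x, y))"
    by (rule continuous_on_compose2[OF assms]) (auto intro!: continuous_intros)
  then show "continuous_on S (\<lambda>x. f x y)" by simp
  have "continuous_on S (\<lambda>y. (\<lambda>(x, y). f x y) (x, y))"
    by (rule continuous_on_compose2[OF assms]) (auto intro!: continuous_intros)
  then show "continuous_on S (f x)" by simp
qed

lemma continuous_partial_integral:
  fixes f :: "real \<Rightarrow> real \<Rightarrow> real"
  assumes "continuous_on UNIV (\<lambda>(x, y). f x y)"
  shows "continuous_on S (\<lambda>x. integral {a..b} (\<lambda>y. f x y))" "continuous_on S (\<lambda>y. integral {a..b} (\<lambda>x. f x y))"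
proof -
  have "continuous_on (S \<times> cbox a b) (\<lambda>(x, y). f x y)"
    by (rule continuous_on_subset[OF assms]) simp
  from integral_continuous_on_param[OF this] show "continuous_on S (\<lambda>x. integral {a..b} (\<lambda>y. f x y))" by simp
  have "continuous_on (S \<times> cbox a b) (\<lambda>(y, x). f x y)"
    unfolding case_prod_beta
    using continuous_on_compose2[OF assms, of "S \<times> cbox a b" "\<lambda>p. (snd p, fst p)"]
    by (simp add: continuous_intros case_prod_beta)
  from integral_continuous_on_param[OF this] show "continuous_on S (\<lambda>y. integral {a..b} (\<lambda>x. f x y))" by simp
qed

lemma increment_le_integral_abs_deriv:
  fixes f f' :: "real \<Rightarrow> real"
  assumes "\<And>x. (f has_real_derivative f' x) (at x)" "continuous_on UNIV f'"
    and x: "x \<in> {a..b}" "x' \<in> {a..b}"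
  shows "\<bar>f x - f x'\<bar> \<le> integral {a..b} (\<lambda>s. \<bar>f' s\<bar>)"
proof -
  have *: "\<bar>f v - f u\<bar> \<le> integral {a..b} (\<lambda>s. \<bar>f' s\<bar>)" if "a \<le> u" "u \<le> v" "v \<le> b" for u v
  proof -
    have c: "continuous_on S f'" for S using assms(2) by (rule continuous_on_subset) simp
    have "(f' has_integral (f v - f u)) {u..v}"
      using that assms(1) by (intro fundamental_theorem_of_calculus)
        (auto simp: has_real_derivative_iff_has_vector_derivative[symmetric] intro: has_field_derivative_at_within)
    then have "\<bar>f v - f u\<bar> = \<bar>integral {u..v} f'\<bar>" by (simp add: integral_unique)
    also have "\<dots> \<le> integral {u..v} (\<lambda>s. \<bar>f' s\<bar>)"
      using integral_norm_bound_integral[of f' "{u..v}" "\<lambda>s. \<bar>f' s\<bar>"]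
      by (simp add: integrable_continuous_real c continuous_on_rabs)
    also have "\<dots> \<le> integral {a..b} (\<lambda>s. \<bar>f' s\<bar>)"
      using that by (intro integral_subset_le integrable_continuous_real continuous_on_rabs c) auto
    finally show ?thesis .
  qed
  show ?thesis using *[of x x'] *[of x' x] x by (cases "x \<le> x'") (auto simp: abs_minus_commute)
qed

text \<open>Each point is joined to \<open>(x0, 0)\<close> by a horizontal segment to the line over
  \<open>x0\<close> and a vertical one along it. That line is chosen to minimise the integral of
  \<open>\<bar>gy\<bar>\<close>, so that its contribution is at most the average over all vertical
  lines.\<close>

lemma poincare_square:
  fixes g gx gy :: "real \<Rightarrow> real \<Rightarrow> real"
  assumes gx: "\<And>x y. ((\<lambda>x. g x y) has_real_derivative gx x y) (at x)"
    and gy: "\<And>x y. ((\<lambda>y. g x y) has_real_derivative gy x y) (at y)"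
    and cg: "continuous_on UNIV (\<lambda>(x, y). g x y)"
    and cx: "continuous_on UNIV (\<lambda>(x, y). gx x y)"
    and cy: "continuous_on UNIV (\<lambda>(x, y). gy x y)"
    and L: "L > 0"
  shows "\<exists>x0. integral (square L) (\<lambda>(x, y). \<bar>g x y - g x0 0\<bar>) \<le>
    2 * L * (integral (square L) (\<lambda>(x, y). \<bar>gx x y\<bar>) + integral (square L) (\<lambda>(x, y). \<bar>gy x y\<bar>))"
proof -
  let ?I = "{- L..L}"
  have ax: "continuous_on UNIV (\<lambda>(x, y). \<bar>gx x y\<bar>)" and ay: "continuous_on UNIV (\<lambda>(x, y). \<bar>gy x y\<bar>)"
    using cx cy by (simp_all add: case_prod_beta continuous_on_rabs)
  define M2 where "M2 = integral (square L) (\<lambda>(x, y). \<bar>gy x y\<bar>)"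
  define h where "h x = integral ?I (\<lambda>y. \<bar>gy x y\<bar>)" for x
  have "continuous_on ?I h" unfolding h_def by (rule continuous_partial_integral(1)[OF ay])
  then obtain x0 where x0: "x0 \<in> ?I" "\<And>x. x \<in> ?I \<Longrightarrow> h x0 \<le> h x"
    using continuous_attains_inf[of ?I h] L by auto
  have "integral ?I (\<lambda>_. h x0) \<le> integral ?I h"
    using x0(2) \<open>continuous_on ?I h\<close> by (intro integral_le integrable_continuous_real) auto
  \<comment> \<open>The minimum is at most the mean over an interval of length
    \<open>2 * L\<close>.\<close>
  then have h0: "2 * L * h x0 \<le> M2" using L by (simp add: M2_def square_iterated(1)[OF ay] h_def[abs_def])
  have ad: "continuous_on UNIV (\<lambda>(x, y). \<bar>g x y - g x0 0\<bar>)"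
    using cg by (auto simp: case_prod_beta intro!: continuous_intros)
  have b: "\<bar>g x y - g x0 0\<bar> \<le> integral ?I (\<lambda>s. \<bar>gx s y\<bar>) + h x0" if "x \<in> ?I" "y \<in> ?I" for x y
  proof -
    have "\<bar>g x y - g x0 y\<bar> \<le> integral ?I (\<lambda>s. \<bar>gx s y\<bar>)"
      using that x0 by (intro increment_le_integral_abs_deriv[of "\<lambda>x. g x y"] gx continuous_section[OF cx])
    moreover have "\<bar>g x0 y - g x0 0\<bar> \<le> h x0"
      unfolding h_def using that L by (intro increment_le_integral_abs_deriv[of "\<lambda>y. g x0 y"] gy continuous_section[OF cy]) auto
    ultimately show ?thesis by linarith
  qed
  have "integral (square L) (\<lambda>(x, y). \<bar>g x y - g x0 0\<bar>) = integral ?I (\<lambda>y. integral ?I (\<lambda>x. \<bar>g x y - g x0 0\<bar>))"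
    by (rule square_iterated(2)[OF ad])
  also have "\<dots> \<le> integral ?I (\<lambda>y. 2 * L * (integral ?I (\<lambda>s. \<bar>gx s y\<bar>) + h x0))"
  proof (rule integral_le)
    show "(\<lambda>y. integral ?I (\<lambda>x. \<bar>g x y - g x0 0\<bar>)) integrable_on ?I"
      by (intro integrable_continuous_real continuous_partial_integral(2)[OF ad])
    show "(\<lambda>y. 2 * L * (integral ?I (\<lambda>s. \<bar>gx s y\<bar>) + h x0)) integrable_on ?I"
      by (intro integrable_continuous_real continuous_intros continuous_partial_integral(2)[OF ax])
    fix y assume y: "y \<in> ?I"
    have "integral ?I (\<lambda>x. \<bar>g x y - g x0 0\<bar>) \<le> integral ?I (\<lambda>x. integral ?I (\<lambda>s. \<bar>gx s y\<bar>) + h x0)"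
      using b y by (intro integral_le integrable_continuous_real continuous_section(1)[OF ad]) auto
    then show "integral ?I (\<lambda>x. \<bar>g x y - g x0 0\<bar>) \<le> 2 * L * (integral ?I (\<lambda>s. \<bar>gx s y\<bar>) + h x0)"
      using L by simp
  qed
  also have "\<dots> = 2 * L * (integral ?I (\<lambda>y. integral ?I (\<lambda>s. \<bar>gx s y\<bar>)) + 2 * L * h x0)"
    using L by (simp add: integral_add integrable_continuous_real continuous_partial_integral(2)[OF ax])
  also have "\<dots> \<le> 2 * L * (integral (square L) (\<lambda>(x, y). \<bar>gx x y\<bar>) + M2)"
    using h0 L by (intro mult_left_mono) (auto simp: square_iterated(2)[OF ax])
  finally show ?thesis unfolding M2_def by blast
qed

text \<open>The divergence theorem on a square, by the fundamental theorem in each variable;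
  \<open>8 * L\<close> is the perimeter.\<close>

lemma flux_bound:
  fixes A B Ax By :: "real \<Rightarrow> real \<Rightarrow> real"
  assumes Ax: "\<And>x y. ((\<lambda>x. A x y) has_real_derivative Ax x y) (at x)"
    and By: "\<And>x y. ((\<lambda>y. B x y) has_real_derivative By x y) (at y)"
    and c: "continuous_on UNIV (\<lambda>(x, y). A x y)" "continuous_on UNIV (\<lambda>(x, y). B x y)"
      "continuous_on UNIV (\<lambda>(x, y). Ax x y)" "continuous_on UNIV (\<lambda>(x, y). By x y)"
    and L: "L > 0"
    and bd: "\<And>x y. \<bar>x\<bar> = L \<or> \<bar>y\<bar> = L \<Longrightarrow> \<bar>A x y\<bar> \<le> M \<and> \<bar>B x y\<bar> \<le> M"
  shows "integral (square L) (\<lambda>(x, y). Ax x y + By x y) \<le> 8 * L * M"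
proof -
  let ?I = "{- L..L}"
  have 1: "integral ?I (\<lambda>x. Ax x y) \<le> 2 * M" for y
  proof -
    have "((\<lambda>x. Ax x y) has_integral (A L y - A (- L) y)) ?I"
      using L Ax by (intro fundamental_theorem_of_calculus)
        (auto simp: has_real_derivative_iff_has_vector_derivative[symmetric] intro: has_field_derivative_at_within)
    then show ?thesis using bd[of L y] bd[of "- L" y] L by (simp add: integral_unique abs_le_iff)
  qed
  have 2: "integral ?I (\<lambda>y. By x y) \<le> 2 * M" for x
  proof -
    have "((\<lambda>y. By x y) has_integral (B x L - B x (- L))) ?I"
      using L By by (intro fundamental_theorem_of_calculus)
        (auto simp: has_real_derivative_iff_has_vector_derivative[symmetric] intro: has_field_derivative_at_within)
    then show ?thesis using bd[of x L] bd[of x "- L"] L by (simp add: integral_unique abs_le_iff)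
  qed
  have "integral (square L) (\<lambda>(x, y). Ax x y + By x y) =
    integral (square L) (\<lambda>(x, y). Ax x y) + integral (square L) (\<lambda>(x, y). By x y)"
    using integral_add[OF square_integrable[OF c(3), of L] square_integrable[OF c(4), of L]] unfolding case_prod_beta by simp
  also have "integral (square L) (\<lambda>(x, y). Ax x y) \<le> integral ?I (\<lambda>_. 2 * M)"
    unfolding square_iterated(2)[OF c(3)]
    using 1 by (intro integral_le integrable_continuous_real continuous_partial_integral(2)[OF c(3)]) auto
  also have "integral (square L) (\<lambda>(x, y). By x y) \<le> integral ?I (\<lambda>_. 2 * M)"
    unfolding square_iterated(1)[OF c(4)]
    using 2 by (intro integral_le integrable_continuous_real continuous_partial_integral(1)[OF c(4)]) auto
  finally show ?thesis using L by simp
qed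

text \<open>Bridge between the Lebesgue integral of the chart and the gauge integrals over squares,
  in which Poincare and flux estimates are stated.\<close>

lemma integral_square_complex:
  fixes F :: "complex \<Rightarrow> real"
  assumes F: "continuous_on UNIV F"
  shows "integrable lborel (\<lambda>z. indicator {z. \<bar>Re z\<bar> \<le> L \<and> \<bar>Im z\<bar> \<le> L} z * F z)"
    and "(\<integral>z. indicator {z. \<bar>Re z\<bar> \<le> L \<and> \<bar>Im z\<bar> \<le> L} z * F z \<partial>lborel) = integral (square L) (\<lambda>(x, y). F (Complex x y))"
proof -
  let ?Q = "{z. \<bar>Re z\<bar> \<le> L \<and> \<bar>Im z\<bar> \<le> L}"
  have cC: "continuous_on UNIV (\<lambda>(x, y). Complex x y)"
    unfolding case_prod_beta Complex_eq by (intro continuous_intros)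
  then have m: "(\<lambda>(x, y). Complex x y) \<in> (lborel :: (real \<times> real) measure) \<rightarrow>\<^sub>M borel"
    by (simp add: borel_measurable_continuous_onI)
  have [measurable]: "F \<in> borel_measurable borel" by (rule borel_measurable_continuous_onI[OF F])
  have [measurable]: "?Q \<in> sets borel" by measurable
  have c: "continuous_on UNIV (\<lambda>(x, y). F (Complex x y))"
    using continuous_on_compose2[OF F cC] by (simp add: case_prod_beta)
  have eq: "(\<lambda>p. indicator ?Q (case p of (x, y) \<Rightarrow> Complex x y) * F (case p of (x, y) \<Rightarrow> Complex x y)) =
     (\<lambda>p. indicator (square L) p *\<^sub>R (\<lambda>(x, y). F (Complex x y)) p)"
    by (auto simp: fun_eq_iff indicator_def mem_square)
  have si: "set_integrable lborel (square L) (\<lambda>(x, y). F (Complex x y))"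
    unfolding square_def set_integrable_def by (intro borel_integrable_compact continuous_on_subset[OF c]) auto
  show "integrable lborel (\<lambda>z. indicator ?Q z * F z)"
    using si unfolding set_integrable_def by (subst lborel_Complex, subst integrable_distr_eq[OF m]) (simp_all add: eq)
  have "(\<integral>z. indicator ?Q z * F z \<partial>lborel) = (LINT p : square L | lborel. (\<lambda>(x, y). F (Complex x y)) p)"
    unfolding set_lebesgue_integral_def by (subst lborel_Complex, subst integral_distr[OF m]) (simp_all add: eq)
  also have "\<dots> = integral (square L) (\<lambda>(x, y). F (Complex x y))"
    by (rule set_borel_integral_eq_integral(2)[OF si])
  finally show "(\<integral>z. indicator ?Q z * F z \<partial>lborel) = integral (square L) (\<lambda>(x, y). F (Complex x y))" .
qed

section \<open>Rational maps in homogeneous coordinates\<close>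

text \<open>The point of the sphere with homogeneous coordinates \<open>a : b\<close>; the junk value at \<open>0 : 0\<close> is \<open>0\<close>.\<close>

definition hopf :: "complex \<Rightarrow> complex \<Rightarrow> real^3" where
  "hopf a b = (1 / ((norm a)\<^sup>2 + (norm b)\<^sup>2)) *\<^sub>R
     vector [2 * Re (a * cnj b), 2 * Im (a * cnj b), (norm a)\<^sup>2 - (norm b)\<^sup>2]"

lemma hopf_denom_pos: "a \<noteq> 0 \<or> b \<noteq> 0 \<Longrightarrow> (norm a)\<^sup>2 + (norm b)\<^sup>2 > 0" for a b :: complex
  by (auto simp: add_pos_nonneg add_nonneg_pos)

lemma norm_hopf:
  assumes "a \<noteq> 0 \<or> b \<noteq> 0" shows "norm (hopf a b) = 1"
proof -
  have p: "(norm a)\<^sup>2 + (norm b)\<^sup>2 > 0" by (rule hopf_denom_pos[OF assms])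
  have "(norm (vector [2 * Re (a * cnj b), 2 * Im (a * cnj b), (norm a)\<^sup>2 - (norm b)\<^sup>2] :: real^3))\<^sup>2
     = ((norm a)\<^sup>2 + (norm b)\<^sup>2)\<^sup>2"
    unfolding norm_vec_3 by (simp add: cmod_power2) algebra
  then have "norm (vector [2 * Re (a * cnj b), 2 * Im (a * cnj b), (norm a)\<^sup>2 - (norm b)\<^sup>2] :: real^3)
     = (norm a)\<^sup>2 + (norm b)\<^sup>2"
    using p by (metis norm_ge_zero less_imp_le power2_eq_imp_eq)
  then show ?thesis using p assms by (simp add: hopf_def)
qed

lemma hopf_1: "hopf z 1 = stereo_inv (Some z)"
  by (simp add: hopf_def stereo_inv_def)

lemma hopf_mult:
  assumes "c \<noteq> 0" shows "hopf (c * a) (c * b) = hopf a b"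
proof -
  have "c * a * cnj (c * b) = of_real ((norm c)\<^sup>2) * (a * cnj b)"
    using complex_norm_square[of c] by (simp add: mult_ac)
  then have 1: "Re (c * a * cnj (c * b)) = (norm c)\<^sup>2 * Re (a * cnj b)" "Im (c * a * cnj (c * b)) = (norm c)\<^sup>2 * Im (a * cnj b)"
    by (simp_all only: Re_complex_of_real Im_complex_of_real times_complex.simps mult_zero_left diff_zero add_0_right)
  define k where "k = (norm c)\<^sup>2"
  have k: "k > 0" using assms by (simp add: k_def)
  show ?thesis
    unfolding hopf_def 1 norm_mult power_mult_distrib k_def[symmetric] distrib_left[symmetric] right_diff_distrib[symmetric]
      vec_eq_iff forall_3
    using k by simp
qed

lemma hopf_stereo_inv:
  assumes "a \<noteq> 0 \<or> b \<noteq> 0"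
  shows "hopf a b = stereo_inv (if b = 0 then None else Some (a / b))"
proof (cases "b = 0")
  case True
  then show ?thesis using assms by (simp add: hopf_def stereo_inv_def vec_eq_iff forall_3)
next
  case False
  then show ?thesis using hopf_mult[of b "a / b" 1] by (simp add: hopf_1)
qed

text \<open>The translation acts on homogeneous coordinates by the identity minus the traceless
  Hermitian matrix with rows \<open>y3, y1 + i y2\<close> and \<open>y1 - i y2, - y3\<close>; its
  determinant is 1 - |y|^2. In real and imaginary parts everything is a polynomial identity.\<close>

lemma mobius_hopf:
  assumes y: "norm y < 1" and ab: "a \<noteq> 0 \<or> b \<noteq> 0"
  shows "mobius y (hopf a b) = hopf (of_real (1 - y$3) * a - Complex (y$1) (y$2) * b) (of_real (1 + y$3) * b - Complex (y$1) (- y$2) * a)"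
proof -
  define y1 y2 y3 where "y1 = y$1" and "y2 = y$2" and "y3 = y$3"
  define a1 a2 b1 b2 where "a1 = Re a" and "a2 = Im a" and "b1 = Re b" and "b2 = Im b"
  define c e where "c = of_real (1 - y$3) * a - Complex (y$1) (y$2) * b" and "e = of_real (1 + y$3) * b - Complex (y$1) (- y$2) * a"
  have ce: "Re c = (1 - y3) * a1 - (y1 * b1 - y2 * b2)" "Im c = (1 - y3) * a2 - (y1 * b2 + y2 * b1)"
     "Re e = (1 + y3) * b1 - (y1 * a1 + y2 * a2)" "Im e = (1 + y3) * b2 - (y1 * a2 - y2 * a1)"
    by (simp_all add: c_def e_def y1_def y2_def y3_def a1_def a2_def b1_def b2_def)
  define Y where "Y = y1\<^sup>2 + y2\<^sup>2 + y3\<^sup>2"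
  have Y: "(norm y)\<^sup>2 = Y" by (simp add: norm_vec_3 Y_def y1_def y2_def y3_def)
  define n where "n = a1\<^sup>2 + a2\<^sup>2 + (b1\<^sup>2 + b2\<^sup>2)"
  have n: "n > 0" using hopf_denom_pos[OF ab] by (simp add: n_def cmod_power2 a1_def a2_def b1_def b2_def)
  define h1 h2 h3 where "h1 = 2 * (a1 * b1 + a2 * b2)" and "h2 = 2 * (a2 * b1 - a1 * b2)" and "h3 = a1\<^sup>2 + a2\<^sup>2 - (b1\<^sup>2 + b2\<^sup>2)"
  have H: "hopf a b $ 1 = h1 / n" "hopf a b $ 2 = h2 / n" "hopf a b $ 3 = h3 / n"
    by (simp_all add: hopf_def cmod_power2 h1_def h2_def h3_def n_def a1_def a2_def b1_def b2_def)
  define s where "s = h1 * y1 + h2 * y2 + h3 * y3"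
  have i: "hopf a b \<bullet> y = s / n"
    unfolding inner_vec_def sum_3 H using n by (simp add: s_def y1_def y2_def y3_def add_divide_distrib)
  define m where "m = (Re c)\<^sup>2 + (Im c)\<^sup>2 + ((Re e)\<^sup>2 + (Im e)\<^sup>2)"
  have m: "m = (1 + Y) * n - 2 * s"
    unfolding m_def ce Y_def n_def s_def h1_def h2_def h3_def by algebra
  have "m / n = 1 - 2 * (hopf a b \<bullet> y) + (norm y)\<^sup>2"
    unfolding i Y m using n by (simp add: field_simps)
  then have mn2: "1 - 2 * (hopf a b \<bullet> y) + (norm y)\<^sup>2 = m / n" ..
  have "0 < m / n" unfolding mn2[symmetric] by (rule mobius_unit_denom_pos[OF norm_hopf[OF ab] y])
  then have mn: "m > 0" using n by (simp add: zero_less_divide_iff)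
  have k: "2 * (Re c * Re e + Im c * Im e) = (1 - Y) * h1 - (2 * n - 2 * s) * y1"
    "2 * (Im c * Re e - Re c * Im e) = (1 - Y) * h2 - (2 * n - 2 * s) * y2"
    "(Re c)\<^sup>2 + (Im c)\<^sup>2 - ((Re e)\<^sup>2 + (Im e)\<^sup>2) = (1 - Y) * h3 - (2 * n - 2 * s) * y3"
    unfolding ce Y_def n_def s_def h1_def h2_def h3_def by algebra+
  have C: "hopf c e $ 1 = 2 * (Re c * Re e + Im c * Im e) / m" "hopf c e $ 2 = 2 * (Im c * Re e - Re c * Im e) / m"
     "hopf c e $ 3 = ((Re c)\<^sup>2 + (Im c)\<^sup>2 - ((Re e)\<^sup>2 + (Im e)\<^sup>2)) / m"
    by (simp_all add: hopf_def cmod_power2 m_def)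
  have "mobius y (hopf a b) = hopf c e"
    unfolding mobius_unit[OF norm_hopf[OF ab]] mn2 unfolding vec_eq_iff forall_3 C k i Y
    using n mn by (simp add: H divide_simps flip: y1_def y2_def y3_def)
  then show ?thesis by (simp add: c_def e_def)
qed

text \<open>
  The derivative of \<open>v \<bullet> hopf a b\<close> along a curve. It depends on \<open>a'\<close> and \<open>b'\<close> only through
  \<open>a' b - a b'\<close>, because \<open>hopf\<close> ignores the radial part.
\<close>

definition hopf_slope :: "real^3 \<Rightarrow> complex \<Rightarrow> complex \<Rightarrow> complex \<Rightarrow> complex \<Rightarrow> real" where
  "hopf_slope v a b a' b' = (let w = cnj (a' * b - a * b') in
     2 / ((norm a)\<^sup>2 + (norm b)\<^sup>2)\<^sup>2 * (v \<bullet> vector [- Re (w * (a\<^sup>2 - b\<^sup>2)), - Im (w * (a\<^sup>2 + b\<^sup>2)), 2 * Re (w * (a * b))]))"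

lemma has_real_derivative_Re_Im:
  assumes "(f has_vector_derivative f') (at t)"
  shows "((\<lambda>t. Re (f t)) has_real_derivative Re f') (at t)" "((\<lambda>t. Im (f t)) has_real_derivative Im f') (at t)"
  using bounded_linear.has_vector_derivative[OF bounded_linear_Re assms]
    bounded_linear.has_vector_derivative[OF bounded_linear_Im assms]
  by (simp_all add: has_real_derivative_iff_has_vector_derivative)

text \<open>Quotient rule in real coordinates; the numerator is then matched with
  \<open>hopf_slope\<close> by a polynomial identity.\<close>

lemma hopf_has_derivative:
  assumes a: "(a has_vector_derivative a') (at t)" and b: "(b has_vector_derivative b') (at t)"
    and nz: "a t \<noteq> 0 \<or> b t \<noteq> 0"
  shows "((\<lambda>t. v \<bullet> hopf (a t) (b t)) has_real_derivative hopf_slope v (a t) (b t) a' b') (at t)"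
proof -
  note d = has_real_derivative_Re_Im[OF a] has_real_derivative_Re_Im[OF b]
  define A1 A2 B1 B2 where "A1 = (\<lambda>t. Re (a t))" and "A2 = (\<lambda>t. Im (a t))" and "B1 = (\<lambda>t. Re (b t))" and "B2 = (\<lambda>t. Im (b t))"
  define N where "N t = (A1 t)\<^sup>2 + (A2 t)\<^sup>2 + ((B1 t)\<^sup>2 + (B2 t)\<^sup>2)" for t
  define Sf where "Sf t = v$1 * (2 * (A1 t * B1 t + A2 t * B2 t)) + v$2 * (2 * (A2 t * B1 t - A1 t * B2 t))
      + v$3 * ((A1 t)\<^sup>2 + (A2 t)\<^sup>2 - ((B1 t)\<^sup>2 + (B2 t)\<^sup>2))" for t
  have eq: "v \<bullet> hopf (a t) (b t) = Sf t / N t" for t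
    by (simp add: inner_vec_def sum_3 hopf_def cmod_power2 N_def Sf_def A1_def A2_def B1_def B2_def add_divide_distrib)
  have N: "N t > 0" using hopf_denom_pos[OF nz] by (simp add: N_def cmod_power2 A1_def A2_def B1_def B2_def)
  define a1 a2 b1 b2 where "a1 = A1 t" and "a2 = A2 t" and "b1 = B1 t" and "b2 = B2 t"
  define c1 c2 e1 e2 where "c1 = Re a'" and "c2 = Im a'" and "e1 = Re b'" and "e2 = Im b'"
  note d = d[folded A1_def A2_def B1_def B2_def c1_def c2_def e1_def e2_def]
  define S' where "S' = v$1 * (2 * (c1 * b1 + a1 * e1 + (c2 * b2 + a2 * e2))) + v$2 * (2 * (c2 * b1 + a2 * e1 - (c1 * b2 + a1 * e2)))
     + v$3 * (2 * a1 * c1 + 2 * a2 * c2 - (2 * b1 * e1 + 2 * b2 * e2))"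
  define N' where "N' = 2 * a1 * c1 + 2 * a2 * c2 + (2 * b1 * e1 + 2 * b2 * e2)"
  have D: "((\<lambda>t. v \<bullet> hopf (a t) (b t)) has_real_derivative (S' * N t - Sf t * N') / (N t * N t)) (at t)"
    unfolding eq
  proof (rule DERIV_divide)
    show "(Sf has_real_derivative S') (at t)"
      unfolding Sf_def[abs_def]
      by (rule derivative_eq_intros d refl)+
         (simp add: S'_def a1_def a2_def b1_def b2_def algebra_simps)
    show "(N has_real_derivative N') (at t)"
      unfolding N_def[abs_def]
      by (rule derivative_eq_intros d refl)+
         (simp add: N'_def a1_def a2_def b1_def b2_def)
  qed (use N in simp)
  \<comment> \<open>Real and imaginary parts of \<open>a' * b - a * b'\<close>; \<open>k1\<close>,
    \<open>k2\<close>, \<open>k3\<close> below are the components of the vector in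
    \<open>hopf_slope\<close>.\<close>
  define w1 w2 where "w1 = c1 * b1 - c2 * b2 - (a1 * e1 - a2 * e2)" and "w2 = c1 * b2 + c2 * b1 - (a1 * e2 + a2 * e1)"
  define k1 k2 k3 where "k1 = - (w1 * (a1\<^sup>2 - a2\<^sup>2 - (b1\<^sup>2 - b2\<^sup>2)) + w2 * (2 * (a1 * a2) - 2 * (b1 * b2)))"
    and "k2 = - (w1 * (2 * (a1 * a2) + 2 * (b1 * b2)) - w2 * (a1\<^sup>2 - a2\<^sup>2 + (b1\<^sup>2 - b2\<^sup>2)))"
    and "k3 = 2 * (w1 * (a1 * b1 - a2 * b2) + w2 * (a1 * b2 + a2 * b1))"
  define w where "w = a' * b t - a t * b'"
  have w: "w1 = Re w" "w2 = Im w"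
    by (simp_all add: w_def w1_def w2_def a1_def a2_def b1_def b2_def A1_def A2_def B1_def B2_def c1_def c2_def e1_def e2_def)
  have kv: "k1 = - Re (cnj w * ((a t)\<^sup>2 - (b t)\<^sup>2))" "k2 = - Im (cnj w * ((a t)\<^sup>2 + (b t)\<^sup>2))" "k3 = 2 * Re (cnj w * (a t * b t))"
    unfolding k1_def k2_def k3_def w
    by (simp_all add: a1_def a2_def b1_def b2_def A1_def A2_def B1_def B2_def power2_eq_square)
  have "N t = (norm (a t))\<^sup>2 + (norm (b t))\<^sup>2" by (simp add: N_def cmod_power2 A1_def A2_def B1_def B2_def)
  then have "hopf_slope v (a t) (b t) a' b' = 2 / (N t)\<^sup>2 * (v$1 * k1 + v$2 * k2 + v$3 * k3)"
    unfolding hopf_slope_def Let_def inner_vec_def sum_3 kv w_def by simp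
  moreover have "S' * N t - Sf t * N' = 2 * (v$1 * k1 + v$2 * k2 + v$3 * k3)"
    unfolding S'_def N_def Sf_def N'_def k1_def k2_def k3_def w1_def w2_def a1_def[symmetric] a2_def[symmetric] b1_def[symmetric] b2_def[symmetric]
    by algebra
  ultimately show ?thesis using D by (simp add: power2_eq_square)
qed

text \<open>This is conformality: the velocity is a multiple of a vector \<open>k\<close> tangent to
  the sphere at \<open>hopf a b\<close>, with \<open>norm k\<close> equal to
  \<open>norm w * N\<close>. It only sees the tangential part of \<open>v\<close>, whose squared
  length is \<open>1 - g^2\<close>.\<close>

lemma hopf_slope_bound:
  assumes v: "norm v = 1" and nz: "a \<noteq> 0 \<or> b \<noteq> 0"
  shows "(hopf_slope v a b a' b')\<^sup>2 \<le>
    4 * (norm (a' * b - a * b'))\<^sup>2 / ((norm a)\<^sup>2 + (norm b)\<^sup>2)\<^sup>2 * (1 - (v \<bullet> hopf a b)\<^sup>2)"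
proof -
  define w where "w = a' * b - a * b'"
  define N where "N = (norm a)\<^sup>2 + (norm b)\<^sup>2"
  have N: "N > 0" using hopf_denom_pos[OF nz] by (simp add: N_def)
  define k :: "real^3" where "k = vector [- Re (cnj w * (a\<^sup>2 - b\<^sup>2)), - Im (cnj w * (a\<^sup>2 + b\<^sup>2)), 2 * Re (cnj w * (a * b))]"
  define a1 a2 b1 b2 w1 w2 where "a1 = Re a" and "a2 = Im a" and "b1 = Re b" and "b2 = Im b" and "w1 = Re w" and "w2 = Im w"
  have k: "k$1 = - (w1 * (a1\<^sup>2 - a2\<^sup>2 - (b1\<^sup>2 - b2\<^sup>2)) + w2 * (2 * (a1 * a2) - 2 * (b1 * b2)))"
     "k$2 = - (w1 * (2 * (a1 * a2) + 2 * (b1 * b2)) - w2 * (a1\<^sup>2 - a2\<^sup>2 + (b1\<^sup>2 - b2\<^sup>2)))"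
     "k$3 = 2 * (w1 * (a1 * b1 - a2 * b2) + w2 * (a1 * b2 + a2 * b1))"
    by (simp_all add: k_def a1_def a2_def b1_def b2_def w1_def w2_def power2_eq_square)
  have N': "N = a1\<^sup>2 + a2\<^sup>2 + (b1\<^sup>2 + b2\<^sup>2)" by (simp add: N_def cmod_power2 a1_def a2_def b1_def b2_def)
  have H: "hopf a b $ 1 = 2 * (a1 * b1 + a2 * b2) / N" "hopf a b $ 2 = 2 * (a2 * b1 - a1 * b2) / N"
     "hopf a b $ 3 = (a1\<^sup>2 + a2\<^sup>2 - (b1\<^sup>2 + b2\<^sup>2)) / N"
    by (simp_all add: hopf_def N_def cmod_power2 a1_def a2_def b1_def b2_def)
  have nk: "(norm k)\<^sup>2 = (w1\<^sup>2 + w2\<^sup>2) * N\<^sup>2"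
    unfolding norm_vec_3 k N' by algebra
  have "hopf a b \<bullet> k = (2 * (a1 * b1 + a2 * b2) * k$1 + 2 * (a2 * b1 - a1 * b2) * k$2 + (a1\<^sup>2 + a2\<^sup>2 - (b1\<^sup>2 + b2\<^sup>2)) * k$3) / N"
    unfolding inner_vec_def sum_3 H using N by (simp add: field_simps)
  also have "2 * (a1 * b1 + a2 * b2) * k$1 + 2 * (a2 * b1 - a1 * b2) * k$2 + (a1\<^sup>2 + a2\<^sup>2 - (b1\<^sup>2 + b2\<^sup>2)) * k$3 = 0"
    unfolding k by algebra
  finally have hk: "hopf a b \<bullet> k = 0" by simp
  define g where "g = v \<bullet> hopf a b"
  have "v \<bullet> k = (v - g *\<^sub>R hopf a b) \<bullet> k" by (simp add: inner_diff_left hk)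
  then have "(v \<bullet> k)\<^sup>2 \<le> (norm (v - g *\<^sub>R hopf a b))\<^sup>2 * (norm k)\<^sup>2"
    using Cauchy_Schwarz_ineq[of "v - g *\<^sub>R hopf a b" k] by (simp add: power2_norm_eq_inner)
  also have "(norm (v - g *\<^sub>R hopf a b))\<^sup>2 = 1 - g\<^sup>2"
  proof -
    have "hopf a b \<bullet> hopf a b = 1" "v \<bullet> v = 1" using norm_hopf[OF nz] v by (simp_all add: norm_eq_1)
    then show ?thesis
      unfolding power2_norm_eq_inner
      by (simp add: inner_diff_left inner_diff_right inner_commute[of "hopf a b" v] power2_eq_square flip: g_def)
  qed
  finally have "(v \<bullet> k)\<^sup>2 \<le> (1 - g\<^sup>2) * ((norm w)\<^sup>2 * N\<^sup>2)" by (simp add: nk cmod_power2 w1_def w2_def)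
  moreover have "hopf_slope v a b a' b' = 2 / N\<^sup>2 * (v \<bullet> k)" by (simp add: hopf_slope_def Let_def N_def k_def w_def)
  ultimately have "(hopf_slope v a b a' b')\<^sup>2 \<le> (2 / N\<^sup>2)\<^sup>2 * ((1 - g\<^sup>2) * ((norm w)\<^sup>2 * N\<^sup>2))"
    by (simp only: power_mult_distrib) (intro mult_left_mono, auto)
  also have "\<dots> = 4 * (norm w)\<^sup>2 / N\<^sup>2 * (1 - g\<^sup>2)" using N by (simp add: power_divide power2_eq_square)
  finally show ?thesis by (simp add: w_def N_def g_def)
qed

text \<open>The first two derivatives of \<open>log (|a|\<^sup>2 + |b|\<^sup>2)\<close> along a curve.\<close>

definition log_slope :: "complex \<Rightarrow> complex \<Rightarrow> complex \<Rightarrow> complex \<Rightarrow> real" where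
  "log_slope a b a' b' = 2 * Re (a' * cnj a + b' * cnj b) / ((norm a)\<^sup>2 + (norm b)\<^sup>2)"

definition log_curvature :: "complex \<Rightarrow> complex \<Rightarrow> complex \<Rightarrow> complex \<Rightarrow> complex \<Rightarrow> complex \<Rightarrow> real" where
  "log_curvature a b a' b' a'' b'' = 2 * (Re (a'' * cnj a + b'' * cnj b) + (norm a')\<^sup>2 + (norm b')\<^sup>2) / ((norm a)\<^sup>2 + (norm b)\<^sup>2)
     - (2 * Re (a' * cnj a + b' * cnj b))\<^sup>2 / ((norm a)\<^sup>2 + (norm b)\<^sup>2)\<^sup>2"

lemma log_slope_has_derivative:
  assumes a: "(a has_vector_derivative a' t) (at t)" and b: "(b has_vector_derivative b' t) (at t)"
    and a': "(a' has_vector_derivative a'') (at t)" and b': "(b' has_vector_derivative b'') (at t)"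
    and nz: "a t \<noteq> 0 \<or> b t \<noteq> 0"
  shows "((\<lambda>t. log_slope (a t) (b t) (a' t) (b' t)) has_real_derivative log_curvature (a t) (b t) (a' t) (b' t) a'' b'') (at t)"
proof -
  note d = has_real_derivative_Re_Im[OF a] has_real_derivative_Re_Im[OF b] has_real_derivative_Re_Im[OF a'] has_real_derivative_Re_Im[OF b']
  define A1 A2 B1 B2 where "A1 = (\<lambda>t. Re (a t))" and "A2 = (\<lambda>t. Im (a t))" and "B1 = (\<lambda>t. Re (b t))" and "B2 = (\<lambda>t. Im (b t))"
  define C1 C2 E1 E2 where "C1 = (\<lambda>t. Re (a' t))" and "C2 = (\<lambda>t. Im (a' t))" and "E1 = (\<lambda>t. Re (b' t))" and "E2 = (\<lambda>t. Im (b' t))"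
  have C: "Re (a' t) = C1 t" "Im (a' t) = C2 t" "Re (b' t) = E1 t" "Im (b' t) = E2 t" by (simp_all add: C1_def C2_def E1_def E2_def)
  note d = d[folded A1_def A2_def B1_def B2_def, unfolded C, folded C1_def C2_def E1_def E2_def]
  define N where "N t = (A1 t)\<^sup>2 + (A2 t)\<^sup>2 + ((B1 t)\<^sup>2 + (B2 t)\<^sup>2)" for t
  define S where "S t = 2 * (C1 t * A1 t + C2 t * A2 t + (E1 t * B1 t + E2 t * B2 t))" for t
  have N: "N t > 0" using hopf_denom_pos[OF nz] by (simp add: N_def cmod_power2 A1_def A2_def B1_def B2_def)
  have eq: "log_slope (a t) (b t) (a' t) (b' t) = S t / N t" for t
    by (simp add: log_slope_def S_def N_def cmod_power2 A1_def A2_def B1_def B2_def C1_def C2_def E1_def E2_def)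
  define S' where "S' = 2 * (Re a'' * A1 t + Im a'' * A2 t + (Re b'' * B1 t + Im b'' * B2 t) + ((C1 t)\<^sup>2 + (C2 t)\<^sup>2) + ((E1 t)\<^sup>2 + (E2 t)\<^sup>2))"
  have D: "((\<lambda>t. log_slope (a t) (b t) (a' t) (b' t)) has_real_derivative (S' * N t - S t * S t) / (N t * N t)) (at t)"
    unfolding eq
  proof (rule DERIV_divide)
    show "(S has_real_derivative S') (at t)"
      unfolding S_def[abs_def]
      by (rule derivative_eq_intros d refl)+
         (simp add: S'_def power2_eq_square algebra_simps)
    show "(N has_real_derivative S t) (at t)"
      unfolding N_def[abs_def]
      by (rule derivative_eq_intros d refl)+
         (simp add: S_def algebra_simps)
  qed (use N in simp)
  have "log_curvature (a t) (b t) (a' t) (b' t) a'' b'' = S' / N t - (S t)\<^sup>2 / (N t)\<^sup>2"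
    by (simp add: log_curvature_def S'_def S_def N_def cmod_power2 A1_def A2_def B1_def B2_def C1_def C2_def E1_def E2_def)
  also have "\<dots> = (S' * N t - S t * S t) / (N t * N t)" using N by (simp add: divide_simps power2_eq_square)
  finally show ?thesis using D by simp
qed

text \<open>Lagrange's form of Cauchy-Schwarz in two complex dimensions. The remainder is the
  Wronskian-like term that controls the energy.\<close>

lemma lagrange_identity:
  fixes a b a' b' :: complex
  shows "((norm a')\<^sup>2 + (norm b')\<^sup>2) * ((norm a)\<^sup>2 + (norm b)\<^sup>2) =
    (norm (a' * cnj a + b' * cnj b))\<^sup>2 + (norm (a' * b - a * b'))\<^sup>2"
  unfolding cmod_power2 by simp algebra

text \<open>
  For holomorphic \<open>a\<close> and \<open>b\<close> the second direction is that of the imaginary axis, along which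
  differentiation multiplies by \<open>\<i>\<close>.
\<close>

lemma laplacian_log:
  assumes "a \<noteq> 0 \<or> b \<noteq> 0"
  shows "log_curvature a b a' b' a'' b'' + log_curvature a b (\<i> * a') (\<i> * b') (\<i> * (\<i> * a'')) (\<i> * (\<i> * b'')) =
    4 * (norm (a' * b - a * b'))\<^sup>2 / ((norm a)\<^sup>2 + (norm b)\<^sup>2)\<^sup>2"
proof -
  define N where "N = (norm a)\<^sup>2 + (norm b)\<^sup>2"
  have N: "N > 0" using hopf_denom_pos[OF assms] by (simp add: N_def)
  define u where "u = a' * cnj a + b' * cnj b"
  define M where "M = (norm a')\<^sup>2 + (norm b')\<^sup>2"
  \<comment> \<open>The second-derivative terms have opposite signs in the two directions and cancel
    in the sum; the squared slopes contribute \<open>Re u\<close> and \<open>Im u\<close>, which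
    combine to \<open>norm u\<close>.\<close>
  have 1: "Re (\<i> * (\<i> * a'') * cnj a + \<i> * (\<i> * b'') * cnj b) = - Re (a'' * cnj a + b'' * cnj b)" by simp
  have 2: "Re (\<i> * a' * cnj a + \<i> * b' * cnj b) = - Im u" by (simp add: u_def)
  have "log_curvature a b a' b' a'' b'' + log_curvature a b (\<i> * a') (\<i> * b') (\<i> * (\<i> * a'')) (\<i> * (\<i> * b''))
      = 4 * M / N - 4 * (norm u)\<^sup>2 / N\<^sup>2"
    unfolding log_curvature_def 1 2 norm_mult cmod_power2[of u]
    by (simp add: N_def[symmetric] u_def[symmetric] M_def power_mult_distrib) (simp add: add_divide_distrib diff_divide_distrib)
  also have "\<dots> = 4 * (M * N - (norm u)\<^sup>2) / N\<^sup>2" using N by (simp add: field_simps power2_eq_square)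
  also have "M * N - (norm u)\<^sup>2 = (norm (a' * b - a * b'))\<^sup>2"
    using lagrange_identity[of a' b' a b] by (simp add: M_def N_def u_def)
  finally show ?thesis by (simp add: N_def)
qed

text \<open>Drop the last square in \<open>lagrange_identity\<close>.\<close>

lemma log_slope_bound:
  assumes "a \<noteq> 0 \<or> b \<noteq> 0"
  shows "(log_slope a b a' b')\<^sup>2 \<le> 4 * ((norm a')\<^sup>2 + (norm b')\<^sup>2) / ((norm a)\<^sup>2 + (norm b)\<^sup>2)"
proof -
  define N where "N = (norm a)\<^sup>2 + (norm b)\<^sup>2"
  have N: "N > 0" using hopf_denom_pos[OF assms] by (simp add: N_def)
  define u where "u = a' * cnj a + b' * cnj b"
  have "(Re u)\<^sup>2 \<le> (norm u)\<^sup>2" by (simp add: cmod_power2)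
  also have "\<dots> \<le> ((norm a')\<^sup>2 + (norm b')\<^sup>2) * N"
    unfolding N_def u_def lagrange_identity[of a' b' a b] by simp
  finally have "4 * (Re u)\<^sup>2 / N\<^sup>2 \<le> 4 * (((norm a')\<^sup>2 + (norm b')\<^sup>2) * N) / N\<^sup>2" by (intro divide_right_mono) auto
  then show ?thesis using N
    by (simp add: log_slope_def power_divide flip: N_def u_def) (simp add: power2_eq_square)
qed

lemma poly_has_vector_derivative:
  "((\<lambda>x. poly p (Complex x y)) has_vector_derivative poly (pderiv p) (Complex x y)) (at x)"
  "((\<lambda>y. poly p (Complex x y)) has_vector_derivative \<i> * poly (pderiv p) (Complex x y)) (at y)"
proof -
  have 1: "((\<lambda>x. Complex x y) has_vector_derivative 1) (at x)"
    unfolding Complex_eq by (auto intro!: derivative_eq_intros)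
  have 2: "((\<lambda>y. Complex x y) has_vector_derivative \<i>) (at y)"
    unfolding Complex_eq by (auto intro!: derivative_eq_intros)
  show "((\<lambda>x. poly p (Complex x y)) has_vector_derivative poly (pderiv p) (Complex x y)) (at x)"
    using field_vector_diff_chain_at[OF 1 poly_DERIV] by (simp add: comp_def)
  show "((\<lambda>y. poly p (Complex x y)) has_vector_derivative \<i> * poly (pderiv p) (Complex x y)) (at y)"
    using field_vector_diff_chain_at[OF 2 poly_DERIV] by (simp add: comp_def)
qed

text \<open>If \<open>n\<close> exceeds the degree, the limit and the coefficient are both
  0.\<close>

lemma poly_tendsto_coeff:
  fixes p :: "'a::real_normed_field poly"
  assumes "degree p \<le> n"
  shows "((\<lambda>z. poly p z / z ^ n) \<longlongrightarrow> coeff p n) at_infinity"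
proof (cases "degree p = n")
  case True
  then show ?thesis using poly_divide_tendsto_aux[of p] by simp
next
  case False
  then have n: "n = degree p + (n - degree p)" and pos: "0 < n - degree p" using assms by simp_all
  have "((\<lambda>z::'a. 1 / z) \<longlongrightarrow> 0) at_infinity" using tendsto_inverse_0 by (simp add: divide_inverse)
  then have "((\<lambda>z. (poly p z / z ^ degree p) * (1 / z) ^ (n - degree p)) \<longlongrightarrow> lead_coeff p * 0 ^ (n - degree p)) at_infinity"
    by (intro tendsto_intros poly_divide_tendsto_aux)
  moreover have "(poly p z / z ^ degree p) * (1 / z) ^ (n - degree p) = poly p z / z ^ n" for z
    by (subst (2) n) (simp only: power_add power_one_over divide_divide_eq_left times_divide_times_eq mult_1_right)
  moreover have "coeff p n = 0" using False assms by (simp add: coeff_eq_0)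
  moreover have "(0::'a) ^ (n - degree p) = 0" using pos by simp
  ultimately show ?thesis by simp
qed

section \<open>Energy of a pair of polynomials and the resulting deviation estimate\<close>

locale poly_pair =
  fixes p q :: "complex poly" and d :: nat
  assumes degree_le: "degree p \<le> d" "degree q \<le> d"
    and no_common_zero: "poly p z \<noteq> 0 \<or> poly q z \<noteq> 0"
begin

definition normsq :: "complex \<Rightarrow> real" where
  "normsq z = (norm (poly p z))\<^sup>2 + (norm (poly q z))\<^sup>2"

definition normsq' :: "complex \<Rightarrow> real" where
  "normsq' z = (norm (poly (pderiv p) z))\<^sup>2 + (norm (poly (pderiv q) z))\<^sup>2"

text \<open>The squared conformal factor of \<open>p / q\<close> from the flat plane to the round
  sphere, that is, the density of pulled-back area.\<close>

definition energy :: "complex \<Rightarrow> real" where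
  "energy z = 4 * (norm (poly (pderiv p) z * poly q z - poly p z * poly (pderiv q) z))\<^sup>2 / (normsq z)\<^sup>2"

lemma normsq_pos: "normsq z > 0"
  unfolding normsq_def by (rule hopf_denom_pos[OF no_common_zero])

text \<open>Multiplied by \<open>z\<close> and divided by \<open>z ^ n\<close>, a derivative tends
  to \<open>n\<close> times the coefficient of index \<open>n\<close>. So the ratio of the two sides
  tends to a number below 1 because \<open>n < d + 1\<close>; the summand 1 provides the strict gap.
  The radius may depend on the pair.\<close>

lemma normsq_growth: "\<exists>R. \<forall>z. norm z \<ge> R \<longrightarrow> (norm z)\<^sup>2 * normsq' z \<le> (real d + 1)\<^sup>2 * normsq z"
proof -
  define n where "n = max (degree p) (degree q)"
  have nd: "n \<le> d" using degree_le by (simp add: n_def)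
  show ?thesis
  proof (cases "n = 0")
    case True
    then have "pderiv p = 0" "pderiv q = 0" by (simp_all add: n_def pderiv_eq_0_iff)
    then show ?thesis using normsq_pos by (auto simp: normsq'_def less_imp_le)
  next
    case False
    define c where "c = (norm (coeff p n))\<^sup>2 + (norm (coeff q n))\<^sup>2"
    have "coeff p n \<noteq> 0 \<or> coeff q n \<noteq> 0"
    proof (cases "degree p = n")
      case True
      then have "p \<noteq> 0" using False by auto
      then show ?thesis using True by auto
    next
      case F: False
      then have "degree q = n" by (auto simp: n_def max_def split: if_splits)
      then show ?thesis using False by auto
    qed
    then have c: "c > 0" unfolding c_def by (rule hopf_denom_pos)
    have lim: "((\<lambda>z. poly r z / z ^ n) \<longlongrightarrow> coeff r n) at_infinity" if "degree r \<le> n" for r :: "complex poly"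
      using that by (rule poly_tendsto_coeff)
    have lim': "((\<lambda>z. z * poly (pderiv r) z / z ^ n) \<longlongrightarrow> of_nat n * coeff r n) at_infinity" if "degree r \<le> n" for r :: "complex poly"
    proof -
      have "((\<lambda>z. poly (pderiv r) z / z ^ (n - 1)) \<longlongrightarrow> coeff (pderiv r) (n - 1)) at_infinity"
        using that by (intro poly_tendsto_coeff) (simp add: degree_pderiv)
      moreover have "coeff (pderiv r) (n - 1) = of_nat n * coeff r n" using False by (simp add: coeff_pderiv)
      moreover have "\<forall>\<^sub>F z in at_infinity. poly (pderiv r) z / z ^ (n - 1) = z * poly (pderiv r) z / z ^ n"
        using eventually_not_equal_at_infinity[of "0::complex"]
      proof eventually_elim
        case (elim z)
        have "z ^ n = z * z ^ (n - 1)" using False by (cases n) auto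
        then show ?case using elim by simp
      qed
      ultimately show ?thesis by (simp add: filterlim_cong)
    qed
    have dpq: "degree p \<le> n" "degree q \<le> n" by (simp_all add: n_def)
    have lim_diff: "((\<lambda>z. (real d + 1)\<^sup>2 * ((norm (poly p z / z ^ n))\<^sup>2 + (norm (poly q z / z ^ n))\<^sup>2)
        - ((norm (z * poly (pderiv p) z / z ^ n))\<^sup>2 + (norm (z * poly (pderiv q) z / z ^ n))\<^sup>2)) \<longlongrightarrow>
        (real d + 1)\<^sup>2 * ((norm (coeff p n))\<^sup>2 + (norm (coeff q n))\<^sup>2)
        - ((norm (of_nat n * coeff p n))\<^sup>2 + (norm (of_nat n * coeff q n))\<^sup>2)) at_infinity"
      by (intro tendsto_intros lim lim' dpq)
    have "(real d + 1)\<^sup>2 * ((norm (coeff p n))\<^sup>2 + (norm (coeff q n))\<^sup>2)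
        - ((norm (of_nat n * coeff p n))\<^sup>2 + (norm (of_nat n * coeff q n))\<^sup>2) = ((real d + 1)\<^sup>2 - (real n)\<^sup>2) * c"
      by (simp add: c_def norm_mult power_mult_distrib algebra_simps)
    moreover have "(real n)\<^sup>2 < (real d + 1)\<^sup>2" using nd by (intro power_strict_mono) auto
    ultimately have "0 < (real d + 1)\<^sup>2 * ((norm (coeff p n))\<^sup>2 + (norm (coeff q n))\<^sup>2)
        - ((norm (of_nat n * coeff p n))\<^sup>2 + (norm (of_nat n * coeff q n))\<^sup>2)"
      using c by simp
    from order_tendstoD(1)[OF lim_diff this]
    have "\<forall>\<^sub>F z in at_infinity. 0 < (real d + 1)\<^sup>2 * ((norm (poly p z / z ^ n))\<^sup>2 + (norm (poly q z / z ^ n))\<^sup>2)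
        - ((norm (z * poly (pderiv p) z / z ^ n))\<^sup>2 + (norm (z * poly (pderiv q) z / z ^ n))\<^sup>2)" .
    then have "\<forall>\<^sub>F z in at_infinity. (norm z)\<^sup>2 * normsq' z \<le> (real d + 1)\<^sup>2 * normsq z"
      using eventually_not_equal_at_infinity[of "0::complex"]
    proof eventually_elim
      case (elim z)
      define k where "k = (norm z ^ n)\<^sup>2"
      have k: "k > 0" using elim by (simp add: k_def)
      have "(real d + 1)\<^sup>2 * ((norm (poly p z / z ^ n))\<^sup>2 + (norm (poly q z / z ^ n))\<^sup>2)
        - ((norm (z * poly (pderiv p) z / z ^ n))\<^sup>2 + (norm (z * poly (pderiv q) z / z ^ n))\<^sup>2)
        = ((real d + 1)\<^sup>2 * normsq z - (norm z)\<^sup>2 * normsq' z) / k"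
        by (simp add: normsq_def normsq'_def norm_divide norm_mult norm_power power_divide power_mult_distrib k_def
            add_divide_distrib diff_divide_distrib distrib_left)
      then have "0 < ((real d + 1)\<^sup>2 * normsq z - (norm z)\<^sup>2 * normsq' z) / k" using elim by simp
      then show ?case using k by (simp add: zero_less_divide_iff)
    qed
    then show ?thesis unfolding eventually_at_infinity by blast
  qed
qed

lemma continuous_poly_Complex: "continuous_on S (\<lambda>(x, y). poly r (Complex x y))"
  unfolding case_prod_beta Complex_eq by (intro continuous_intros)

text \<open>The energy is nonnegative, so the square may be enlarged until its boundary lies in the
  range of \<open>normsq_growth\<close>. There the gradient of \<open>log normsq\<close> is O(d /
  L'), and the perimeter \<open>8 * L'\<close> cancels the side.\<close>

lemma energy_bound:
  assumes "L > 0"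
  shows "integral (square L) (\<lambda>(x, y). energy (Complex x y)) \<le> 16 * (real d + 1)"
proof -
  obtain R where R: "\<And>z. norm z \<ge> R \<Longrightarrow> (norm z)\<^sup>2 * normsq' z \<le> (real d + 1)\<^sup>2 * normsq z"
    using normsq_growth by blast
  define L' where "L' = max L R"
  have L': "L' \<ge> L" "L' \<ge> R" "L' > 0" using assms by (auto simp: L'_def)
  define A where "A x y = (let z = Complex x y in log_slope (poly p z) (poly q z) (poly (pderiv p) z) (poly (pderiv q) z))" for x y
  define B where "B x y = (let z = Complex x y in log_slope (poly p z) (poly q z) (\<i> * poly (pderiv p) z) (\<i> * poly (pderiv q) z))" for x y
  define Ax where "Ax x y = (let z = Complex x y in log_curvature (poly p z) (poly q z) (poly (pderiv p) z) (poly (pderiv q) z)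
    (poly (pderiv (pderiv p)) z) (poly (pderiv (pderiv q)) z))" for x y
  define By where "By x y = (let z = Complex x y in log_curvature (poly p z) (poly q z) (\<i> * poly (pderiv p) z) (\<i> * poly (pderiv q) z)
    (\<i> * (\<i> * poly (pderiv (pderiv p)) z)) (\<i> * (\<i> * poly (pderiv (pderiv q)) z)))" for x y
  have E: "energy (Complex x y) = Ax x y + By x y" for x y
    unfolding Ax_def By_def Let_def laplacian_log[OF no_common_zero] energy_def normsq_def ..
  note cp = continuous_poly_Complex[of UNIV, unfolded case_prod_beta]
  have cN: "\<And>x. (norm (poly p (Complex (fst x) (snd x))))\<^sup>2 + (norm (poly q (Complex (fst x) (snd x))))\<^sup>2 \<noteq> 0"
    using normsq_pos unfolding normsq_def by (metis less_irrefl)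
  have c: "continuous_on UNIV (\<lambda>(x, y). A x y)" "continuous_on UNIV (\<lambda>(x, y). B x y)"
      "continuous_on UNIV (\<lambda>(x, y). Ax x y)" "continuous_on UNIV (\<lambda>(x, y). By x y)"
    unfolding A_def B_def Ax_def By_def Let_def log_slope_def log_curvature_def case_prod_beta
    by (intro continuous_intros cp; use cN in simp)+
  have Axd: "((\<lambda>x. A x y) has_real_derivative Ax x y) (at x)" for x y
    unfolding A_def Ax_def Let_def
    by (intro log_slope_has_derivative poly_has_vector_derivative no_common_zero)
  have Byd: "((\<lambda>y. B x y) has_real_derivative By x y) (at y)" for x y
    unfolding B_def By_def Let_def
    by (intro log_slope_has_derivative poly_has_vector_derivative no_common_zero has_vector_derivative_mult_right)
  have bd: "\<bar>A x y\<bar> \<le> 2 * (real d + 1) / L' \<and> \<bar>B x y\<bar> \<le> 2 * (real d + 1) / L'" if "\<bar>x\<bar> = L' \<or> \<bar>y\<bar> = L'" for x y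
  proof -
    define z where "z = Complex x y"
    have z: "norm z \<ge> L'" using that abs_Re_le_cmod[of z] abs_Im_le_cmod[of z] by (auto simp: z_def)
    have "L'\<^sup>2 * normsq' z \<le> (norm z)\<^sup>2 * normsq' z"
      using z L' by (intro mult_right_mono power_mono) (auto simp: normsq'_def)
    also have "\<dots> \<le> (real d + 1)\<^sup>2 * normsq z" using R z L' by simp
    finally have "normsq' z / normsq z \<le> (real d + 1)\<^sup>2 / L'\<^sup>2"
      using normsq_pos[of z] L' by (simp add: divide_simps mult_ac)
    then have "4 * normsq' z / normsq z \<le> 2\<^sup>2 * (real d + 1)\<^sup>2 / L'\<^sup>2" by simp
    then have "4 * normsq' z / normsq z \<le> (2 * (real d + 1) / L')\<^sup>2" by (simp only: power_divide power_mult_distrib)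
    moreover have "(A x y)\<^sup>2 \<le> 4 * normsq' z / normsq z"
      using log_slope_bound[OF no_common_zero] by (simp add: A_def Let_def z_def normsq_def normsq'_def)
    moreover have "(B x y)\<^sup>2 \<le> 4 * normsq' z / normsq z"
      using log_slope_bound[OF no_common_zero, of z "\<i> * poly (pderiv p) z" "\<i> * poly (pderiv q) z"]
      by (simp add: B_def Let_def z_def normsq_def normsq'_def norm_mult)
    ultimately have "(A x y)\<^sup>2 \<le> (2 * (real d + 1) / L')\<^sup>2" "(B x y)\<^sup>2 \<le> (2 * (real d + 1) / L')\<^sup>2" by linarith+
    moreover have "2 * (real d + 1) / L' \<ge> 0" using L' by simp
    ultimately show ?thesis by (metis abs_le_square_iff abs_of_nonneg)
  qed
  have ce: "continuous_on UNIV (\<lambda>(x, y). energy (Complex x y))"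
    unfolding E using c(3,4) unfolding case_prod_beta by (intro continuous_intros)
  have "integral (square L) (\<lambda>(x, y). energy (Complex x y)) \<le> integral (square L') (\<lambda>(x, y). energy (Complex x y))"
    using L' by (intro integral_subset_le square_integrable ce) (auto simp: mem_square energy_def)
  also have "\<dots> \<le> 8 * L' * (2 * (real d + 1) / L')"
    unfolding E by (intro flux_bound[of A Ax B By] Axd Byd c L' bd)
  also have "\<dots> = 16 * (real d + 1)" using L' by simp
  finally show ?thesis .
qed

lemma continuous_hopf: "continuous_on S (\<lambda>z. hopf (poly p z) (poly q z))"
  unfolding hopf_def using normsq_pos unfolding normsq_def
  by (intro continuous_intros) (metis less_irrefl)

text \<open>\<open>poincare_square\<close> with both partial derivatives bounded by
  \<open>sqrt (energy * (1 - g^2))\<close>. The free parameter \<open>t\<close> stands for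
  Cauchy-Schwarz: its weight is chosen only after the degree is known.\<close>

lemma deviation_bound:
  assumes v: "norm v = 1" and L: "L > 0" and t: "t > 0"
  defines "g \<equiv> \<lambda>z. v \<bullet> hopf (poly p z) (poly q z)"
  shows "\<exists>w. integral (square L) (\<lambda>(x, y). \<bar>g (Complex x y) - g w\<bar>) \<le>
    2 * L * (t * (16 * (real d + 1)) + integral (square L) (\<lambda>(x, y). 1 - (g (Complex x y))\<^sup>2) / t)"
proof -
  define gx where "gx x y = (let z = Complex x y in hopf_slope v (poly p z) (poly q z) (poly (pderiv p) z) (poly (pderiv q) z))" for x y
  define gy where "gy x y = (let z = Complex x y in hopf_slope v (poly p z) (poly q z) (\<i> * poly (pderiv p) z) (\<i> * poly (pderiv q) z))" for x y
  have gxd: "((\<lambda>x. g (Complex x y)) has_real_derivative gx x y) (at x)" for x y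
    unfolding g_def gx_def Let_def
    by (intro hopf_has_derivative poly_has_vector_derivative no_common_zero)
  have gyd: "((\<lambda>y. g (Complex x y)) has_real_derivative gy x y) (at y)" for x y
    unfolding g_def gy_def Let_def
    by (intro hopf_has_derivative poly_has_vector_derivative no_common_zero)
  note cp = continuous_poly_Complex[of UNIV, unfolded case_prod_beta]
  have cN: "\<And>x. (norm (poly p (Complex (fst x) (snd x))))\<^sup>2 + (norm (poly q (Complex (fst x) (snd x))))\<^sup>2 \<noteq> 0"
    using normsq_pos unfolding normsq_def by (metis less_irrefl)
  have cx: "continuous_on UNIV (\<lambda>(x, y). gx x y)" and cy: "continuous_on UNIV (\<lambda>(x, y). gy x y)"
    unfolding gx_def gy_def Let_def hopf_slope_def case_prod_beta
    by (intro continuous_intros cp; use cN in simp)+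
  have cg: "continuous_on UNIV (\<lambda>(x, y). g (Complex x y))"
    unfolding g_def hopf_def case_prod_beta by (intro continuous_intros cp) (use cN in simp)
  have ce: "continuous_on UNIV (\<lambda>(x, y). energy (Complex x y))"
    unfolding energy_def normsq_def case_prod_beta by (intro continuous_intros cp) (use cN in simp)
  have cs: "continuous_on UNIV (\<lambda>(x, y). 1 - (g (Complex x y))\<^sup>2)"
    using cg unfolding case_prod_beta by (intro continuous_intros)
  have cr: "continuous_on UNIV (\<lambda>(x, y). (t * energy (Complex x y) + (1 - (g (Complex x y))\<^sup>2) / t) / 2)"
    using ce cg t unfolding case_prod_beta by (intro continuous_intros) auto
  \<comment> \<open>Weighted inequality of arithmetic and geometric means, with weights
    \<open>t\<close> and \<open>1 / t\<close>.\<close>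
  have amgm: "\<bar>s\<bar> \<le> (t * E + r / t) / 2" if "s\<^sup>2 \<le> E * r" "E \<ge> 0" "r \<ge> 0" for s E r :: real
  proof -
    have "s\<^sup>2 \<le> E * r" by fact
    also have "\<dots> = (t * E) * (r / t)" using t by simp
    also have "\<dots> \<le> ((t * E + r / t) / 2)\<^sup>2"
      using zero_le_power2[of "t * E - r / t"] by (simp add: power2_eq_square algebra_simps)
    finally have "\<bar>s\<bar> \<le> \<bar>(t * E + r / t) / 2\<bar>" unfolding abs_le_square_iff .
    then show ?thesis using that t by simp
  qed
  have s0: "1 - (g z)\<^sup>2 \<ge> 0" for z
    using inner_sq_le[OF norm_hopf[OF no_common_zero], of v z] v by (simp add: g_def)
  have e0: "energy z \<ge> 0" for z by (simp add: energy_def)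
  have bx: "\<bar>gx x y\<bar> \<le> (t * energy (Complex x y) + (1 - (g (Complex x y))\<^sup>2) / t) / 2" for x y
  proof (rule amgm)
    show "(gx x y)\<^sup>2 \<le> energy (Complex x y) * (1 - (g (Complex x y))\<^sup>2)"
      unfolding gx_def Let_def energy_def normsq_def g_def by (rule hopf_slope_bound[OF v no_common_zero])
  qed (rule e0 s0)+
  have by': "\<bar>gy x y\<bar> \<le> (t * energy (Complex x y) + (1 - (g (Complex x y))\<^sup>2) / t) / 2" for x y
  proof (rule amgm)
    define z where "z = Complex x y"
    have "\<i> * poly (pderiv p) z * poly q z - poly p z * (\<i> * poly (pderiv q) z) =
      \<i> * (poly (pderiv p) z * poly q z - poly p z * poly (pderiv q) z)" by (simp add: algebra_simps)
    then show "(gy x y)\<^sup>2 \<le> energy (Complex x y) * (1 - (g (Complex x y))\<^sup>2)"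
      using hopf_slope_bound[OF v no_common_zero, of z "\<i> * poly (pderiv p) z" "\<i> * poly (pderiv q) z"]
      by (simp add: gy_def Let_def energy_def normsq_def g_def norm_mult flip: z_def)
  qed (rule e0 s0)+
  define J where "J = integral (square L) (\<lambda>(x, y). 1 - (g (Complex x y))\<^sup>2)"
  have r: "integral (square L) (\<lambda>(x, y). (t * energy (Complex x y) + (1 - (g (Complex x y))\<^sup>2) / t) / 2)
      = (t * integral (square L) (\<lambda>(x, y). energy (Complex x y)) + J / t) / 2"
    using has_integral_divide[OF has_integral_add[OF has_integral_mult_right[OF integrable_integral[OF square_integrable[OF ce]]]
      has_integral_divide[OF integrable_integral[OF square_integrable[OF cs]]]], of t t 2 L]
    unfolding J_def case_prod_beta by (rule integral_unique)
  obtain x0 where x0: "integral (square L) (\<lambda>(x, y). \<bar>g (Complex x y) - g (Complex x0 0)\<bar>) \<le>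
    2 * L * (integral (square L) (\<lambda>(x, y). \<bar>gx x y\<bar>) + integral (square L) (\<lambda>(x, y). \<bar>gy x y\<bar>))"
    using poincare_square[OF gxd gyd cg cx cy L] by blast
  also have "\<dots> \<le> 2 * L * ((t * integral (square L) (\<lambda>(x, y). energy (Complex x y)) + J / t) / 2
      + (t * integral (square L) (\<lambda>(x, y). energy (Complex x y)) + J / t) / 2)"
    unfolding r[symmetric]
  proof (intro mult_left_mono add_mono integral_le square_integrable cr)
    show "continuous_on UNIV (\<lambda>(x, y). \<bar>gx x y\<bar>)" "continuous_on UNIV (\<lambda>(x, y). \<bar>gy x y\<bar>)"
      using cx cy by (simp_all add: case_prod_beta continuous_on_rabs)
  qed (use bx by' L in auto)
  also have "\<dots> = 2 * L * (t * integral (square L) (\<lambda>(x, y). energy (Complex x y)) + J / t)" by simp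
  also have "\<dots> \<le> 2 * L * (t * (16 * (real d + 1)) + J / t)"
    using energy_bound[OF L] L t by (intro mult_left_mono add_mono) auto
  finally show ?thesis unfolding J_def by blast
qed

end

section \<open>The lower bound for the variance\<close>

lemma integrable_chart_density: "integrable lborel chart_density" "(\<integral>z. chart_density z \<partial>lborel) = 1"
proof -
  have "integrable mu_S2 (\<lambda>_. 1 :: real)" by simp
  then show "integrable lborel chart_density" by (subst (asm) integral_mu_S2_chart(2)) auto
  have "(\<integral>\<omega>. (1::real) \<partial>mu_S2) = 1" using mu_S2.prob_space by simp
  then show "(\<integral>z. chart_density z \<partial>lborel) = 1" by (subst (asm) integral_mu_S2_chart(1)) auto
qed

definition csquare :: "real \<Rightarrow> complex set" where
  "csquare L = {z. \<bar>Re z\<bar> \<le> L \<and> \<bar>Im z\<bar> \<le> L}"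

lemma borel_csquare [measurable]: "csquare L \<in> sets borel"
  unfolding csquare_def by measurable

text \<open>With 7/8 inside, the outside contributes at most 4 * (1/8) = 1/2 to the integral of
  \<open>(g - g w)^2\<close>, leaving room below 1.\<close>

lemma ex_square_mass: "\<exists>L>0. (\<integral>z. indicator (csquare L) z * chart_density z \<partial>lborel) \<ge> 7 / 8"
proof -
  have "(\<lambda>n. \<integral>z. indicator (csquare (real n)) z * chart_density z \<partial>lborel) \<longlonglongrightarrow> (\<integral>z. chart_density z \<partial>lborel)"
  proof (rule integral_dominated_convergence[where w = chart_density])
    show "AE z in lborel. (\<lambda>n. indicator (csquare (real n)) z * chart_density z) \<longlonglongrightarrow> chart_density z"
    proof (rule AE_I2)
      fix z :: complex
      obtain N where N: "norm z \<le> real N" using real_arch_simple by blast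
      have "indicator (csquare (real n)) z * chart_density z = chart_density z" if "n \<ge> N" for n
        using that N abs_Re_le_cmod[of z] abs_Im_le_cmod[of z] by (auto simp: csquare_def indicator_def)
      then show "(\<lambda>n. indicator (csquare (real n)) z * chart_density z) \<longlonglongrightarrow> chart_density z"
        by (intro tendsto_eventually) (auto simp: eventually_sequentially)
    qed
    show "AE z in lborel. norm (indicator (csquare (real i)) z * chart_density z) \<le> chart_density z" for i
      using chart_density_pos by (intro AE_I2) (auto simp: indicator_def less_imp_le)
  qed (auto simp: integrable_chart_density(1))
  then have "\<forall>\<^sub>F n in sequentially. 7 / 8 < (\<integral>z. indicator (csquare (real n)) z * chart_density z \<partial>lborel)"
    by (rule order_tendstoD) (simp add: integrable_chart_density(2))
  then have "\<forall>\<^sub>F n in sequentially. 0 < n \<and> 7 / 8 < (\<integral>z. indicator (csquare (real n)) z * chart_density z \<partial>lborel)"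
    using eventually_gt_at_top[of "0::nat"] by eventually_elim auto
  then obtain n where "0 < n" "7 / 8 < (\<integral>z. indicator (csquare (real n)) z * chart_density z \<partial>lborel)"
    using eventually_happens' sequentially_bot by blast
  then show ?thesis by (intro exI[of _ "real n"]) auto
qed

lemma chart_density_le: "chart_density z \<le> 1 / pi"
proof -
  have "1\<^sup>2 \<le> (1 + (norm z)\<^sup>2)\<^sup>2" by (intro power_mono) auto
  then have "pi * 1 \<le> pi * (1 + (norm z)\<^sup>2)\<^sup>2" by (intro mult_left_mono) auto
  moreover have "0 < pi * (1 + (norm z)\<^sup>2)\<^sup>2" using norm_sq_plus_1_pos[of z] by (simp add: add.commute)
  ultimately show ?thesis unfolding chart_density_def by (intro divide_left_mono) auto
qed

lemma chart_density_ge: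
  assumes "z \<in> csquare L" shows "chart_density z \<ge> 1 / (pi * (1 + 2 * L\<^sup>2)\<^sup>2)"
proof -
  have "(Re z)\<^sup>2 \<le> L\<^sup>2" "(Im z)\<^sup>2 \<le> L\<^sup>2" using assms by (auto simp: csquare_def abs_le_square_iff[symmetric])
  then have "(norm z)\<^sup>2 \<le> 2 * L\<^sup>2" by (simp add: cmod_power2)
  then have "pi * (1 + (norm z)\<^sup>2)\<^sup>2 \<le> pi * (1 + 2 * L\<^sup>2)\<^sup>2" by (intro mult_left_mono power_mono) auto
  moreover have "1 + 2 * L\<^sup>2 > 0" by (simp add: add_pos_nonneg)
  moreover have "0 < pi * (1 + (norm z)\<^sup>2)\<^sup>2" using norm_sq_plus_1_pos[of z] by (simp add: add.commute)
  ultimately show ?thesis unfolding chart_density_def by (intro divide_left_mono) auto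
qed

text \<open>\<open>L\<close>, \<open>w0\<close> and \<open>C\<close> are fixed before the
  polynomials, which makes \<open>c\<close> universal. On the square the chart density lies between
  \<open>w0\<close> and \<open>1 / pi\<close>, so flat and spherical integrals are comparable
  there.\<close>

theorem balanced_variance_bound:
  "\<exists>c>0. \<forall>p q d v. d \<ge> 1 \<longrightarrow> poly_pair p q d \<longrightarrow> norm v = 1 \<longrightarrow>
    (\<integral>z. chart_density z * (v \<bullet> hopf (poly p z) (poly q z)) \<partial>lborel) = 0 \<longrightarrow>
    c / real d \<le> (\<integral>z. chart_density z * (1 - (v \<bullet> hopf (poly p z) (poly q z))\<^sup>2) \<partial>lborel)"
proof -
  obtain L where L: "L > 0" and mass: "(\<integral>z. indicator (csquare L) z * chart_density z \<partial>lborel) \<ge> 7 / 8"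
    using ex_square_mass by blast
  define w0 where "w0 = 1 / (pi * (1 + 2 * L\<^sup>2)\<^sup>2)"
  have "1 + 2 * L\<^sup>2 > 0" by (simp add: add_pos_nonneg)
  then have w0: "w0 > 0" unfolding w0_def by auto
  \<comment> \<open>The coefficient of \<open>real d * \<epsilon>\<close> that the choice of
    \<open>t\<close> below produces.\<close>
  define C where "C = 2048 * L\<^sup>2 / (pi\<^sup>2 * w0)"
  have C: "C > 0" using L w0 by (simp add: C_def)
  show ?thesis
  proof (intro exI[of _ "1 / (4 * (1 + C))"] conjI allI impI)
    show "1 / (4 * (1 + C)) > 0" using C by simp
    fix p q :: "complex poly" and d :: nat and v :: "real^3"
    assume d: "d \<ge> 1" and pq: "poly_pair p q d" and v: "norm v = 1"
    interpret poly_pair p q d by (rule pq)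
    define g where "g = (\<lambda>z. v \<bullet> hopf (poly p z) (poly q z))"
    assume "(\<integral>z. chart_density z * (v \<bullet> hopf (poly p z) (poly q z)) \<partial>lborel) = 0"
    then have mean: "(\<integral>z. chart_density z * g z \<partial>lborel) = 0" by (simp add: g_def)
    have cg: "continuous_on S g" for S unfolding g_def by (intro continuous_intros continuous_hopf)
    have [measurable]: "g \<in> borel_measurable borel" by (rule borel_measurable_continuous_onI[OF cg])
    have g1: "\<bar>g z\<bar> \<le> 1" for z
      using Cauchy_Schwarz_ineq2[of v "hopf (poly p z) (poly q z)"] v norm_hopf[OF no_common_zero] by (simp add: g_def)
    then have g2: "(g z)\<^sup>2 \<le> 1" for z by (simp add: abs_square_le_1)
    have wi: "integrable lborel (\<lambda>z. chart_density z * h z)"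
      if [measurable]: "h \<in> borel_measurable borel" and "\<And>z. \<bar>h z\<bar> \<le> B" for h :: "complex \<Rightarrow> real" and B
    proof (rule Bochner_Integration.integrable_bound[where f = "\<lambda>z. B * chart_density z"])
      show "AE z in lborel. norm (chart_density z * h z) \<le> norm (B * chart_density z)"
      proof (rule AE_I2)
        fix z
        have "\<bar>h z\<bar> \<le> \<bar>B\<bar>" using that(2)[of z] by linarith
        then show "norm (chart_density z * h z) \<le> norm (B * chart_density z)"
          using chart_density_pos[of z] by (simp add: abs_mult mult.commute)
      qed
    qed (use integrable_chart_density(1) in auto)
    define \<epsilon> where "\<epsilon> = (\<integral>z. chart_density z * (1 - (g z)\<^sup>2) \<partial>lborel)"
    have i2: "integrable lborel (\<lambda>z. chart_density z * (1 - (g z)\<^sup>2))" by (rule wi[where B = 1]) (use g2 in auto)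
    have i1: "integrable lborel (\<lambda>z. chart_density z * g z)" by (rule wi[OF _ g1]) auto
    \<comment> \<open>Chosen so that the energy term
      \<open>2 / pi * (2 * L * (t * (32 * real d)))\<close> is exactly 1/4.\<close>
    define t where "t = pi / (512 * L * real d)"
    have t: "t > 0" using L d by (simp add: t_def)
    define J where "J = integral (square L) (\<lambda>(x, y). 1 - (g (Complex x y))\<^sup>2)"
    have J: "J \<le> \<epsilon> / w0"
    proof -
      have "J = (\<integral>z. indicator (csquare L) z * (1 - (g z)\<^sup>2) \<partial>lborel)"
        unfolding J_def csquare_def by (rule integral_square_complex(2)[symmetric]) (intro continuous_intros cg)
      also have "w0 * \<dots> = (\<integral>z. w0 * (indicator (csquare L) z * (1 - (g z)\<^sup>2)) \<partial>lborel)" by simp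
      also have "\<dots> \<le> (\<integral>z. chart_density z * (1 - (g z)\<^sup>2) \<partial>lborel)"
      proof (rule integral_mono)
        show "integrable lborel (\<lambda>z. w0 * (indicator (csquare L) z * (1 - (g z)\<^sup>2)))"
          unfolding csquare_def by (intro integrable_mult_right integral_square_complex(1) continuous_intros cg)
        show "w0 * (indicator (csquare L) z * (1 - (g z)\<^sup>2)) \<le> chart_density z * (1 - (g z)\<^sup>2)" for z
          using g2[of z] chart_density_ge[of z L] chart_density_pos[of z]
          by (auto simp: indicator_def w0_def[symmetric] intro!: mult_right_mono)
      qed (rule i2)
      finally show ?thesis using w0 by (simp add: \<epsilon>_def field_simps)
    qed
    obtain w where w: "integral (square L) (\<lambda>(x, y). \<bar>g (Complex x y) - g w\<bar>) \<le> 2 * L * (t * (16 * (real d + 1)) + J / t)"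
      using deviation_bound[OF v L t] unfolding J_def g_def by blast
    have I: "(\<integral>z. indicator (csquare L) z * \<bar>g z - g w\<bar> \<partial>lborel) = integral (square L) (\<lambda>(x, y). \<bar>g (Complex x y) - g w\<bar>)"
      unfolding csquare_def by (rule integral_square_complex(2)) (intro continuous_intros cg)
    have iI: "integrable lborel (\<lambda>z. indicator (csquare L) z * \<bar>g z - g w\<bar>)"
      unfolding csquare_def by (rule integral_square_complex(1)) (intro continuous_intros cg)
    have imass: "integrable lborel (\<lambda>z. indicator (csquare L) z * chart_density z)"
      using wi[of "indicator (csquare L)" 1] by (simp add: indicator_def mult.commute)
    \<comment> \<open>Expanding \<open>(g - g w)^2\<close>, the cross term vanishes because
      \<open>g\<close> has mean zero.\<close>
    have "1 - \<epsilon> \<le> (1 - \<epsilon>) + (g w)\<^sup>2" by simp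
    also have "\<dots> = (\<integral>z. chart_density z - chart_density z * (1 - (g z)\<^sup>2) - 2 * g w * (chart_density z * g z) + (g w)\<^sup>2 * chart_density z \<partial>lborel)"
      using i1 i2 integrable_chart_density by (simp add: mean \<epsilon>_def)
    also have "\<dots> = (\<integral>z. chart_density z * (g z - g w)\<^sup>2 \<partial>lborel)"
      by (intro Bochner_Integration.integral_cong refl) (simp add: power2_eq_square algebra_simps)
    \<comment> \<open>Both values of \<open>g\<close> lie in [-1, 1]: inside the square one factor
      \<open>\<bar>g z - g w\<bar>\<close> is bounded by 2 to pass from the square to the absolute
      value, outside the whole square is bounded by 4.\<close>
    also have "\<dots> \<le> (\<integral>z. 2 / pi * (indicator (csquare L) z * \<bar>g z - g w\<bar>) + 4 * (chart_density z - indicator (csquare L) z * chart_density z) \<partial>lborel)"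
    proof (rule integral_mono)
      have b: "\<bar>g z - g w\<bar> \<le> 2" for z using g1[of z] g1[of w] by linarith
      then have b2: "(g z - g w)\<^sup>2 \<le> 4" for z using abs_le_square_iff[of "g z - g w" 2] by simp
      show "integrable lborel (\<lambda>z. chart_density z * (g z - g w)\<^sup>2)" by (rule wi[where B = 4]) (use b2 in auto)
      show "integrable lborel (\<lambda>z. 2 / pi * (indicator (csquare L) z * \<bar>g z - g w\<bar>) + 4 * (chart_density z - indicator (csquare L) z * chart_density z))"
        using iI imass integrable_chart_density(1) by simp
      fix z
      show "chart_density z * (g z - g w)\<^sup>2 \<le> 2 / pi * (indicator (csquare L) z * \<bar>g z - g w\<bar>) + 4 * (chart_density z - indicator (csquare L) z * chart_density z)"
      proof (cases "z \<in> csquare L")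
        case True
        have "(g z - g w)\<^sup>2 = \<bar>g z - g w\<bar> * \<bar>g z - g w\<bar>" by (simp add: power2_eq_square)
        also have "\<dots> \<le> 2 * \<bar>g z - g w\<bar>" using b[of z] by (intro mult_right_mono) auto
        finally have "chart_density z * (g z - g w)\<^sup>2 \<le> 1 / pi * (2 * \<bar>g z - g w\<bar>)"
          using chart_density_le[of z] by (intro mult_mono) auto
        then show ?thesis using True by simp
      next
        case False
        have "chart_density z * (g z - g w)\<^sup>2 \<le> chart_density z * 4"
          using b2[of z] chart_density_pos[of z] by (intro mult_left_mono) auto
        then show ?thesis using False by simp
      qed
    qed
    also have "\<dots> = 2 / pi * integral (square L) (\<lambda>(x, y). \<bar>g (Complex x y) - g w\<bar>)
        + 4 * (1 - (\<integral>z. indicator (csquare L) z * chart_density z \<partial>lborel))"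
      using iI imass integrable_chart_density by (simp add: I)
    also have "\<dots> \<le> 2 / pi * (2 * L * (t * (16 * (real d + 1)) + J / t)) + 4 * (1 - 7 / 8)"
      using w mass by (intro add_mono mult_left_mono) auto
    \<comment> \<open>Uses \<open>real d + 1 \<le> 2 * real d\<close>.\<close>
    also have "\<dots> \<le> 2 / pi * (2 * L * (t * (32 * real d) + (\<epsilon> / w0) / t)) + 1 / 2"
      using d t J L by (intro add_mono mult_left_mono divide_right_mono) auto
    also have "\<dots> = 3 / 4 + C * real d * \<epsilon>"
      using L d w0 by (simp add: t_def C_def field_simps power2_eq_square)
    finally have 1: "1 / 4 \<le> \<epsilon> + C * real d * \<epsilon>" by simp
    have "\<epsilon> \<ge> 0" unfolding \<epsilon>_def using g2 chart_density_pos
      by (intro Bochner_Integration.integral_nonneg mult_nonneg_nonneg) (auto simp: less_imp_le)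
    then have "\<epsilon> * 1 \<le> \<epsilon> * real d" using d by (intro mult_left_mono) auto
    then have "1 / 4 \<le> \<epsilon> * real d * (1 + C)" using 1 by (simp add: algebra_simps)
    moreover have "0 < 4 * (1 + C) * real d" using C d by simp
    ultimately have "1 / (4 * (1 + C)) / real d \<le> \<epsilon>"
      unfolding divide_divide_eq_left by (subst pos_divide_le_eq) (auto simp: algebra_simps)
    then show "1 / (4 * (1 + C)) / real d \<le> (\<integral>z. chart_density z * (1 - (v \<bullet> hopf (poly p z) (poly q z))\<^sup>2) \<partial>lborel)"
      by (simp add: \<epsilon>_def g_def)
  qed
qed

section \<open>The barycentric extension\<close>

definition homog :: "nat \<Rightarrow> complex poly \<Rightarrow> complex \<Rightarrow> complex \<Rightarrow> complex" where
  "homog n p a b = (\<Sum>i\<le>n. coeff p i * (a ^ i * b ^ (n - i)))"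

lemma homog_eq_poly:
  assumes "b \<noteq> 0" "degree p \<le> n" shows "homog n p a b = b ^ n * poly p (a / b)"
proof -
  have "poly p (a / b) = (\<Sum>i\<le>n. coeff p i * (a / b) ^ i)"
    unfolding poly_altdef using assms(2)
    by (intro sum.mono_neutral_left) (auto simp: coeff_eq_0)
  moreover have e: "b ^ n * (coeff p i * (a / b) ^ i) = coeff p i * (a ^ i * b ^ (n - i))" if "i \<le> n" for i
    using assms(1) that by (simp add: power_divide power_diff)
  ultimately show ?thesis
    unfolding homog_def by (simp only: sum_distrib_left) (rule sum.cong[OF refl], rule e[symmetric], simp)
qed

lemma homog_infinity: "homog n p a 0 = coeff p n * a ^ n"
proof -
  have "homog n p a 0 = (\<Sum>i\<in>{n}. coeff p i * (a ^ i * 0 ^ (n - i)))"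
    unfolding homog_def by (intro sum.mono_neutral_right) auto
  then show ?thesis by simp
qed

text \<open>Substitution of \<open>l : l'\<close> into the homogenisation of \<open>p\<close>, so
  that composing with a fractional linear map stays polynomial.\<close>

definition homog_poly :: "nat \<Rightarrow> complex poly \<Rightarrow> complex poly \<Rightarrow> complex poly \<Rightarrow> complex poly" where
  "homog_poly n p l l' = (\<Sum>i\<le>n. smult (coeff p i) (l ^ i * l' ^ (n - i)))"

lemma poly_homog_poly: "poly (homog_poly n p l l') z = homog n p (poly l z) (poly l' z)"
  by (simp add: homog_poly_def homog_def poly_sum)

lemma degree_homog_poly:
  assumes "degree l \<le> 1" "degree l' \<le> 1" shows "degree (homog_poly n p l l') \<le> n"
  unfolding homog_poly_def
proof (rule degree_sum_le)
  fix i assume "i \<in> {..n}"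
  have "degree (smult (coeff p i) (l ^ i * l' ^ (n - i))) \<le> degree (l ^ i) + degree (l' ^ (n - i))"
    by (rule order_trans[OF degree_smult_le degree_mult_le])
  also have "\<dots> \<le> degree l * i + degree l' * (n - i)" by (intro add_mono degree_power_le)
  also have "\<dots> \<le> 1 * i + 1 * (n - i)" using assms by (intro add_mono mult_right_mono) auto
  finally show "degree (smult (coeff p i) (l ^ i * l' ^ (n - i))) \<le> n" using \<open>i \<in> {..n}\<close> by simp
qed simp

lemma hopf_0: "hopf 0 0 = 0"
  by (simp add: hopf_def)

text \<open>If both entries vanished, \<open>mobius_hopf\<close> would give the junk value 0 of
  \<open>hopf\<close> for a point of norm 1.\<close>

lemma mobius_matrix_nonzero:
  fixes y :: "real^3"
  assumes "norm y < 1" "a \<noteq> 0 \<or> b \<noteq> 0"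
  shows "of_real (1 - y$3) * a - Complex (y$1) (y$2) * b \<noteq> 0 \<or> of_real (1 + y$3) * b - Complex (y$1) (- y$2) * a \<noteq> 0"
  using mobius_hopf[OF assms] norm_mobius_eq_1[OF norm_hopf[OF assms(2)] assms(1)] by (metis hopf_0 norm_zero zero_neq_one)

lemma stereo_stereo_inv': "stereo (stereo_inv w) = w"
  by (cases w) (simp_all add: stereo_stereo_inv, simp add: stereo_inv_def stereo_def)

lemma norm_stereo_inv: "norm (stereo_inv w) = 1"
proof (cases w)
  case None
  have "(norm (vector [0, 0, 1] :: real^3))\<^sup>2 = 1\<^sup>2" unfolding norm_vec_3 by simp
  then have "norm (vector [0, 0, 1] :: real^3) = 1" by (rule power2_eq_imp_eq) auto
  then show ?thesis using None by (simp add: stereo_inv_def)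
qed (simp add: norm_stereo_inv_Some)

lemma on_sphere_stereo_inv: "on_sphere f (stereo_inv w) = stereo_inv (f w)"
  by (simp add: on_sphere_def stereo_stereo_inv')

lemma norm_on_sphere: "norm (on_sphere f \<zeta>) = 1"
  by (simp add: on_sphere_def norm_stereo_inv)

lemma is_unit_imp_degree_0: "is_unit p \<Longrightarrow> degree p = 0" for p :: "'a::field poly"
  by (metis is_unit_iff_degree not_is_unit_0)

section \<open>The extension of a rational map of degree at least one\<close>

locale coprime_pair =
  fixes p q :: "complex poly" and d :: nat
  assumes coprime_pq: "coprime p q" and d_eq: "max (degree p) (degree q) = d" and d_pos: "d \<ge> 1"
begin

lemma degree_le_d: "degree p \<le> d" "degree q \<le> d"
  using d_eq by auto

lemma no_common_root: "poly p z \<noteq> 0 \<or> poly q z \<noteq> 0"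
proof (rule ccontr)
  assume "\<not> ?thesis"
  then have "[:- z, 1:] dvd p" "[:- z, 1:] dvd q" by (simp_all add: poly_eq_0_iff_dvd)
  then have "is_unit [:- z, 1:]" using coprime_pq coprime_common_divisor by blast
  then show False by (simp add: is_unit_iff_degree)
qed

lemma coeff_d_nonzero: "coeff p d \<noteq> 0 \<or> coeff q d \<noteq> 0"
  using d_eq d_pos by (auto simp: max_def split: if_splits)

lemma homog_nonzero:
  assumes "a \<noteq> 0 \<or> b \<noteq> 0" shows "homog d p a b \<noteq> 0 \<or> homog d q a b \<noteq> 0"
proof (cases "b = 0")
  case True
  then show ?thesis using assms coeff_d_nonzero by (simp add: homog_infinity)
next
  case False
  then show ?thesis using no_common_root[of "a / b"] by (simp add: homog_eq_poly degree_le_d)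
qed

definition F :: "real^3 \<Rightarrow> real^3" where
  "F = on_sphere (rational_fun p q)"

text \<open>The homogenisations differ from the values of \<open>p\<close> and \<open>q\<close> by
  the common factor \<open>b ^ d\<close>, or \<open>a ^ d\<close> at infinity, which
  \<open>hopf\<close> ignores.\<close>

lemma F_hopf:
  assumes ab: "a \<noteq> 0 \<or> b \<noteq> 0" shows "F (hopf a b) = hopf (homog d p a b) (homog d q a b)"
proof (cases "b = 0")
  case True
  then have a: "a ^ d \<noteq> 0" using ab by simp
  have "hopf (homog d p a b) (homog d q a b) = hopf (coeff p d) (coeff q d)"
    using hopf_mult[OF a] True by (simp add: homog_infinity mult.commute)
  then show ?thesis
    unfolding hopf_stereo_inv[OF ab] F_def on_sphere_stereo_inv
    using True by (simp add: hopf_stereo_inv[OF coeff_d_nonzero] rational_fun_def Let_def d_eq)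
next
  case False
  then have b: "b ^ d \<noteq> 0" by simp
  have "hopf (homog d p a b) (homog d q a b) = hopf (poly p (a / b)) (poly q (a / b))"
    using hopf_mult[OF b] False by (simp add: homog_eq_poly degree_le_d)
  then show ?thesis
    unfolding hopf_stereo_inv[OF ab] F_def on_sphere_stereo_inv
    using False by (simp add: hopf_stereo_inv[OF no_common_root] rational_fun_def)
qed

lemma norm_F: "norm (F \<zeta>) = 1"
  by (simp add: F_def norm_on_sphere)

lemma measurable_F [measurable]: "F \<in> borel_S2 \<rightarrow>\<^sub>M borel_S2"
proof (rule measurable_restrict_space2)
  define P where "P r \<zeta> = homog d r (Complex (\<zeta>$1) (\<zeta>$2)) (of_real (1 - \<zeta>$3))" for r and \<zeta> :: "real^3"
  have cP: "continuous_on UNIV (P r)" for r unfolding P_def homog_def Complex_eq by (intro continuous_intros)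
  have "continuous_on UNIV (\<lambda>\<zeta>. vector [2 * Re (P p \<zeta> * cnj (P q \<zeta>)), 2 * Im (P p \<zeta> * cnj (P q \<zeta>)), (norm (P p \<zeta>))\<^sup>2 - (norm (P q \<zeta>))\<^sup>2] :: real^3)"
    by (intro continuous_intros cP)
  from borel_measurable_continuous_onI[OF this] borel_measurable_continuous_onI[OF cP]
  have [measurable]: "(\<lambda>\<zeta>. hopf (P p \<zeta>) (P q \<zeta>)) \<in> borel_measurable borel"
    unfolding hopf_def by measurable
  \<comment> \<open>A point has homogeneous coordinates
    \<open>\<zeta>1 + i \<zeta>2 : 1 - \<zeta>3\<close> except at the north pole, where both vanish
    and the value is inserted by hand.\<close>
  have "(\<lambda>\<zeta>. if \<zeta>$3 = 1 then F (vector [0,0,1]) else hopf (P p \<zeta>) (P q \<zeta>)) \<in> borel_measurable borel"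
    by measurable
  then have "(\<lambda>\<zeta>. if \<zeta>$3 = 1 then F (vector [0,0,1]) else hopf (P p \<zeta>) (P q \<zeta>)) \<in> borel_measurable borel_S2"
    by (rule measurable_restrict_space1)
  moreover have "(if \<zeta>$3 = 1 then F (vector [0,0,1]) else hopf (P p \<zeta>) (P q \<zeta>)) = F \<zeta>" if "\<zeta> \<in> space borel_S2" for \<zeta>
  proof (cases "\<zeta>$3 = 1")
    case True
    then show ?thesis using sphere_component_3(2)[of \<zeta>] that by simp
  next
    case False
    then have nz: "Complex (\<zeta>$1) (\<zeta>$2) \<noteq> 0 \<or> of_real (1 - \<zeta>$3) \<noteq> (0::complex)"
      by (metis eq_iff_diff_eq_0 of_real_eq_0_iff)
    have "\<zeta> = stereo_inv (Some (Complex (\<zeta>$1) (\<zeta>$2) / of_real (1 - \<zeta>$3)))"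
    proof -
      have "Complex (\<zeta>$1) (\<zeta>$2) / of_real (1 - \<zeta>$3) = Complex (\<zeta>$1 / (1 - \<zeta>$3)) (\<zeta>$2 / (1 - \<zeta>$3))"
        by (simp only: complex_eq_iff Re_divide_of_real Im_divide_of_real complex.sel)
      then show ?thesis using stereo_inv_stereo[of \<zeta>] that False by (simp add: stereo_def)
    qed
    also have "\<dots> = hopf (Complex (\<zeta>$1) (\<zeta>$2)) (of_real (1 - \<zeta>$3))"
      using False unfolding hopf_stereo_inv[OF nz] by simp
    finally have "F \<zeta> = hopf (P p \<zeta>) (P q \<zeta>)" unfolding P_def using F_hopf[OF nz] by simp
    then show ?thesis using False by simp
  qed
  ultimately show "F \<in> borel_S2 \<rightarrow>\<^sub>M borel" by (subst measurable_cong[symmetric]) auto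
qed (auto simp: norm_F)

text \<open>Fibres are zeros of \<open>q\<close> or of \<open>p - smult c q\<close>. Neither
  polynomial vanishes identically, since coprimality would then force degree 0. Finite fibres keep
  the image measures atomless.\<close>

lemma finite_fibre: "finite {\<omega>. norm \<omega> = 1 \<and> F \<omega> = \<xi>}"
proof -
  define w where "w = stereo \<xi>"
  have fin: "finite {z. rational_fun p q (Some z) = w}"
  proof (cases w)
    case None
    have "q \<noteq> 0"
    proof
      assume "q = 0"
      then have "is_unit p" using coprime_pq by simp
      then have "degree p = 0" by (rule is_unit_imp_degree_0)
      then show False using d_eq d_pos \<open>q = 0\<close> by simp
    qed
    then have "finite {z. poly q z = 0}" by (rule poly_roots_finite)
    then show ?thesis by (rule rev_finite_subset) (auto simp: rational_fun_def None split: if_splits)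
  next
    case (Some c)
    have "p - smult c q \<noteq> 0"
    proof
      assume "p - smult c q = 0"
      then have "q dvd p" by (metis dvd_smult dvd_refl eq_iff_diff_eq_0)
      then have "is_unit q" using coprime_pq by (metis coprime_common_divisor dvd_refl)
      then have "degree q = 0" by (rule is_unit_imp_degree_0)
      moreover have "degree p \<le> degree q" using \<open>p - smult c q = 0\<close> by (metis degree_smult_le eq_iff_diff_eq_0)
      ultimately show False using d_eq d_pos by simp
    qed
    then have "finite {z. poly (p - smult c q) z = 0}" by (rule poly_roots_finite)
    then show ?thesis by (rule rev_finite_subset) (auto simp: rational_fun_def Some field_simps split: if_splits)
  qed
  have "{\<omega>. norm \<omega> = 1 \<and> F \<omega> = \<xi>} \<subseteq> insert (stereo_inv None) ((\<lambda>z. stereo_inv (Some z)) ` {z. rational_fun p q (Some z) = w})"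
  proof clarify
    fix \<omega> :: "real^3" assume o: "norm \<omega> = 1" "\<xi> = F \<omega>" "\<omega> \<notin> (\<lambda>z. stereo_inv (Some z)) ` {z. rational_fun p q (Some z) = w}"
    have so: "stereo_inv (stereo \<omega>) = \<omega>" by (rule stereo_inv_stereo[OF o(1)])
    show "\<omega> = stereo_inv None"
    proof (cases "stereo \<omega>")
      case None
      then show ?thesis using so by simp
    next
      case (Some z)
      then have "w = rational_fun p q (Some z)" by (simp add: w_def o(2) F_def on_sphere_def stereo_stereo_inv')
      moreover have "\<omega> = stereo_inv (Some z)" using so Some by simp
      ultimately show ?thesis using o(3) by blast
    qed
  qed
  then show ?thesis using fin by (meson finite.insertI finite_imageI finite_subset)
qed

text \<open>Source translation substitutes linear polynomials into the homogenisations; target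
  translation takes two linear combinations of the results. Both matrices are invertible, so no
  common zero appears and the degree bound survives.\<close>

lemma conjugate_poly_pair:
  assumes x: "norm x < 1" and y: "norm y < 1"
  shows "\<exists>r s. poly_pair r s d \<and>
    (\<forall>z. mobius y (F (mobius (- x) (stereo_inv (Some z)))) = hopf (poly r z) (poly s z))"
proof -
  \<comment> \<open>\<open>l : l'\<close> is the image of \<open>z : 1\<close> under the matrix of
    \<open>mobius (- x)\<close> from \<open>mobius_hopf\<close>.\<close>
  define l where "l = [:Complex (x$1) (x$2), of_real (1 + x$3):]"
  define l' where "l' = [:of_real (1 - x$3), Complex (x$1) (- x$2):]"
  define P where "P = homog_poly d p l l'"
  define Q where "Q = homog_poly d q l l'"
  define r where "r = smult (of_real (1 - y$3)) P - smult (Complex (y$1) (y$2)) Q"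
  define s where "s = smult (of_real (1 + y$3)) Q - smult (Complex (y$1) (- y$2)) P"
  have x': "norm (- x) < 1" using x by simp
  have n1: "z \<noteq> 0 \<or> (1::complex) \<noteq> 0" for z :: complex by simp
  have ll: "of_real (1 - (- x)$3) * z - Complex ((- x)$1) ((- x)$2) * 1 = poly l z"
     "of_real (1 + (- x)$3) * 1 - Complex ((- x)$1) (- (- x)$2) * z = poly l' z" for z
    by (simp_all add: l_def l'_def complex_eq_iff)
  have l0: "poly l z \<noteq> 0 \<or> poly l' z \<noteq> 0" for z
    using mobius_matrix_nonzero[OF x' n1, of z] unfolding ll .
  have PQ: "poly P z = homog d p (poly l z) (poly l' z)" "poly Q z = homog d q (poly l z) (poly l' z)" for z
    by (simp_all add: P_def Q_def poly_homog_poly)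
  have P0: "poly P z \<noteq> 0 \<or> poly Q z \<noteq> 0" for z
    unfolding PQ by (rule homog_nonzero[OF l0])
  have rs: "of_real (1 - y$3) * poly P z - Complex (y$1) (y$2) * poly Q z = poly r z"
    "of_real (1 + y$3) * poly Q z - Complex (y$1) (- y$2) * poly P z = poly s z" for z
    by (simp_all add: r_def s_def)
  have dPQ: "degree P \<le> d" "degree Q \<le> d"
    unfolding P_def Q_def by (intro degree_homog_poly; simp add: l_def l'_def)+
  have "poly_pair r s d"
  proof
    show "degree r \<le> d" "degree s \<le> d"
      unfolding r_def s_def using dPQ by (intro degree_diff_le order_trans[OF degree_smult_le]; simp)+
    show "poly r z \<noteq> 0 \<or> poly s z \<noteq> 0" for z
      using mobius_matrix_nonzero[OF y P0, of z] unfolding rs .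
  qed
  moreover have "mobius y (F (mobius (- x) (stereo_inv (Some z)))) = hopf (poly r z) (poly s z)" for z
  proof -
    have "mobius (- x) (stereo_inv (Some z)) = hopf (poly l z) (poly l' z)"
      using mobius_hopf[OF x' n1, of z] unfolding ll hopf_1 .
    then show ?thesis
      by (simp only: F_hopf[OF l0] mobius_hopf[OF y P0] rs flip: PQ)
  qed
  ultimately show ?thesis by blast
qed

text \<open>The measure in \<open>barycentric_extension\<close>, with \<open>mobius (- x)\<close> in
  place of the isometry picked by \<open>SOME\<close>.\<close>

definition pushed :: "real^3 \<Rightarrow> (real^3) measure" where
  "pushed x = distr mu_S2 borel_S2 (\<lambda>\<omega>. F (mobius (- x) \<omega>))"

lemma measurable_pushed: "norm x < 1 \<Longrightarrow> (\<lambda>\<omega>. F (mobius (- x) \<omega>)) \<in> borel_S2 \<rightarrow>\<^sub>M borel_S2"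
  using measurable_compose[OF measurable_mobius measurable_F, of "- x"] by simp

lemma measurable_pushed': "norm x < 1 \<Longrightarrow> (\<lambda>\<omega>. F (mobius (- x) \<omega>)) \<in> mu_S2 \<rightarrow>\<^sub>M borel_S2"
  using measurable_pushed by (simp cong: measurable_cong_sets)

lemma atomless_pushed:
  assumes x: "norm x < 1" shows "atomless_sphere_prob (pushed x)"
proof -
  interpret P: prob_space "pushed x"
    unfolding pushed_def by (rule mu_S2.prob_space_distr[OF measurable_pushed'[OF x]])
  show ?thesis
  proof
    fix \<zeta> :: "real^3"
    show "emeasure (pushed x) {\<zeta>} = 0"
    proof (cases "norm \<zeta> = 1")
      case True
      let ?A = "(\<lambda>\<omega>. F (mobius (- x) \<omega>)) -` {\<zeta>} \<inter> sphere 0 1"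
      have "?A \<subseteq> mobius x ` {\<omega>. norm \<omega> = 1 \<and> F \<omega> = \<zeta>}"
      proof
        fix \<omega> assume "\<omega> \<in> ?A"
        then have "mobius x (mobius (- x) \<omega>) = \<omega>" "norm (mobius (- x) \<omega>) = 1" "F (mobius (- x) \<omega>) = \<zeta>"
          using mobius_inverse[of \<omega> "- x"] x by (auto simp: norm_mobius_eq_1)
        then show "\<omega> \<in> mobius x ` {\<omega>. norm \<omega> = 1 \<and> F \<omega> = \<zeta>}" by (intro image_eqI[OF sym]) auto
      qed
      then have "finite ?A" using finite_fibre finite_subset by blast
      then have "?A \<in> null_sets mu_S2" by (intro mu_S2_finite) auto
      then show ?thesis using True unfolding pushed_def
        by (subst emeasure_distr[OF measurable_pushed'[OF x]]) (auto simp: sets_restrict_space_iff)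
    qed (intro emeasure_notin_sets, auto simp: pushed_def sets_restrict_space_iff)
  qed (simp add: pushed_def)
qed

text \<open>The chosen isometry is \<open>mobius (- x)\<close> after an orthogonal map, and that map
  preserves \<open>mu_S2\<close>.\<close>

lemma barycentric_extension_eq:
  assumes x: "norm x < 1"
  shows "barycentric_extension (rational_fun p q) x = barycenter (pushed x)"
proof -
  define M where "M = (SOME M. hyp_isometry M \<and> M 0 = x)"
  have "\<exists>M. hyp_isometry M \<and> M 0 = x"
    using x by (intro exI[of _ "mobius (- x)"]) (auto intro: hyp_isometry_mobius)
  from someI_ex[OF this] have M: "hyp_isometry M" "M 0 = x" unfolding M_def by auto
  obtain g where g: "orthogonal_transformation g" "\<And>z. norm z = 1 \<Longrightarrow> M z = mobius (- x) (g z)"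
    using hyp_isometry_from_0[OF M x] by metis
  have gm: "g \<in> mu_S2 \<rightarrow>\<^sub>M borel_S2" using measurable_orthogonal_S2[OF g(1)] by (simp cong: measurable_cong_sets)
  have "distr mu_S2 borel_S2 (F \<circ> M) = distr mu_S2 borel_S2 ((\<lambda>\<omega>. F (mobius (- x) \<omega>)) \<circ> g)"
    by (intro distr_cong refl) (simp add: g(2))
  also have "\<dots> = distr (distr mu_S2 borel_S2 g) borel_S2 (\<lambda>\<omega>. F (mobius (- x) \<omega>))"
    by (rule distr_distr[OF measurable_pushed[OF x] gm, symmetric])
  also have "\<dots> = pushed x" unfolding distr_mu_S2_orthogonal[OF g(1)] pushed_def ..
  finally show ?thesis by (simp add: barycentric_extension_def F_def M_def)
qed

abbreviation "E \<equiv> barycentric_extension (rational_fun p q)"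

lemma E_balanced:
  assumes x: "norm x < 1"
  shows "norm (E x) < 1" "(\<integral>\<omega>. mobius (E x) (F (mobius (- x) \<omega>)) \<partial>mu_S2) = 0"
proof -
  interpret a: atomless_sphere_prob "pushed x" by (rule atomless_pushed[OF x])
  show 1: "norm (E x) < 1" unfolding barycentric_extension_eq[OF x] by (rule a.barycenter_balanced)
  have m: "mobius (E x) \<in> borel_measurable borel_S2"
    using a.integrable_mobius[OF 1] by (auto cong: measurable_cong_sets)
  have "(\<integral>\<zeta>. mobius (E x) \<zeta> \<partial>pushed x) = 0" unfolding barycentric_extension_eq[OF x] by (rule a.barycenter_balanced)
  then show "(\<integral>\<omega>. mobius (E x) (F (mobius (- x) \<omega>)) \<partial>mu_S2) = 0"
    unfolding pushed_def by (subst (asm) integral_distr[OF measurable_pushed'[OF x] m])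
qed

text \<open>The variance bound enters as an assumption on \<open>c\<close>, so that the same
  constant serves all maps and base points. The quadratic form at \<open>v\<close> follows from the
  unit vector in its direction.\<close>

lemma conjugate_balanced:
  assumes c: "c > 0" "\<And>r s v. poly_pair r s d \<Longrightarrow> norm v = 1 \<Longrightarrow>
      (\<integral>z. chart_density z * (v \<bullet> hopf (poly r z) (poly s z)) \<partial>lborel) = 0 \<Longrightarrow>
      c / real d \<le> (\<integral>z. chart_density z * (1 - (v \<bullet> hopf (poly r z) (poly s z))\<^sup>2) \<partial>lborel)"
    and x: "norm x < 1"
  shows "balanced_sphere_map (\<lambda>\<omega>. mobius (E x) (F (mobius (- x) \<omega>))) (c / real d)"
proof
  define \<phi> where "\<phi> = (\<lambda>\<omega>. mobius (E x) (F (mobius (- x) \<omega>)))"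
  have y: "norm (E x) < 1" by (rule E_balanced[OF x])
  show m: "(\<lambda>\<omega>. mobius (E x) (F (mobius (- x) \<omega>))) \<in> borel_S2 \<rightarrow>\<^sub>M borel_S2"
    by (rule measurable_compose[OF measurable_pushed[OF x] measurable_mobius[OF y]])
  show 0: "(\<integral>\<omega>. mobius (E x) (F (mobius (- x) \<omega>)) \<partial>mu_S2) = 0"
    by (rule E_balanced[OF x])
  show "c / real d > 0" using c d_pos by simp
  fix v :: "real^3"
  show "c / real d * (norm v)\<^sup>2 \<le> (\<integral>\<omega>. (norm v)\<^sup>2 - (v \<bullet> mobius (E x) (F (mobius (- x) \<omega>)))\<^sup>2 \<partial>mu_S2)"
  proof (cases "v = 0")
    case False
    define u where "u = v /\<^sub>R norm v"
    have u: "norm u = 1" "v = norm v *\<^sub>R u" using False by (simp_all add: u_def)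
    obtain r s where rs: "poly_pair r s d" "\<And>z. \<phi> (stereo_inv (Some z)) = hopf (poly r z) (poly s z)"
      using conjugate_poly_pair[OF x y] unfolding \<phi>_def by blast
    have mb[measurable]: "\<phi> \<in> borel_measurable borel_S2"
      using m unfolding \<phi>_def by (rule measurable_restrict_space2_iff[THEN iffD1, THEN conjunct1])
    have n: "norm (\<phi> \<omega>) = 1" if "norm \<omega> = 1" for \<omega>
      using measurable_space[OF m, of \<omega>] that by (simp add: \<phi>_def)
    have i: "integrable mu_S2 \<phi>" by (rule mu_S2.integrable_bounded[OF mb, of 1]) (simp add: n)
    have "(\<integral>z. chart_density z * (u \<bullet> hopf (poly r z) (poly s z)) \<partial>lborel) = (\<integral>\<omega>. u \<bullet> \<phi> \<omega> \<partial>mu_S2)"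
      by (subst integral_mu_S2_chart(1)) (simp_all add: rs)
    also have "\<dots> = 0" using i 0 by (simp add: \<phi>_def integral_inner_right)
    finally have "c / real d \<le> (\<integral>z. chart_density z * (1 - (u \<bullet> hopf (poly r z) (poly s z))\<^sup>2) \<partial>lborel)"
      by (rule c(2)[OF rs(1) u(1)])
    also have "\<dots> = (\<integral>\<omega>. 1 - (u \<bullet> \<phi> \<omega>)\<^sup>2 \<partial>mu_S2)"
      by (subst integral_mu_S2_chart(1)) (simp_all add: rs)
    finally have "(norm v)\<^sup>2 * (c / real d) \<le> (norm v)\<^sup>2 * (\<integral>\<omega>. 1 - (u \<bullet> \<phi> \<omega>)\<^sup>2 \<partial>mu_S2)"
      by (intro mult_left_mono) auto
    also have "\<dots> = (\<integral>\<omega>. (norm v)\<^sup>2 * (1 - (u \<bullet> \<phi> \<omega>)\<^sup>2) \<partial>mu_S2)" by simp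
    also have "\<dots> = (\<integral>\<omega>. (norm v)\<^sup>2 - (v \<bullet> \<phi> \<omega>)\<^sup>2 \<partial>mu_S2)"
    proof (intro Bochner_Integration.integral_cong refl)
      fix \<omega>
      have "v \<bullet> \<phi> \<omega> = norm v * (u \<bullet> \<phi> \<omega>)" by (subst u(2)) simp
      then show "(norm v)\<^sup>2 * (1 - (u \<bullet> \<phi> \<omega>)\<^sup>2) = (norm v)\<^sup>2 - (v \<bullet> \<phi> \<omega>)\<^sup>2" by (simp add: power_mult_distrib algebra_simps)
    qed
    finally show ?thesis by (simp add: \<phi>_def mult.commute)
  qed simp
qed

text \<open>In coordinates centred at \<open>x0\<close> and \<open>E x0\<close>, the extension
  solves the equation of \<open>implicit_derivative\<close>. The translation by \<open>x'\<close> in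
  the source becomes the kernel \<open>poisson x'\<close>, and the rotations from composing
  translations are absorbed by the measure and by linearity.\<close>

lemma conjugate_implicit:
  assumes x0: "norm x0 < 1" and x': "norm x' < 1"
  defines "y' \<equiv> mobius (E x0) (E (mobius (- x0) x'))"
  shows "norm y' < 1"
    "(\<integral>\<omega>. poisson x' \<omega> *\<^sub>R mobius y' (mobius (E x0) (F (mobius (- x0) \<omega>))) \<partial>mu_S2) = 0"
proof -
  define x where "x = mobius (- x0) x'"
  define y0 where "y0 = E x0"
  define y where "y = E x"
  have x: "norm x < 1" unfolding x_def using x0 x' by (intro norm_mobius_less_1) auto
  have y0: "norm y0 < 1" and y: "norm y < 1" using E_balanced x0 x by (simp_all add: y0_def y_def)
  have y'_eq: "y' = mobius y0 y" by (simp add: y'_def y0_def y_def x_def)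
  show y': "norm y' < 1" unfolding y'_eq by (rule norm_mobius_less_1[OF y y0])
  have yy: "mobius (- y0) y' = y" unfolding y'_eq using y y0 by (intro mobius_inverse) auto
  obtain g where g: "orthogonal_transformation g" "\<And>z. norm z = 1 \<Longrightarrow> mobius y' (mobius y0 z) = g (mobius y z)"
    using mobius_comp_to_0[OF y0 y'] unfolding yy by metis
  obtain g' where g': "orthogonal_transformation g'"
    "\<And>z. norm z = 1 \<Longrightarrow> mobius (- x0) (mobius (- x') z) = mobius (- x) (g' z)"
    using mobius_comp_from_0[OF x0 x'] unfolding x_def[symmetric] by metis
  have bl: "bounded_linear g" using g(1) by (simp add: orthogonal_transformation_linear linear_conv_bounded_linear[symmetric])
  have comp: "(\<lambda>\<omega>. mobius v (h \<omega>)) \<in> borel_measurable borel_S2" if "norm v < 1" "h \<in> borel_S2 \<rightarrow>\<^sub>M borel_S2" for v :: "real^3" and h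
    using measurable_compose[OF that(2) measurable_mobius[OF that(1)]]
    by (rule measurable_restrict_space2_iff[THEN iffD1, THEN conjunct1])
  have m1: "(\<lambda>\<omega>. mobius y' (mobius y0 (F (mobius (- x0) \<omega>)))) \<in> borel_measurable borel_S2"
    by (rule comp[OF y' measurable_compose[OF measurable_pushed[OF x0] measurable_mobius[OF y0]]])
  have m2: "(\<lambda>\<omega>. mobius y (F (mobius (- x) \<omega>))) \<in> borel_measurable borel_S2"
    by (rule comp[OF y measurable_pushed[OF x]])
  have i2: "integrable mu_S2 (\<lambda>\<omega>. mobius y (F (mobius (- x) \<omega>)))"
    by (rule mu_S2.integrable_bounded[OF m2, of 1]) (use norm_F norm_mobius_eq_1[OF _ y] in auto)
  have "(\<integral>\<omega>. poisson x' \<omega> *\<^sub>R mobius y' (mobius y0 (F (mobius (- x0) \<omega>))) \<partial>mu_S2)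
    = (\<integral>\<omega>. mobius y' (mobius y0 (F (mobius (- x0) (mobius (- x') \<omega>)))) \<partial>mu_S2)"
    by (rule integral_mu_S2_poisson[OF x' m1, symmetric])
  also have "\<dots> = (\<integral>\<omega>. g (mobius y (F (mobius (- x) (g' \<omega>)))) \<partial>mu_S2)"
    by (intro Bochner_Integration.integral_cong refl) (simp add: g(2) g'(2) norm_F)
  also have "\<dots> = (\<integral>\<omega>. g (mobius y (F (mobius (- x) \<omega>))) \<partial>mu_S2)"
  proof (rule integral_mu_S2_orthogonal[OF g'(1)])
    have "g \<in> borel_measurable borel" using bl by (intro borel_measurable_continuous_onI linear_continuous_on)
    then show "(\<lambda>\<omega>. g (mobius y (F (mobius (- x) \<omega>)))) \<in> borel_measurable borel_S2" by (rule measurable_compose[OF m2])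
  qed
  also have "\<dots> = g (\<integral>\<omega>. mobius y (F (mobius (- x) \<omega>)) \<partial>mu_S2)"
    by (rule integral_bounded_linear[OF bl i2])
  also have "\<dots> = 0"
    using E_balanced(2)[OF x] linear_0[OF orthogonal_transformation_linear[OF g(1)]] by (simp add: y_def)
  finally show "(\<integral>\<omega>. poisson x' \<omega> *\<^sub>R mobius y' (mobius (E x0) (F (mobius (- x0) \<omega>))) \<partial>mu_S2) = 0"
    by (simp add: y0_def)
qed

end

section \<open>Derivatives of translations and the hyperbolic operator norm\<close>

lemma mobius_has_derivative:
  fixes x y :: "'a::real_inner"
  assumes "1 - 2 * (x \<bullet> y) + (x \<bullet> x) * (y \<bullet> y) \<noteq> 0"
  defines "D \<equiv> 1 - 2 * (x \<bullet> y) + (x \<bullet> x) * (y \<bullet> y)"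
    and "N \<equiv> (1 - y \<bullet> y) *\<^sub>R x - (1 - 2 * (x \<bullet> y) + x \<bullet> x) *\<^sub>R y"
  shows "(mobius y has_derivative (\<lambda>v. (((1 - y \<bullet> y) *\<^sub>R v - (2 * (x \<bullet> v) - 2 * (v \<bullet> y)) *\<^sub>R y) /\<^sub>R D
      - ((2 * (x \<bullet> v) * (y \<bullet> y) - 2 * (v \<bullet> y)) / D\<^sup>2) *\<^sub>R N))) (at x)"
proof -
  have D: "((\<lambda>x. inverse (1 - 2 * (x \<bullet> y) + (x \<bullet> x) * (y \<bullet> y))) has_derivative
     (\<lambda>v. - ((2 * (x \<bullet> v) * (y \<bullet> y) - 2 * (v \<bullet> y)) / D\<^sup>2))) (at x)"
  proof -
    have "((\<lambda>x. 1 - 2 * (x \<bullet> y) + (x \<bullet> x) * (y \<bullet> y)) has_derivative (\<lambda>v. 2 * (x \<bullet> v) * (y \<bullet> y) - 2 * (v \<bullet> y))) (at x)"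
      by (auto intro!: derivative_eq_intros simp: fun_eq_iff inner_commute algebra_simps)
    from Deriv.has_derivative_inverse[OF _ this] assms(1) show ?thesis
      by (simp add: D_def divide_inverse power2_eq_square mult_ac)
  qed
  have N: "((\<lambda>x. (1 - y \<bullet> y) *\<^sub>R x - (1 - 2 * (x \<bullet> y) + x \<bullet> x) *\<^sub>R y) has_derivative
     (\<lambda>v. (1 - y \<bullet> y) *\<^sub>R v - (2 * (x \<bullet> v) - 2 * (v \<bullet> y)) *\<^sub>R y)) (at x)"
    by (auto intro!: derivative_eq_intros simp: fun_eq_iff inner_commute algebra_simps)
  have "mobius y = (\<lambda>x. inverse (1 - 2 * (x \<bullet> y) + (x \<bullet> x) * (y \<bullet> y)) *\<^sub>R ((1 - y \<bullet> y) *\<^sub>R x - (1 - 2 * (x \<bullet> y) + x \<bullet> x) *\<^sub>R y))"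
    by (simp add: fun_eq_iff mobius_def power2_norm_eq_inner)
  then show ?thesis
    using has_derivative_scaleR[OF D N] by (simp add: D_def N_def)
qed

text \<open>The numerator \<open>N\<close> vanishes at \<open>y\<close>, which leaves a scaling by
  half the density of the hyperbolic metric at \<open>y\<close>.\<close>

lemma mobius_derivative_self:
  assumes "norm y < 1" shows "(mobius y has_derivative (\<lambda>v. v /\<^sub>R (1 - (norm y)\<^sup>2))) (at y)"
proof -
  define Y where "Y = y \<bullet> y"
  have Y: "Y < 1" using assms by (simp add: Y_def abs_square_less_1 flip: power2_norm_eq_inner)
  have D: "1 - 2 * (y \<bullet> y) + (y \<bullet> y) * (y \<bullet> y) = (1 - Y)\<^sup>2" by (simp add: Y_def power2_eq_square algebra_simps)
  have nz: "1 - 2 * (y \<bullet> y) + (y \<bullet> y) * (y \<bullet> y) \<noteq> 0" unfolding D using Y by simp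
  have N: "(1 - y \<bullet> y) *\<^sub>R y - (1 - 2 * (y \<bullet> y) + y \<bullet> y) *\<^sub>R y = 0" by (simp add: algebra_simps)
  have "(mobius y has_derivative (\<lambda>v. ((1 - Y) *\<^sub>R v) /\<^sub>R (1 - Y)\<^sup>2)) (at y)"
    using mobius_has_derivative[OF nz] unfolding D N by (simp add: inner_commute Y_def[symmetric])
  moreover have "(\<lambda>v. ((1 - Y) *\<^sub>R v) /\<^sub>R (1 - Y)\<^sup>2) = (\<lambda>v :: 'a. v /\<^sub>R (1 - Y))"
  proof
    fix v :: 'a
    have "inverse ((1 - Y)\<^sup>2) * (1 - Y) = inverse (1 - Y)" using Y by (simp add: power2_eq_square)
    then show "((1 - Y) *\<^sub>R v) /\<^sub>R (1 - Y)\<^sup>2 = v /\<^sub>R (1 - Y)" by (simp only: scaleR_scaleR)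
  qed
  ultimately show ?thesis by (simp only: Y_def power2_norm_eq_inner)
qed

lemma mobius_derivative_0: "(mobius (- y) has_derivative (\<lambda>v. (1 - (norm y)\<^sup>2) *\<^sub>R v)) (at 0)"
  using mobius_has_derivative[of 0 "- y"] by (simp add: power2_norm_eq_inner)

context coprime_pair
begin

text \<open>\<open>E\<close> is \<eta> composed with the two translations, whose derivatives are the
  scalings by \<open>1 / X\<close> and \<open>Y\<close>. These are precisely the factors in
  \<open>hyp_norm\<close>, so the hyperbolic norm of the derivative is the Euclidean norm of
  \<open>L\<close>.\<close>

theorem E_derivative:
  assumes c: "c > 0" "\<And>r s v. poly_pair r s d \<Longrightarrow> norm v = 1 \<Longrightarrow>
      (\<integral>z. chart_density z * (v \<bullet> hopf (poly r z) (poly s z)) \<partial>lborel) = 0 \<Longrightarrow>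
      c / real d \<le> (\<integral>z. chart_density z * (1 - (v \<bullet> hopf (poly r z) (poly s z))\<^sup>2) \<partial>lborel)"
    and x0: "norm x0 < 1"
  shows "E differentiable (at x0)" "hyp_onorm x0 (E x0) (frechet_derivative E (at x0)) \<le> 2 / c * real d"
proof -
  define y0 where "y0 = E x0"
  have y0: "norm y0 < 1" using E_balanced x0 by (simp add: y0_def)
  define X where "X = 1 - (norm x0)\<^sup>2"
  define Y where "Y = 1 - (norm y0)\<^sup>2"
  have XY: "X > 0" "Y > 0" using x0 y0 by (simp_all add: X_def Y_def abs_square_less_1)
  define \<eta> where "\<eta> x' = mobius y0 (E (mobius (- x0) x'))" for x'
  interpret b: balanced_sphere_map "\<lambda>\<omega>. mobius (E x0) (F (mobius (- x0) \<omega>))" "c / real d"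
    by (rule conjugate_balanced[OF c x0])
  obtain L where L: "(\<eta> has_derivative L) (at 0)" "\<And>v. norm (L v) \<le> 2 / (c / real d) * norm v"
    using b.implicit_derivative[of \<eta>] conjugate_implicit[OF x0] unfolding \<eta>_def y0_def by blast
  have \<eta>0: "\<eta> 0 = 0" by (simp add: \<eta>_def y0_def)
  have d1: "((\<lambda>x. \<eta> (mobius x0 x)) has_derivative (\<lambda>v. L (v /\<^sub>R X))) (at x0)"
    using has_derivative_compose[OF mobius_derivative_self[OF x0], of \<eta> L] L(1) by (simp add: X_def)
  have "((\<lambda>x. mobius (- y0) (\<eta> (mobius x0 x))) has_derivative (\<lambda>v. Y *\<^sub>R L (v /\<^sub>R X))) (at x0)"
    using has_derivative_compose[OF d1, of "mobius (- y0)" "\<lambda>v. Y *\<^sub>R v"] mobius_derivative_0[of y0] \<eta>0 by (simp add: Y_def)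
  then have dE: "(E has_derivative (\<lambda>v. Y *\<^sub>R L (v /\<^sub>R X))) (at x0)"
  proof (rule has_derivative_transform_within_open[of _ _ _ _ "ball 0 1"])
    fix x :: "real^3" assume "x \<in> ball 0 1"
    then have x: "norm x < 1" by simp
    have "mobius (- x0) (mobius x0 x) = x" using x x0 by (intro mobius_inverse) auto
    moreover have "mobius (- y0) (mobius y0 (E x)) = E x"
      using E_balanced(1)[OF x] y0 by (intro mobius_inverse) auto
    ultimately show "mobius (- y0) (\<eta> (mobius x0 x)) = E x" by (simp add: \<eta>_def)
  qed (use x0 in auto)
  then show "E differentiable (at x0)" by (rule differentiableI)
  have lin: "linear L" using L(1) by (rule has_derivative_linear)
  have "frechet_derivative E (at x0) = (\<lambda>v. Y *\<^sub>R L (v /\<^sub>R X))" by (rule frechet_derivative_at[OF dE, symmetric])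
  moreover have "hyp_norm (E x0) (Y *\<^sub>R L (v /\<^sub>R X)) / hyp_norm x0 v \<le> 2 / c * real d" for v
  proof (cases "v = 0")
    \<comment> \<open>The supremum in \<open>hyp_onorm\<close> includes \<open>v = 0\<close>, where
      the quotient is 0 / 0, hence 0.\<close>
    case True
    then show ?thesis using c d_pos by (simp add: hyp_norm_def)
  next
    case False
    have "hyp_norm (E x0) (Y *\<^sub>R L (v /\<^sub>R X)) = 2 * norm (L v) / X"
      using XY by (simp add: hyp_norm_def linear_scale[OF lin] flip: y0_def Y_def) (simp add: divide_inverse)
    moreover have "hyp_norm x0 v = 2 * norm v / X" by (simp add: hyp_norm_def X_def)
    ultimately have "hyp_norm (E x0) (Y *\<^sub>R L (v /\<^sub>R X)) / hyp_norm x0 v = norm (L v) / norm v" using XY by simp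
    also have "\<dots> \<le> 2 / c * real d" using L(2)[of v] False by (simp add: divide_le_eq)
    finally show ?thesis .
  qed
  ultimately show "hyp_onorm x0 (E x0) (frechet_derivative E (at x0)) \<le> 2 / c * real d"
    unfolding hyp_onorm_def by (intro cSUP_least) auto
qed

end

text \<open>Differentiability is asserted because \<open>frechet_derivative\<close> is meaningful
  only then. The supremum over the ball is taken in \<open>ereal\<close>, where it is genuine
  without prior knowledge of boundedness.\<close>

theorem theorem1p1:
  "\<exists>C::real. C > 0 \<and>
     (\<forall>d::nat. d \<ge> 1 \<longrightarrow>
       (\<forall>f. rational_map_of_degree d f \<longrightarrow>
          barycentric_extension f \<in> ball 0 1 \<rightarrow> ball 0 1 \<and>
          (\<forall>x\<in>ball 0 1. barycentric_extension f differentiable (at x)) \<and>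
          (SUP x\<in>ball 0 1. ereal (hyp_onorm x (barycentric_extension f x)
             (frechet_derivative (barycentric_extension f) (at x)))) \<le> ereal (C * real d)))"
proof -
  obtain c where c: "c > 0" "\<And>p q d v. d \<ge> 1 \<Longrightarrow> poly_pair p q d \<Longrightarrow> norm v = 1 \<Longrightarrow>
    (\<integral>z. chart_density z * (v \<bullet> hopf (poly p z) (poly q z)) \<partial>lborel) = 0 \<Longrightarrow>
    c / real d \<le> (\<integral>z. chart_density z * (1 - (v \<bullet> hopf (poly p z) (poly q z))\<^sup>2) \<partial>lborel)"
    using balanced_variance_bound by blast
  show ?thesis
  proof (intro exI[of _ "2 / c"] conjI allI impI)
    show "2 / c > 0" using c by simp
    fix d :: nat and f assume d: "d \<ge> 1" and f: "rational_map_of_degree d f"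
    obtain p q where pq: "coprime p q" "max (degree p) (degree q) = d" "f = rational_fun p q"
      using f unfolding rational_map_of_degree_def by blast
    interpret coprime_pair p q d using pq d by unfold_locales auto
    show "barycentric_extension f \<in> ball 0 1 \<rightarrow> ball 0 1"
      using E_balanced(1) by (auto simp: pq(3))
    show "\<forall>x\<in>ball 0 1. barycentric_extension f differentiable (at x)"
      unfolding pq(3) by (intro ballI E_derivative(1)[OF c(1)] c(2)[OF d]) auto
    show "(SUP x\<in>ball 0 1. ereal (hyp_onorm x (barycentric_extension f x)
        (frechet_derivative (barycentric_extension f) (at x)))) \<le> ereal (2 / c * real d)"
    proof (rule SUP_least)
      fix x :: "real^3" assume "x \<in> ball 0 1"
      then have "norm x < 1" by simp
      from E_derivative(2)[OF c(1) c(2)[OF d] this]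
      show "ereal (hyp_onorm x (barycentric_extension f x) (frechet_derivative (barycentric_extension f) (at x)))
          \<le> ereal (2 / c * real d)"
        unfolding pq(3) ereal_less_eq by blast
    qed
  qed
qed

end
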